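(* Let $T:X\to X$ be a homeomorphism of a compact metric space. The topological Pinsker algebra $P_{X,T}$ is equal to the set of all $f\in C(X)$ such that $ht(T,f)=0$.
   Context: Topological entropy of covers: for a finite open cover $\mathcal U$ of $X$, let $N(\mathcal U)$ be the smallest cardinality of a subcover and $h_{\mathrm{top}}(T,\mathcal U)=\lim_{n\to\infty}\frac1n\log N(\mathcal U\vee T^{-1}\mathcal U\vee\cdots\vee T^{-(n-1)}\mathcal U)$. A pair $(x,y)\in X\times X$ with $x\ne y$ is an entropy pair if $h_{\mathrm{top}}(T,\mathcal U)>0$ for every two-element open cover $\mathcal U=\{U,V\}$ of $X$ with $x\in\mathrm{int}(X\setminus U)$ and $y\in\mathrm{int}(X\setminus V)$. The topological Pinsker algebra $P_{X,T}$ is the $C^*$-subalgebra of $C(X)$ (complex-valued continuous functions) consisting of all $f\in C(X)$ with $f(x)=f(y)$ for every entropy pair $(x,y)$. Local Voiculescu-Brown entropy: for a $C^*$-algebra $A$ that is exact (e.g. $A=C(X)$), fix a faithful representation $\pi:A\to\mathcal B(\mathcal H)$. For a finite set $\Omega\subset A$ and $\delta>0$, $\mathrm{rcp}(\Omega,\delta)$ is the infimum of $\mathrm{rank}\,B$ over all triples $(\phi,\psi,B)$ where $B$ is a finite-dimensional $C^*$-algebra and $\phi:A\to B$, $\psi:B\to\mathcal B(\mathcal H)$ are contractive completely positive linear maps with $\|(\psi\circ\phi)(x)-\pi(x)\|<\delta$ for all $x\in\Omega$; rank is the dimension of a maximal abelian $C^*$-subalgebra, and the infimum does not depend on $\pi$.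 For an automorphism $\alpha$ of $A$, $ht(\alpha,\Omega)=\sup_{\delta>0}\limsup_{n\to\infty}\frac1n\log\mathrm{rcp}(\Omega\cup\alpha\Omega\cup\cdots\cup\alpha^{n-1}\Omega,\delta)$. Let $\alpha_T$ be the automorphism $f\mapsto f\circ T$ of $C(X)$; then $ht(T,f)$ denotes $ht(\alpha_T,\{f\})$. *)

theory Defs
  imports "HOL-Analysis.Analysis" "HOL-Algebra.Module"
begin

section \<open>Topological entropy, entropy pairs, the topological Pinsker algebra\<close>

definition cover_number :: "'x set set \<Rightarrow> nat" where
  "cover_number \<U> = (LEAST m. \<exists>\<V>\<subseteq>\<U>. finite \<V> \<and> \<Union>\<V> = UNIV \<and> card \<V> = m)"

definition cover_join :: "'x set set \<Rightarrow> 'x set set \<Rightarrow> 'x set set" where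
  "cover_join \<U> \<V> = {U \<inter> V |U V. U \<in> \<U> \<and> V \<in> \<V>}"

text \<open>\<open>cover_iterate T \<U> n\<close> is the join of the preimages of \<open>\<U>\<close> under the iterates of \<open>T\<close>
  with exponents \<open>0, \<dots>, n - 1\<close>; the trivial cover is the neutral element of the join.\<close>

primrec cover_iterate :: "('x \<Rightarrow> 'x) \<Rightarrow> 'x set set \<Rightarrow> nat \<Rightarrow> 'x set set" where
  "cover_iterate T \<U> 0 = {UNIV}"
| "cover_iterate T \<U> (Suc n) = cover_join (cover_iterate T \<U> n) ((\<lambda>U. (T ^^ n) -` U) ` \<U>)"

definition h_top :: "('x \<Rightarrow> 'x) \<Rightarrow> 'x set set \<Rightarrow> real" where
  "h_top T \<U> = lim (\<lambda>n. ln (real (cover_number (cover_iterate T \<U> n))) / real n)"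

definition entropy_pair :: "('x::topological_space \<Rightarrow> 'x) \<Rightarrow> 'x \<Rightarrow> 'x \<Rightarrow> bool" where
  "entropy_pair T x y \<longleftrightarrow>
     x \<noteq> y \<and>
     (\<forall>U V. open U \<and> open V \<and> card {U, V} = 2 \<and> U \<union> V = UNIV \<and>
            x \<in> interior (- U) \<and> y \<in> interior (- V) \<longrightarrow> h_top T {U, V} > 0)"

definition pinsker_algebra :: "('x::topological_space \<Rightarrow> 'x) \<Rightarrow> ('x \<Rightarrow> complex) set" where
  "pinsker_algebra T =
     {f. continuous_on UNIV f \<and> (\<forall>x y. entropy_pair T x y \<longrightarrow> f x = f y)}"


section \<open>C*-algebras\<close>

text \<open>All C*-algebras occurring here (\<open>C(X)\<close> with \<open>X\<close> compact, the bounded operators on a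
  Hilbert space, finite-dimensional C*-algebras) have a unit, so the unit is part of the
  structure. Homomorphisms are not required to preserve it.\<close>

record 'a cstar = "(complex, 'a) module" +
  star :: "'a \<Rightarrow> 'a"
  cnorm :: "'a \<Rightarrow> real"

definition complex_ring :: "complex ring" where
  "complex_ring = \<lparr>carrier = UNIV, mult = (*), one = 1, zero = 0, add = (+)\<rparr>"

locale cstar_algebra = ring A + module complex_ring A for A :: "'a cstar" (structure) +
  assumes smult_mult_left:
      "\<lbrakk>x \<in> carrier A; y \<in> carrier A\<rbrakk> \<Longrightarrow> (c \<odot> x) \<otimes> y = c \<odot> (x \<otimes> y)"
    and smult_mult_right:
      "\<lbrakk>x \<in> carrier A; y \<in> carrier A\<rbrakk> \<Longrightarrow> x \<otimes> (c \<odot> y) = c \<odot> (x \<otimes> y)"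
    and star_closed: "x \<in> carrier A \<Longrightarrow> star A x \<in> carrier A"
    and star_star: "x \<in> carrier A \<Longrightarrow> star A (star A x) = x"
    and star_add:
      "\<lbrakk>x \<in> carrier A; y \<in> carrier A\<rbrakk> \<Longrightarrow> star A (x \<oplus> y) = star A x \<oplus> star A y"
    and star_smult: "x \<in> carrier A \<Longrightarrow> star A (c \<odot> x) = cnj c \<odot> star A x"
    and star_mult:
      "\<lbrakk>x \<in> carrier A; y \<in> carrier A\<rbrakk> \<Longrightarrow> star A (x \<otimes> y) = star A y \<otimes> star A x"
    and cnorm_nonneg: "x \<in> carrier A \<Longrightarrow> cnorm A x \<ge> 0"
    and cnorm_eq_0_iff: "x \<in> carrier A \<Longrightarrow> cnorm A x = 0 \<longleftrightarrow> x = \<zero>"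
    and cnorm_triangle:
      "\<lbrakk>x \<in> carrier A; y \<in> carrier A\<rbrakk> \<Longrightarrow> cnorm A (x \<oplus> y) \<le> cnorm A x + cnorm A y"
    and cnorm_smult: "x \<in> carrier A \<Longrightarrow> cnorm A (c \<odot> x) = cmod c * cnorm A x"
    and cnorm_mult:
      "\<lbrakk>x \<in> carrier A; y \<in> carrier A\<rbrakk> \<Longrightarrow> cnorm A (x \<otimes> y) \<le> cnorm A x * cnorm A y"
    and cstar_identity: "x \<in> carrier A \<Longrightarrow> cnorm A (star A x \<otimes> x) = (cnorm A x)\<^sup>2"
    and cnorm_complete:
      "\<lbrakk>range s \<subseteq> carrier A; \<forall>e>0. \<exists>N. \<forall>m\<ge>N. \<forall>n\<ge>N. cnorm A (s m \<ominus> s n) < e\<rbrakk>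
        \<Longrightarrow> \<exists>x\<in>carrier A. (\<lambda>n. cnorm A (s n \<ominus> x)) \<longlonglongrightarrow> 0"

definition cstar_subalgebra :: "'a cstar \<Rightarrow> 'a set \<Rightarrow> bool" where
  "cstar_subalgebra A D \<longleftrightarrow>
     D \<subseteq> carrier A \<and> \<zero>\<^bsub>A\<^esub> \<in> D \<and>
     (\<forall>x\<in>D. \<forall>y\<in>D. x \<oplus>\<^bsub>A\<^esub> y \<in> D \<and> x \<otimes>\<^bsub>A\<^esub> y \<in> D) \<and>
     (\<forall>c. \<forall>x\<in>D. c \<odot>\<^bsub>A\<^esub> x \<in> D) \<and>
     (\<forall>x\<in>D. star A x \<in> D) \<and>
     (\<forall>s x. range s \<subseteq> D \<and> x \<in> carrier A \<and> (\<lambda>n. cnorm A (s n \<ominus>\<^bsub>A\<^esub> x)) \<longlonglongrightarrow> 0 \<longrightarrow> x \<in> D)"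

definition abelian_cstar_subalgebra :: "'a cstar \<Rightarrow> 'a set \<Rightarrow> bool" where
  "abelian_cstar_subalgebra A D \<longleftrightarrow>
     cstar_subalgebra A D \<and> (\<forall>x\<in>D. \<forall>y\<in>D. x \<otimes>\<^bsub>A\<^esub> y = y \<otimes>\<^bsub>A\<^esub> x)"

definition maximal_abelian_cstar_subalgebra :: "'a cstar \<Rightarrow> 'a set \<Rightarrow> bool" where
  "maximal_abelian_cstar_subalgebra A D \<longleftrightarrow>
     abelian_cstar_subalgebra A D \<and>
     (\<forall>E. abelian_cstar_subalgebra A E \<and> D \<subseteq> E \<longrightarrow> E = D)"

text \<open>The complex linear subspace \<open>D\<close> has a basis with \<open>n\<close> elements.\<close>

definition has_dimension :: "'a cstar \<Rightarrow> 'a set \<Rightarrow> nat \<Rightarrow> bool" where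
  "has_dimension A D n \<longleftrightarrow>
     (\<exists>b. (\<forall>i<n. b i \<in> D) \<and>
          (\<forall>x\<in>D. \<exists>!c. (\<forall>i\<ge>n. c i = 0) \<and> x = (\<Oplus>\<^bsub>A\<^esub>i\<in>{..<n}. c i \<odot>\<^bsub>A\<^esub> b i)))"

definition finite_dimensional :: "'a cstar \<Rightarrow> bool" where
  "finite_dimensional A \<longleftrightarrow> (\<exists>n. has_dimension A (carrier A) n)"

text \<open>For a finite-dimensional C*-algebra, all maximal abelian C*-subalgebras have the same
  dimension, so that \<open>has_rank A r\<close> holds for exactly one \<open>r\<close>.\<close>

definition has_rank :: "'a cstar \<Rightarrow> nat \<Rightarrow> bool" where
  "has_rank A r \<longleftrightarrow> (\<exists>D. maximal_abelian_cstar_subalgebra A D \<and> has_dimension A D r)"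

definition star_homomorphism :: "'a cstar \<Rightarrow> 'b cstar \<Rightarrow> ('a \<Rightarrow> 'b) \<Rightarrow> bool" where
  "star_homomorphism A B \<pi> \<longleftrightarrow>
     \<pi> \<in> carrier A \<rightarrow> carrier B \<and>
     (\<forall>x\<in>carrier A. \<forall>y\<in>carrier A. \<pi> (x \<oplus>\<^bsub>A\<^esub> y) = \<pi> x \<oplus>\<^bsub>B\<^esub> \<pi> y \<and> \<pi> (x \<otimes>\<^bsub>A\<^esub> y) = \<pi> x \<otimes>\<^bsub>B\<^esub> \<pi> y) \<and>
     (\<forall>c. \<forall>x\<in>carrier A. \<pi> (c \<odot>\<^bsub>A\<^esub> x) = c \<odot>\<^bsub>B\<^esub> \<pi> x) \<and>
     (\<forall>x\<in>carrier A. \<pi> (star A x) = star B (\<pi> x))"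

text \<open>The \<open>n \<times> n\<close> matrix \<open>a\<close> over \<open>A\<close> is a positive element of the C*-algebra of \<open>n \<times> n\<close>
  matrices over \<open>A\<close>, i.e. it is the product of the adjoint of some matrix \<open>c\<close> with \<open>c\<close>.\<close>

definition positive_matrix :: "'a cstar \<Rightarrow> nat \<Rightarrow> (nat \<Rightarrow> nat \<Rightarrow> 'a) \<Rightarrow> bool" where
  "positive_matrix A n a \<longleftrightarrow>
     (\<exists>c. (\<forall>i<n. \<forall>j<n. c i j \<in> carrier A) \<and>
          (\<forall>i<n. \<forall>j<n. a i j = (\<Oplus>\<^bsub>A\<^esub>k\<in>{..<n}. star A (c k i) \<otimes>\<^bsub>A\<^esub> c k j)))"

definition contractive_cp :: "'a cstar \<Rightarrow> 'b cstar \<Rightarrow> ('a \<Rightarrow> 'b) \<Rightarrow> bool" where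
  "contractive_cp A B \<phi> \<longleftrightarrow>
     \<phi> \<in> carrier A \<rightarrow> carrier B \<and>
     (\<forall>x\<in>carrier A. \<forall>y\<in>carrier A. \<phi> (x \<oplus>\<^bsub>A\<^esub> y) = \<phi> x \<oplus>\<^bsub>B\<^esub> \<phi> y) \<and>
     (\<forall>c. \<forall>x\<in>carrier A. \<phi> (c \<odot>\<^bsub>A\<^esub> x) = c \<odot>\<^bsub>B\<^esub> \<phi> x) \<and>
     (\<forall>x\<in>carrier A. cnorm B (\<phi> x) \<le> cnorm A x) \<and>
     (\<forall>n a. positive_matrix A n a \<longrightarrow> positive_matrix B n (\<lambda>i j. \<phi> (a i j)))"


section \<open>Hilbert spaces and bounded operators\<close>

text \<open>The inner product is linear in the second argument. Completeness comes from the class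
  \<open>banach\<close>, whose norm is tied to the inner product by \<open>norm_eq_sqrt_cinner\<close>.\<close>

class chilbert_space = banach +
  fixes scaleC :: "complex \<Rightarrow> 'a \<Rightarrow> 'a"
    and cinner :: "'a \<Rightarrow> 'a \<Rightarrow> complex"
  assumes scaleC_add_right: "scaleC c (x + y) = scaleC c x + scaleC c y"
    and scaleC_add_left: "scaleC (c + d) x = scaleC c x + scaleC d x"
    and scaleC_scaleC: "scaleC c (scaleC d x) = scaleC (c * d) x"
    and scaleC_of_real: "scaleC (complex_of_real r) x = scaleR r x"
    and cinner_commute: "cinner x y = cnj (cinner y x)"
    and cinner_add_right: "cinner x (y + z) = cinner x y + cinner x z"
    and cinner_scaleC_right: "cinner x (scaleC c y) = c * cinner x y"
    and cinner_ge_zero: "0 \<le> Re (cinner x x)"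
    and norm_eq_sqrt_cinner: "norm x = sqrt (Re (cinner x x))"

definition bounded_operators :: "('h::chilbert_space \<Rightarrow> 'h) set" where
  "bounded_operators = {S. bounded_linear S \<and> (\<forall>c x. S (scaleC c x) = scaleC c (S x))}"

definition operator_algebra :: "('h::chilbert_space \<Rightarrow> 'h) cstar" where
  "operator_algebra =
     \<lparr>carrier = bounded_operators,
      mult = (\<lambda>S R. S \<circ> R),
      one = id,
      zero = (\<lambda>x. 0),
      add = (\<lambda>S R x. S x + R x),
      smult = (\<lambda>c S x. scaleC c (S x)),
      star = (\<lambda>S. THE R. R \<in> bounded_operators \<and> (\<forall>x y. cinner (R x) y = cinner x (S y))),
      cnorm = onorm\<rparr>"

definition faithful_representation :: "'a cstar \<Rightarrow> ('a \<Rightarrow> 'h::chilbert_space \<Rightarrow> 'h) \<Rightarrow> bool" where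
  "faithful_representation A \<pi> \<longleftrightarrow>
     star_homomorphism A operator_algebra \<pi> \<and> inj_on \<pi> (carrier A)"

text \<open>The C*-algebra \<open>C(X)\<close>, where \<open>X\<close> is the (compact) type \<open>'x\<close>.\<close>

definition continuous_functions :: "('x::topological_space \<Rightarrow> complex) cstar" where
  "continuous_functions =
     \<lparr>carrier = {f. continuous_on UNIV f},
      mult = (\<lambda>f g x. f x * g x),
      one = (\<lambda>x. 1),
      zero = (\<lambda>x. 0),
      add = (\<lambda>f g x. f x + g x),
      smult = (\<lambda>c f x. c * f x),
      star = (\<lambda>f x. cnj (f x)),
      cnorm = (\<lambda>f. SUP x. cmod (f x))\<rparr>"


section \<open>Local Voiculescu-Brown entropy\<close>

text \<open>The finite-dimensional C*-algebra \<open>B\<close> is an abstract one whose elements are of type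
  \<open>nat \<Rightarrow> complex\<close>; by transport along a linear bijection onto sequences supported in an initial
  segment, every finite-dimensional C*-algebra is isomorphic to one of these. It is nonzero:
  otherwise \<open>rcp {0} \<delta>\<close> would be \<open>0\<close> instead of \<open>1\<close>, with an undefined logarithm.
  When \<open>A\<close> is exact, \<open>\<Omega>\<close> finite and \<open>\<delta>\<close> positive, the infimum is over a nonempty set.\<close>

definition rcp ::
    "'a cstar \<Rightarrow> ('a \<Rightarrow> 'h::chilbert_space \<Rightarrow> 'h) \<Rightarrow> 'a set \<Rightarrow> real \<Rightarrow> nat" where
  "rcp A \<pi> \<Omega> \<delta> =
     Inf {r. \<exists>(B :: (nat \<Rightarrow> complex) cstar) \<phi> \<psi>.
            cstar_algebra B \<and> finite_dimensional B \<and> \<one>\<^bsub>B\<^esub> \<noteq> \<zero>\<^bsub>B\<^esub> \<and>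
            contractive_cp A B \<phi> \<and> contractive_cp B operator_algebra \<psi> \<and>
            (\<forall>x\<in>\<Omega>. onorm (\<lambda>h. \<psi> (\<phi> x) h - \<pi> x h) < \<delta>) \<and>
            has_rank B r}"

definition ht ::
    "'a cstar \<Rightarrow> ('a \<Rightarrow> 'h::chilbert_space \<Rightarrow> 'h) \<Rightarrow> ('a \<Rightarrow> 'a) \<Rightarrow> 'a set \<Rightarrow> ereal" where
  "ht A \<pi> \<alpha> \<Omega> =
     (SUP \<delta>\<in>{0<..}. limsup (\<lambda>n.
        ereal (ln (real (rcp A \<pi> (\<Union>k<n. (\<alpha> ^^ k) ` \<Omega>) \<delta>)) / real n)))"

definition induced_automorphism :: "('x \<Rightarrow> 'x) \<Rightarrow> ('x \<Rightarrow> complex) \<Rightarrow> 'x \<Rightarrow> complex" where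
  "induced_automorphism T f = f \<circ> T"

end

theory Submission
  imports Defs "HOL-Computational_Algebra.Fundamental_Theorem_Algebra"
begin

text \<open>Let \<open>f\<close> take the same value at the two points of every entropy pair. By Blanchard's theorem
  the covers \<open>{- F, - G}\<close> with \<open>F = {\<bar>f - c\<bar> \<le> \<delta>/8}\<close> and \<open>G = {\<bar>f - c\<bar> \<ge> \<delta>/4}\<close> have entropy zero, hence so
  does their join over a finite net of values \<open>c\<close>. The partitions of unity subordinate to its iterates
  factor the orbit of \<open>f\<close> up to \<open>\<delta>\<close> through algebras \<open>\<complex>\<^sup>N\<close> with \<open>N\<close> growing subexponentially.

  Conversely, if \<open>f\<close> separates an entropy pair, a combinatorial lemma of Sauer--Shelah type yields sets
  \<open>J \<subseteq> {0..<n}\<close> of positive density such that the \<open>f \<circ> T\<^sup>k\<close> with \<open>k \<in> J\<close> take values near \<open>f x\<close> and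
  \<open>f y\<close> in all combinations, so that all sums of the \<open>f \<circ> T\<^sup>k\<close> with signs have norm at least a multiple of
  \<open>card J\<close>. This persists in every finite-dimensional algebra through which they factor
  approximately. There, the trace method applied to random signs (with the compressions to minimal
  projections of a maximal abelian subalgebra in place of the trace) shows that the rank is
  exponential in \<open>card J\<close>.\<close>


section \<open>Entropy of open covers\<close>

text \<open>The algebra \<open>B\<close> in \<open>rcp\<close> is abstract, with its rank read off
  from a maximal abelian subalgebra. The lower bound therefore works inside \<open>B\<close> without
  splitting it into matrix blocks: the compression to a minimal projection \<open>p\<close> is a
  functional, because \<open>p b p\<close> is always a multiple of \<open>p\<close>.

  The upper bound meets another obstacle. A positive matrix has to be the product of the adjoint of
  an \<open>n\<close> by \<open>n\<close> matrix with that matrix, whereas averaging against a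
  partition of unity with \<open>N\<close> members yields a Gram matrix of \<open>n * N\<close>
  rows. Continuous square roots bring it back to \<open>n\<close> rows.

  The lower bound does not depend on the structure of \<open>B\<close> because the noncommutative
  moments are compared termwise with scalar ones: the mean of a word in the signs is never negative,
  so all coefficients may be replaced by their common bound. For \<open>m\<close> functions the
  scalar moment of order \<open>2 * L\<close> is of order \<open>(L * m) ^ L\<close>, against a
  lower bound of order \<open>m ^ (2 * L)\<close>. With \<open>L\<close> a small multiple of
  \<open>m\<close> a factor \<open>2 ^ L\<close> is left over, which only the rank can
  absorb.\<close>

lemma subadditive_bound:
  fixes a :: "nat \<Rightarrow> real"
  assumes sub: "\<And>n m. a (n + m) \<le> a n + a m"
  shows "a (q * k + r) \<le> real q * a k + a r"
proof (induction q)
  case (Suc q)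
  have "a (Suc q * k + r) = a (k + (q * k + r))" by (simp add: algebra_simps)
  also have "\<dots> \<le> a k + a (q * k + r)" by (rule sub)
  also have "\<dots> \<le> real (Suc q) * a k + a r" using Suc by (simp add: algebra_simps)
  finally show ?case .
qed simp

text \<open>Fekete's lemma. Division with remainder by a \<open>k\<close> that nearly realises the
  infimum compares \<open>a n / n\<close> with \<open>a k / k\<close> up to a remainder that stays
  bounded.\<close>

lemma fekete_convergent:
  fixes a :: "nat \<Rightarrow> real"
  assumes sub: "\<And>n m. a (n + m) \<le> a n + a m" and nonneg: "\<And>n. a n \<ge> 0"
  shows "convergent (\<lambda>n. a n / real n)"
proof -
  \<comment> \<open>The index 0 is excluded: there the quotient is 0 by convention and would spoil
    the infimum.\<close>
  define L where "L = (INF n\<in>{1..}. a n / real n)"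
  have bdd: "bdd_below ((\<lambda>n. a n / real n) ` {1..})"
    by (rule bdd_belowI2[where m = 0]) (simp add: nonneg)
  have low: "L \<le> a n / real n" if "n \<ge> 1" for n
    unfolding L_def by (rule cINF_lower[OF bdd]) (use that in simp)
  have "(\<lambda>n. a n / real n) \<longlonglongrightarrow> L"
  proof (rule LIMSEQ_I)
    fix e :: real assume e: "e > 0"
    have "\<exists>k\<in>{1..}. a k / real k < L + e / 2"
      using cINF_less_iff[of "{1::nat..}" "\<lambda>n. a n / real n" "L + e/2"] bdd e
      by (auto simp: L_def)
    then obtain k where k: "k \<ge> 1" "a k / real k < L + e / 2" by auto
    define M where "M = (\<Sum>r<k. a r)"
    have M: "a r \<le> M" if "r < k" for r
      unfolding M_def by (rule member_le_sum) (use that nonneg in auto)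
    have M0: "M \<ge> 0" unfolding M_def by (simp add: sum_nonneg nonneg)
    obtain n0 :: nat where n0: "real n0 > 2 * M / e" using reals_Archimedean2 by blast
    show "\<exists>no. \<forall>n\<ge>no. norm (a n / real n - L) < e"
    proof (intro exI allI impI)
      fix n assume n: "n \<ge> max n0 1"
      define q r where "q = n div k" and "r = n mod k"
      have qr: "q * k + r = n" "r < k" using k by (auto simp: q_def r_def)
      have "a n \<le> real q * a k + a r"
        using subadditive_bound[of a q k r, OF sub] qr by simp
      also have "\<dots> \<le> real q * a k + M" using M qr by simp
      also have "real q * a k = real (q * k) * (a k / real k)" using k by simp
      also have "\<dots> \<le> real n * (a k / real k)"
        by (rule mult_right_mono) (use qr nonneg[of k] in auto)
      finally have 1: "a n \<le> real n * (a k / real k) + M" by simp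
      have np: "real n > 0" using n by simp
      have "a n / real n \<le> a k / real k + M / real n"
        using divide_right_mono[OF 1, of "real n"] np by (simp add: add_divide_distrib)
      moreover have "M / real n < e / 2"
      proof -
        have "2 * M / e < real n" using n0 n by linarith
        then have "2 * M < real n * e" using e by (simp add: divide_simps)
        then show ?thesis using np by (simp add: divide_simps mult.commute)
      qed
      ultimately have "a n / real n < L + e" using k by linarith
      moreover have "L \<le> a n / real n" using low n by simp
      ultimately show "norm (a n / real n - L) < e" by simp
    qed
  qed
  then show ?thesis by (rule convergentI)
qed

section \<open>Minimal subcovers, joins and iterated covers\<close>

lemma cover_number_le:
  assumes "\<V> \<subseteq> \<U>" "finite \<V>" "\<Union>\<V> = UNIV"
  shows "cover_number \<U> \<le> card \<V>"
  unfolding cover_number_def by (rule Least_le) (use assms in blast)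

lemma cover_number_attained:
  assumes "finite \<U>" "\<Union>\<U> = UNIV"
  obtains \<V> where "\<V> \<subseteq> \<U>" "finite \<V>" "\<Union>\<V> = UNIV" "card \<V> = cover_number \<U>"
proof -
  have "\<exists>m. \<exists>\<V>\<subseteq>\<U>. finite \<V> \<and> \<Union>\<V> = UNIV \<and> card \<V> = m" using assms by blast
  from LeastI_ex[OF this] show ?thesis unfolding cover_number_def[symmetric] using that by blast
qed

lemma cover_number_pos:
  assumes "finite \<U>" "\<Union>\<U> = UNIV"
  shows "cover_number \<U> \<ge> 1"
proof -
  obtain \<V> where "\<V> \<subseteq> \<U>" "finite \<V>" "\<Union>\<V> = UNIV" "card \<V> = cover_number \<U>"
    by (rule cover_number_attained[OF assms])
  moreover from this have "\<V> \<noteq> {}" by auto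
  ultimately show ?thesis by (metis One_nat_def Suc_leI card_gt_0_iff)
qed

text \<open>The maps \<open>S i\<close> let one lemma serve both the join along time, with
  \<open>S i\<close> an iterate of \<open>T\<close>, and the join of several covers, with
  \<open>S i\<close> the identity. Choosing one set from an optimal subcover for every index gives
  at most the product of their sizes many intersections, each inside a member of
  \<open>\<W>\<close>.\<close>

lemma cover_number_le_prod:
  fixes S :: "'i \<Rightarrow> 'x \<Rightarrow> 'y"
  assumes I: "finite I" and fin: "\<And>i. i \<in> I \<Longrightarrow> finite (\<U> i)"
    and cov: "\<And>i. i \<in> I \<Longrightarrow> \<Union>(\<U> i) = UNIV"
    and ref: "\<And>u. (\<And>i. i \<in> I \<Longrightarrow> u i \<in> \<U> i) \<Longrightarrow> \<exists>W\<in>\<W>. (\<Inter>i\<in>I. S i -` u i) \<subseteq> W"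
  shows "cover_number \<W> \<le> (\<Prod>i\<in>I. cover_number (\<U> i))"
proof -
  have "\<forall>i\<in>I. \<exists>\<V>. \<V> \<subseteq> \<U> i \<and> finite \<V> \<and> \<Union>\<V> = UNIV \<and> card \<V> = cover_number (\<U> i)"
    using cover_number_attained[OF fin cov] by metis
  then obtain \<V> where \<V>: "\<And>i. i \<in> I \<Longrightarrow> \<V> i \<subseteq> \<U> i \<and> finite (\<V> i) \<and> \<Union>(\<V> i) = UNIV \<and> card (\<V> i) = cover_number (\<U> i)"
    by metis
  define w where "w u = (SOME W. W \<in> \<W> \<and> (\<Inter>i\<in>I. S i -` u i) \<subseteq> W)" for u
  have w: "w u \<in> \<W> \<and> (\<Inter>i\<in>I. S i -` u i) \<subseteq> w u" if "u \<in> PiE I \<V>" for u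
    unfolding w_def
  proof (rule someI_ex)
    have "\<And>i. i \<in> I \<Longrightarrow> u i \<in> \<U> i" using that \<V> by (meson PiE_mem subsetD)
    from ref[OF this] show "\<exists>W. W \<in> \<W> \<and> (\<Inter>i\<in>I. S i -` u i) \<subseteq> W" by blast
  qed
  have fP: "finite (PiE I \<V>)" using I \<V> by (intro finite_PiE) auto
  have "\<Union>(w ` PiE I \<V>) = UNIV"
  proof (rule UNIV_eq_I[symmetric])
    fix x
    have "\<forall>i\<in>I. \<exists>U\<in>\<V> i. S i x \<in> U" using \<V> by blast
    then obtain u where u: "\<And>i. i \<in> I \<Longrightarrow> u i \<in> \<V> i \<and> S i x \<in> u i" by metis
    define u' where "u' = restrict u I"
    have "u' \<in> PiE I \<V>" "x \<in> (\<Inter>i\<in>I. S i -` u' i)" using u by (auto simp: u'_def)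
    with w show "x \<in> \<Union>(w ` PiE I \<V>)" by blast
  qed
  then have "cover_number \<W> \<le> card (w ` PiE I \<V>)"
    by (intro cover_number_le) (use w fP in auto)
  also have "\<dots> \<le> card (PiE I \<V>)" by (rule card_image_le[OF fP])
  also have "\<dots> = (\<Prod>i\<in>I. cover_number (\<U> i))" using I \<V> by (simp add: card_PiE)
  finally show ?thesis .
qed

lemma cover_iterate_eq:
  "cover_iterate T \<U> n = {(\<Inter>k<n. (T ^^ k) -` u k) |u. \<forall>k<n. u k \<in> \<U>}"
proof (induction n)
  case (Suc n)
  show ?case
  proof (intro equalityI subsetI)
    fix A assume "A \<in> cover_iterate T \<U> (Suc n)"
    then obtain u V where u: "A = (\<Inter>k<n. (T ^^ k) -` u k) \<inter> (T ^^ n) -` V" "\<forall>k<n. u k \<in> \<U>" "V \<in> \<U>"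
      by (auto simp: cover_join_def Suc)
    then have "A = (\<Inter>k<Suc n. (T ^^ k) -` (u(n := V)) k)" "\<forall>k<Suc n. (u(n := V)) k \<in> \<U>"
      by (auto simp: lessThan_Suc)
    then show "A \<in> {(\<Inter>k<Suc n. (T ^^ k) -` u k) |u. \<forall>k<Suc n. u k \<in> \<U>}" by blast
  next
    fix A assume "A \<in> {(\<Inter>k<Suc n. (T ^^ k) -` u k) |u. \<forall>k<Suc n. u k \<in> \<U>}"
    then obtain u where u: "A = (\<Inter>k<Suc n. (T ^^ k) -` u k)" "\<forall>k<Suc n. u k \<in> \<U>" by blast
    then have "A = (\<Inter>k<n. (T ^^ k) -` u k) \<inter> (T ^^ n) -` u n" by (auto simp: lessThan_Suc)
    moreover have "(\<Inter>k<n. (T ^^ k) -` u k) \<in> cover_iterate T \<U> n" using u by (auto simp: Suc)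
    moreover have "u n \<in> \<U>" using u by auto
    ultimately show "A \<in> cover_iterate T \<U> (Suc n)" unfolding cover_iterate.simps cover_join_def by blast
  qed
qed simp

lemma finite_cover_iterate: "finite \<U> \<Longrightarrow> finite (cover_iterate T \<U> n)"
proof (induction n)
  case (Suc n)
  have "cover_iterate T \<U> (Suc n) =
      (\<lambda>(U, V). U \<inter> V) ` (cover_iterate T \<U> n \<times> (\<lambda>U. (T ^^ n) -` U) ` \<U>)"
    by (auto simp: cover_join_def)
  then show ?case using Suc by (simp del: cover_iterate.simps)
qed simp

lemma Union_cover_iterate:
  assumes "\<Union>\<U> = UNIV" shows "\<Union>(cover_iterate T \<U> n) = UNIV"
proof (rule UNIV_eq_I[symmetric])
  fix x
  have "\<forall>k. \<exists>U\<in>\<U>. (T ^^ k) x \<in> U" using assms by blast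
  then obtain u where u: "\<And>k. u k \<in> \<U> \<and> (T ^^ k) x \<in> u k" by metis
  have "(\<Inter>k<n. (T ^^ k) -` u k) \<in> cover_iterate T \<U> n"
    unfolding cover_iterate_eq using u by blast
  moreover have "x \<in> (\<Inter>k<n. (T ^^ k) -` u k)" using u by simp
  ultimately show "x \<in> \<Union>(cover_iterate T \<U> n)" by blast
qed

lemma cover_number_iterate_add:
  assumes "finite \<U>" "\<Union>\<U> = UNIV"
  shows "cover_number (cover_iterate T \<U> (n + m))
       \<le> cover_number (cover_iterate T \<U> n) * cover_number (cover_iterate T \<U> m)"
proof -
  have "cover_number (cover_iterate T \<U> (n + m))
      \<le> (\<Prod>b\<in>{False, True}. cover_number (cover_iterate T \<U> (if b then m else n)))"
  proof (rule cover_number_le_prod[where S = "\<lambda>b. if b then T ^^ n else id"])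
    fix u assume "\<And>b. b \<in> {False, True} \<Longrightarrow> u b \<in> cover_iterate T \<U> (if b then m else n)"
    from this[of False] this[of True]
    obtain v w where v: "u False = (\<Inter>k<n. (T ^^ k) -` v k)" "\<forall>k<n. v k \<in> \<U>"
      and w: "u True = (\<Inter>k<m. (T ^^ k) -` w k)" "\<forall>k<m. w k \<in> \<U>"
      unfolding cover_iterate_eq by auto
    define z where "z k = (if k < n then v k else w (k - n))" for k
    have "(\<Inter>k<n+m. (T ^^ k) -` z k) \<in> cover_iterate T \<U> (n + m)"
      unfolding cover_iterate_eq using v w by (auto simp: z_def)
    moreover have "u False \<inter> (T ^^ n) -` u True \<subseteq> (\<Inter>k<n+m. (T ^^ k) -` z k)"
    proof (intro subsetI INT_I)
      fix x k assume x: "x \<in> u False \<inter> (T ^^ n) -` u True" and k: "k \<in> {..<n+m}"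
      show "x \<in> (T ^^ k) -` z k"
      proof (cases "k < n")
        case True then show ?thesis using x v by (auto simp: z_def)
      next
        case False
        have "(T ^^ (k - n)) ((T ^^ n) x) = (T ^^ k) x"
          using False by (metis comp_apply funpow_add le_add_diff_inverse2 not_less)
        moreover have "(T ^^ (k - n)) ((T ^^ n) x) \<in> w (k - n)" using x w k False by auto
        ultimately show ?thesis using False by (simp add: z_def)
      qed
    qed
    ultimately show "\<exists>W\<in>cover_iterate T \<U> (n + m). (\<Inter>b\<in>{False, True}. (if b then T ^^ n else id) -` u b) \<subseteq> W"
      by (intro bexI) auto
  qed (auto simp: finite_cover_iterate Union_cover_iterate assms)
  then show ?thesis by simp
qed

text \<open>The \<open>lim\<close> in the definition of \<open>h_top\<close> says something only
  once convergence is known; it follows from submultiplicativity of the cover numbers.\<close>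

lemma h_top_limit:
  assumes "finite \<U>" "\<Union>\<U> = UNIV"
  shows "(\<lambda>n. ln (real (cover_number (cover_iterate T \<U> n))) / real n) \<longlonglongrightarrow> h_top T \<U>"
proof -
  let ?N = "\<lambda>n. cover_number (cover_iterate T \<U> n)"
  have N1: "?N n \<ge> 1" for n
    by (intro cover_number_pos finite_cover_iterate Union_cover_iterate assms)
  have "convergent (\<lambda>n. ln (real (?N n)) / real n)"
  proof (rule fekete_convergent)
    fix n m
    have "real (?N (n + m)) \<le> real (?N n) * real (?N m)"
      using cover_number_iterate_add[OF assms, of T n m]
      by (simp only: of_nat_mult[symmetric] of_nat_le_iff)
    then have "ln (real (?N (n + m))) \<le> ln (real (?N n) * real (?N m))"
      using N1[of "n+m"] by (intro ln_mono) auto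
    also have "\<dots> = ln (real (?N n)) + ln (real (?N m))"
      using N1[of n] N1[of m] by (intro ln_mult_pos) auto
    finally show "ln (real (?N (n + m))) \<le> ln (real (?N n)) + ln (real (?N m))" .
  next
    fix n show "0 \<le> ln (real (?N n))" using N1[of n] by simp
  qed
  then show ?thesis unfolding h_top_def by (simp add: convergent_LIMSEQ_iff)
qed

lemma cover_number_iterate_le_prod:
  assumes I: "finite I" and fin: "\<And>i. i \<in> I \<Longrightarrow> finite (\<U> i)"
    and cov: "\<And>i. i \<in> I \<Longrightarrow> \<Union>(\<U> i) = UNIV"
    and ref: "\<And>u. (\<And>i. i \<in> I \<Longrightarrow> u i \<in> \<U> i) \<Longrightarrow> \<exists>W\<in>\<W>. (\<Inter>i\<in>I. u i) \<subseteq> W"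
  shows "cover_number (cover_iterate T \<W> n) \<le> (\<Prod>i\<in>I. cover_number (cover_iterate T (\<U> i) n))"
proof (rule cover_number_le_prod[where S = "\<lambda>_. id"])
  fix u assume "\<And>i. i \<in> I \<Longrightarrow> u i \<in> cover_iterate T (\<U> i) n"
  then have "\<forall>i\<in>I. \<exists>v. u i = (\<Inter>k<n. (T ^^ k) -` v k) \<and> (\<forall>k<n. v k \<in> \<U> i)"
    unfolding cover_iterate_eq by blast
  then obtain v where v: "\<And>i. i \<in> I \<Longrightarrow> u i = (\<Inter>k<n. (T ^^ k) -` v i k) \<and> (\<forall>k<n. v i k \<in> \<U> i)"
    by metis
  have "\<forall>k. \<exists>W. k < n \<longrightarrow> W \<in> \<W> \<and> (\<Inter>i\<in>I. v i k) \<subseteq> W"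
  proof
    fix k
    have "\<exists>W\<in>\<W>. (\<Inter>i\<in>I. v i k) \<subseteq> W" if "k < n" by (rule ref) (use v that in blast)
    then show "\<exists>W. k < n \<longrightarrow> W \<in> \<W> \<and> (\<Inter>i\<in>I. v i k) \<subseteq> W" by blast
  qed
  then obtain W where W: "\<And>k. k < n \<Longrightarrow> W k \<in> \<W> \<and> (\<Inter>i\<in>I. v i k) \<subseteq> W k" by metis
  have "(\<Inter>k<n. (T ^^ k) -` W k) \<in> cover_iterate T \<W> n"
    unfolding cover_iterate_eq using W by blast
  moreover have "(\<Inter>i\<in>I. id -` u i) \<subseteq> (\<Inter>k<n. (T ^^ k) -` W k)"
    using v W by fastforce
  ultimately show "\<exists>W\<in>cover_iterate T \<W> n. (\<Inter>i\<in>I. id -` u i) \<subseteq> W" by blast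
qed (auto simp: finite_cover_iterate Union_cover_iterate fin cov I)

text \<open>The refinement hypothesis says that the join of the covers \<open>\<U> i\<close> refines
  \<open>\<W>\<close>. This combines subadditivity under joins with monotonicity under
  refinement.\<close>

lemma h_top_le_sum:
  assumes I: "finite I" and fin: "\<And>i. i \<in> I \<Longrightarrow> finite (\<U> i)"
    and cov: "\<And>i. i \<in> I \<Longrightarrow> \<Union>(\<U> i) = UNIV"
    and ref: "\<And>u. (\<And>i. i \<in> I \<Longrightarrow> u i \<in> \<U> i) \<Longrightarrow> \<exists>W\<in>\<W>. (\<Inter>i\<in>I. u i) \<subseteq> W"
    and W: "finite \<W>" "\<Union>\<W> = UNIV"
  shows "h_top T \<W> \<le> (\<Sum>i\<in>I. h_top T (\<U> i))"
proof (rule LIMSEQ_le[OF h_top_limit[OF W] tendsto_sum[OF h_top_limit[OF fin cov]]])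
  let ?N = "\<lambda>\<U> n. cover_number (cover_iterate T \<U> n)"
  have "ln (real (?N \<W> n)) / real n \<le> (\<Sum>i\<in>I. ln (real (?N (\<U> i) n)) / real n)" for n
  proof -
    have pos: "?N (\<U> i) n \<ge> 1" if "i \<in> I" for i
      by (intro cover_number_pos finite_cover_iterate Union_cover_iterate fin cov that)
    have "?N \<W> n \<ge> 1" by (intro cover_number_pos finite_cover_iterate Union_cover_iterate W)
    moreover have "real (?N \<W> n) \<le> (\<Prod>i\<in>I. real (?N (\<U> i) n))"
      using cover_number_iterate_le_prod[OF I fin cov ref, where T = T and n = n]
      by (simp only: of_nat_prod[symmetric] of_nat_le_iff)
    ultimately have "ln (real (?N \<W> n)) \<le> ln (\<Prod>i\<in>I. real (?N (\<U> i) n))"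
      by (intro ln_mono) auto
    also have "\<dots> = (\<Sum>i\<in>I. ln (real (?N (\<U> i) n)))"
      using pos I by (intro ln_prod) force+
    finally show ?thesis by (simp add: sum_divide_distrib[symmetric] divide_right_mono)
  qed
  then show "\<exists>N. \<forall>n\<ge>N. ln (real (?N \<W> n)) / real n \<le> (\<Sum>i\<in>I. ln (real (?N (\<U> i) n)) / real n)" by blast
qed

lemma h_top_nonneg:
  assumes "finite \<U>" "\<Union>\<U> = UNIV" shows "h_top T \<U> \<ge> 0"
proof (rule LIMSEQ_le_const[OF h_top_limit[OF assms]])
  have "cover_number (cover_iterate T \<U> n) \<ge> 1" for n
    by (intro cover_number_pos finite_cover_iterate Union_cover_iterate assms)
  then show "\<exists>N. \<forall>n\<ge>N. 0 \<le> ln (real (cover_number (cover_iterate T \<U> n))) / real n"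
    by (intro exI[of _ 0] allI impI divide_nonneg_nonneg ln_ge_zero) (simp_all del: One_nat_def)
qed

lemma h_top_insert_UNIV:
  fixes T :: "'x \<Rightarrow> 'x"
  assumes "finite \<U>" "UNIV \<in> \<U>" shows "h_top T \<U> = 0"
proof -
  \<comment> \<open>The join of no covers is the trivial cover, which refines \<open>\<U>\<close>
    because the whole space is a member.\<close>
  have "h_top T \<U> \<le> (\<Sum>i\<in>({} :: nat set). h_top T ({} :: 'x set set))"
    by (rule h_top_le_sum) (use assms in auto)
  moreover have "h_top T \<U> \<ge> 0" by (rule h_top_nonneg) (use assms in auto)
  ultimately show ?thesis by simp
qed

text \<open>Localisation of entropy: when \<open>F\<close> is cut into finitely many small pieces,
  the join of the covers belonging to the pieces refines the cover belonging to \<open>F\<close>, so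
  one of the pieces must carry positive entropy.\<close>

lemma h_top_pos_shrink:
  fixes T :: "'x::metric_space \<Rightarrow> 'x"
  assumes "compact F" "F \<inter> G = {}" "h_top T {- F, - G} > 0" "e > 0"
  obtains c where "h_top T {- (F \<inter> cball c e), - G} > 0"
proof -
  have "\<exists>k. finite k \<and> F \<subseteq> (\<Union>x\<in>k. ball x e)"
  proof (rule compactE_image[OF assms(1), of F "\<lambda>x. ball x e"])
    show "F \<subseteq> (\<Union>c\<in>F. ball c e)" using assms(4) by force
  qed blast+
  then obtain k where k: "finite k" "F \<subseteq> (\<Union>x\<in>k. ball x e)" by blast
  have "h_top T {- F, - G} \<le> (\<Sum>c\<in>k. h_top T {- (F \<inter> cball c e), - G})"
  proof (rule h_top_le_sum)
    fix u assume u: "\<And>i. i \<in> k \<Longrightarrow> u i \<in> {- (F \<inter> cball i e), - G}"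
    show "\<exists>W\<in>{- F, - G}. (\<Inter>i\<in>k. u i) \<subseteq> W"
    proof (cases "\<exists>i\<in>k. u i = - G")
      case True then show ?thesis by blast
    next
      case False
      then have "u i = - (F \<inter> cball i e)" if "i \<in> k" for i using u that by blast
      then have "(\<Inter>i\<in>k. u i) = (\<Inter>i\<in>k. - (F \<inter> cball i e))" by simp
      also have "\<dots> \<subseteq> - F" using k(2) ball_subset_cball by blast
      finally have "(\<Inter>i\<in>k. u i) \<subseteq> - F" .
      then show ?thesis by blast
    qed
  qed (use assms k in auto)
  then have "(\<Sum>c\<in>k. h_top T {- (F \<inter> cball c e), - G}) > 0" using assms(3) by linarith
  then obtain c where "h_top T {- (F \<inter> cball c e), - G} > 0"
    by (meson linorder_not_less sum_nonpos)
  then show ?thesis by (rule that)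
qed


section \<open>Entropy pairs and independence\<close>

text \<open>Blanchard's localisation. Shrinking both sets alternately keeps the entropy positive,
  and compactness provides a limit point on either side; a test cover of these two points is finer
  than the covers of the late stages.\<close>

lemma entropy_pair_exists:
  fixes T :: "'x::metric_space \<Rightarrow> 'x"
  assumes X: "compact (UNIV :: 'x set)" and F: "closed F" and G: "closed G" and disj: "F \<inter> G = {}"
    and h: "h_top T {- F, - G} > 0"
  obtains x y where "x \<in> F" "y \<in> G" "entropy_pair T x y"
proof -
  define P where "P s \<longleftrightarrow> closed (fst s) \<and> closed (snd s) \<and> fst s \<subseteq> F \<and> snd s \<subseteq> G \<and>
    h_top T {- fst s, - snd s} > 0" for s :: "'x set \<times> 'x set"
  define Q where "Q n s t \<longleftrightarrow> fst t \<subseteq> fst s \<and> snd t \<subseteq> snd s \<and>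
    (\<exists>c. fst t \<subseteq> cball c (1 / real (Suc n))) \<and> (\<exists>c. snd t \<subseteq> cball c (1 / real (Suc n)))"
    for n and s t :: "'x set \<times> 'x set"
  have "\<exists>s. \<forall>n. P (s n) \<and> Q n (s n) (s (Suc n))"
  proof (rule dependent_nat_choice)
    show "\<exists>s. P s" using F G h by (intro exI[of _ "(F, G)"]) (simp add: P_def)
  next
    fix s n assume "P s"
    obtain A B where s: "s = (A, B)" by (cases s)
    note P = \<open>P s\<close>[unfolded P_def s fst_conv snd_conv]
    have comp: "compact C" if "closed C" for C :: "'x set"
      using compact_Int_closed[OF X that] by simp
    have AB: "A \<inter> B = {}" "B \<inter> A = {}" using P disj by blast+
    obtain c where c: "h_top T {- (A \<inter> cball c (1 / real (Suc n))), - B} > 0"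
      by (rule h_top_pos_shrink[of A B T "1 / real (Suc n)"]) (use P comp AB in auto)
    let ?A = "A \<inter> cball c (1 / real (Suc n))"
    \<comment> \<open>The second cut is made against the already shrunken first piece, so that
      positivity holds for the two new pieces together.\<close>
    obtain d where d: "h_top T {- (B \<inter> cball d (1 / real (Suc n))), - ?A} > 0"
      by (rule h_top_pos_shrink[of B ?A T "1 / real (Suc n)"]) (use P comp AB c in \<open>auto simp: insert_commute\<close>)
    let ?B = "B \<inter> cball d (1 / real (Suc n))"
    have "P (?A, ?B)" using P d by (auto simp: P_def insert_commute)
    moreover have "Q n s (?A, ?B)" unfolding Q_def s by auto
    ultimately show "\<exists>t. P t \<and> Q n s t" by blast
  qed
  then obtain s where s: "\<And>n. P (s n)" "\<And>n. Q n (s n) (s (Suc n))" by blast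
  \<comment> \<open>An empty piece would put the whole space into the cover and make its entropy
    zero.\<close>
  have ne: "fst (s n) \<noteq> {}" "snd (s n) \<noteq> {}" for n
    using s(1)[of n] h_top_insert_UNIV[of "{- fst (s n), - snd (s n)}" T] by (auto simp: P_def)
  have anti: "fst (s n) \<subseteq> fst (s m)" "snd (s n) \<subseteq> snd (s m)" if "m \<le> n" for m n
  proof -
    show "fst (s n) \<subseteq> fst (s m)" by (rule lift_Suc_antimono_le[OF _ that]) (use s(2) in \<open>auto simp: Q_def\<close>)
    show "snd (s n) \<subseteq> snd (s m)" by (rule lift_Suc_antimono_le[OF _ that]) (use s(2) in \<open>auto simp: Q_def\<close>)
  qed
  have nest: "(\<Inter>n. A n) \<noteq> {}"
    if A: "\<And>n. closed (A n)" "\<And>n. A n \<noteq> {}" "\<And>m n. m \<le> n \<Longrightarrow> A n \<subseteq> A m" for A :: "nat \<Rightarrow> 'x set"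
  proof -
    have "UNIV \<inter> (\<Inter>n\<in>UNIV. A n) \<noteq> {}"
    proof (rule compact_imp_fip_image[OF X A(1)])
      fix I :: "nat set" assume "finite I"
      then obtain k where "\<forall>n\<in>I. n \<le> k" using finite_nat_set_iff_bounded_le by blast
      then have "A k \<subseteq> (\<Inter>n\<in>I. A n)" using A(3) by blast
      then show "UNIV \<inter> (\<Inter>n\<in>I. A n) \<noteq> {}" using A(2)[of k] by blast
    qed
    then show ?thesis by simp
  qed
  have cl: "closed (fst (s n))" "closed (snd (s n))" for n
    using s(1)[of n] by (simp_all add: P_def)
  have "(\<Inter>n. fst (s n)) \<noteq> {}" by (rule nest[OF cl(1) ne(1) anti(1)])
  moreover have "(\<Inter>n. snd (s n)) \<noteq> {}" by (rule nest[OF cl(2) ne(2) anti(2)])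
  ultimately obtain x y where "x \<in> (\<Inter>n. fst (s n))" "y \<in> (\<Inter>n. snd (s n))" by blast
  then have x: "x \<in> fst (s n)" and y: "y \<in> snd (s n)" for n by simp_all
  have xy: "x \<in> F" "y \<in> G" using x[of 0] y[of 0] s(1)[of 0] unfolding P_def by blast+
  have small: "\<exists>N. \<forall>n\<ge>N. A n \<subseteq> O'"
    if A: "\<And>n. z \<in> A n" "\<And>n. \<exists>c. A (Suc n) \<subseteq> cball c (1 / real (Suc n))"
      and O: "open O'" "z \<in> O'" for A O' and z :: 'x
  proof -
    obtain e where e: "e > 0" "ball z e \<subseteq> O'" using O openE by blast
    obtain N where N: "2 / e < real N" using reals_Archimedean2 by blast
    show ?thesis
    proof (intro exI[of _ "Suc N"] allI impI subsetI)
      fix n w assume n: "Suc N \<le> n" and w: "w \<in> A n"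
      then obtain k where k: "n = Suc k" "N \<le> k" by (metis Suc_le_D Suc_le_mono)
      obtain c where "A n \<subseteq> cball c (1 / real (Suc k))" using A(2) k by blast
      then have "dist z c \<le> 1 / real (Suc k)" "dist w c \<le> 1 / real (Suc k)"
        using A(1)[of n] w by (auto simp: dist_commute)
      then have "dist z w \<le> 2 / real (Suc k)" using dist_triangle2[of z w c] by simp
      also have "\<dots> < e"
      proof -
        have "2 / e < real (Suc k)" using N k by linarith
        then have "2 < real (Suc k) * e" using e by (simp only: divide_less_eq)
        then show ?thesis by (simp only: divide_less_eq) (simp add: mult.commute)
      qed
      finally show "w \<in> O'" using e by auto
    qed
  qed
  have "entropy_pair T x y"
    unfolding entropy_pair_def
  proof (intro conjI allI impI)
    show "x \<noteq> y" using xy disj by auto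
  next
    fix U V :: "'x set"
    assume UV: "open U \<and> open V \<and> card {U, V} = 2 \<and> U \<union> V = UNIV \<and> x \<in> interior (- U) \<and> y \<in> interior (- V)"
    obtain N1 where N1: "\<forall>n\<ge>N1. fst (s n) \<subseteq> interior (- U)"
      using small[of x "\<lambda>n. fst (s n)" "interior (- U)"] x s(2) UV by (auto simp: Q_def)
    obtain N2 where N2: "\<forall>n\<ge>N2. snd (s n) \<subseteq> interior (- V)"
      using small[of y "\<lambda>n. snd (s n)" "interior (- V)"] y s(2) UV by (auto simp: Q_def)
    define n where "n = max N1 N2"
    have sub: "fst (s n) \<subseteq> - U" "snd (s n) \<subseteq> - V"
      using N1 N2 interior_subset unfolding n_def by (meson max.cobounded1 max.cobounded2 order_trans)+
    \<comment> \<open>At this stage the pieces miss \<open>U\<close> and \<open>V\<close>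
      respectively, so \<open>{U, V}\<close> refines the cover by their complements and has at least
      its entropy.\<close>
    have "h_top T {- fst (s n), - snd (s n)} \<le> (\<Sum>i\<in>{0::nat}. h_top T {U, V})"
    proof (rule h_top_le_sum)
      fix u assume "\<And>i. i \<in> {0::nat} \<Longrightarrow> u i \<in> {U, V}"
      then have "u 0 = U \<or> u 0 = V" by auto
      then show "\<exists>W\<in>{- fst (s n), - snd (s n)}. (\<Inter>i\<in>{0}. u i) \<subseteq> W" using sub by auto
    next
      show "\<Union>{- fst (s n), - snd (s n)} = UNIV" using s(1)[of n] disj by (auto simp: P_def)
    qed (use UV in auto)
    moreover have "h_top T {- fst (s n), - snd (s n)} > 0" using s(1)[of n] by (simp add: P_def)
    ultimately show "h_top T {U, V} > 0" by simp
  qed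
  with xy show ?thesis by (rule that)
qed

section \<open>Word numbers and shattered coordinates\<close>

text \<open>A word \<open>\<tau>\<close> encodes the intersection of the sets
  \<open>C i (\<tau> i)\<close>, so \<open>W\<close> encodes a cover of \<open>S\<close> by members
  of an iterated two-element cover. Working with words allows letters to be appended one coordinate
  at a time.\<close>

definition separating_words :: "(nat \<Rightarrow> bool \<Rightarrow> 'x set) \<Rightarrow> nat \<Rightarrow> 'x set \<Rightarrow> (nat \<Rightarrow> bool) set \<Rightarrow> bool" where
  "separating_words C n S W \<longleftrightarrow> finite W \<and> (\<forall>s\<in>S. \<exists>\<tau>\<in>W. \<forall>i<n. s \<in> C i (\<tau> i))"

definition word_number :: "(nat \<Rightarrow> bool \<Rightarrow> 'x set) \<Rightarrow> nat \<Rightarrow> 'x set \<Rightarrow> nat" where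
  "word_number C n S = (LEAST m. \<exists>W. separating_words C n S W \<and> card W = m)"

text \<open>Independence of the complements: on the coordinates in \<open>J\<close> every pattern of
  avoided sides is realised by a point of \<open>S\<close>.\<close>

definition shattered :: "(nat \<Rightarrow> bool \<Rightarrow> 'x set) \<Rightarrow> nat \<Rightarrow> 'x set \<Rightarrow> nat set set" where
  "shattered C n S = {J. J \<subseteq> {..<n} \<and> (\<forall>\<sigma>. \<exists>s\<in>S. \<forall>i\<in>J. s \<notin> C i (\<sigma> i))}"

lemma finite_shattered: "finite (shattered C n S)"
  by (rule finite_subset[of _ "Pow {..<n}"]) (auto simp: shattered_def)

lemma word_number_le: "separating_words C n S W \<Longrightarrow> word_number C n S \<le> card W"
  unfolding word_number_def by (rule Least_le) blast

text \<open>A set shattered by both parts stays shattered after adding \<open>n\<close>, since the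
  side to be avoided at \<open>n\<close> can be prescribed by choosing the part. These extensions
  contain \<open>n\<close>, hence are new, and pay for the intersection in
  inclusion-exclusion.\<close>

lemma card_shattered_split:
  "card (shattered C n {s\<in>S. s \<notin> C n True}) + card (shattered C n {s\<in>S. s \<notin> C n False})
    \<le> card (shattered C (Suc n) S)"
proof -
  let ?A = "shattered C n {s\<in>S. s \<notin> C n True}" and ?B = "shattered C n {s\<in>S. s \<notin> C n False}"
  have "?A \<union> ?B \<subseteq> shattered C (Suc n) S"
  proof
    fix J assume "J \<in> ?A \<union> ?B"
    then have "J \<subseteq> {..<n}" "\<forall>\<sigma>. \<exists>s\<in>S. \<forall>i\<in>J. s \<notin> C i (\<sigma> i)" unfolding shattered_def by blast+
    then show "J \<in> shattered C (Suc n) S" unfolding shattered_def by auto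
  qed
  moreover have "insert n ` (?A \<inter> ?B) \<subseteq> shattered C (Suc n) S"
  proof
    fix J' assume "J' \<in> insert n ` (?A \<inter> ?B)"
    then obtain J where J: "J' = insert n J" "J \<in> ?A" "J \<in> ?B" by blast
    have "\<exists>s\<in>S. \<forall>i\<in>J'. s \<notin> C i (\<sigma> i)" for \<sigma>
      using J unfolding shattered_def by (cases "\<sigma> n") fastforce+
    then show "J' \<in> shattered C (Suc n) S" using J unfolding shattered_def by auto
  qed
  ultimately have "(?A \<union> ?B) \<union> insert n ` (?A \<inter> ?B) \<subseteq> shattered C (Suc n) S" by blast
  then have "card ((?A \<union> ?B) \<union> insert n ` (?A \<inter> ?B)) \<le> card (shattered C (Suc n) S)"
    by (intro card_mono finite_shattered)
  moreover have "(?A \<union> ?B) \<inter> insert n ` (?A \<inter> ?B) = {}" by (auto simp: shattered_def)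
  then have "card ((?A \<union> ?B) \<union> insert n ` (?A \<inter> ?B)) = card (?A \<union> ?B) + card (insert n ` (?A \<inter> ?B))"
    by (intro card_Un_disjoint) (auto simp: finite_shattered)
  moreover have "card (insert n ` (?A \<inter> ?B)) = card (?A \<inter> ?B)"
  proof (rule card_image, rule inj_onI)
    fix I J assume "I \<in> ?A \<inter> ?B" "J \<in> ?A \<inter> ?B" and eq: "insert n I = insert n J"
    then have "n \<notin> I" "n \<notin> J" by (auto simp: shattered_def)
    then show "I = J" using eq by auto
  qed
  moreover have "card (?A \<union> ?B) + card (?A \<inter> ?B) = card ?A + card ?B"
    by (rule card_Un_Int[symmetric]) (rule finite_shattered)+
  ultimately show ?thesis by linarith
qed

lemma shattered_mono: "shattered C n S \<subseteq> shattered C (Suc n) S"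
  by (auto simp: shattered_def)

context
  fixes C :: "nat \<Rightarrow> bool \<Rightarrow> 'x set"
  assumes cover: "\<And>i. C i True \<union> C i False = UNIV"
begin

lemma separating_words_exists: "\<exists>W. separating_words C n S W"
proof (induction n arbitrary: S)
  case 0
  show ?case by (rule exI[of _ "{\<lambda>_. True}"]) (simp add: separating_words_def)
next
  case (Suc n)
  then obtain W where W: "separating_words C n S W" by blast
  have "separating_words C (Suc n) S ((\<lambda>\<tau>. \<tau>(n := True)) ` W \<union> (\<lambda>\<tau>. \<tau>(n := False)) ` W)"
    unfolding separating_words_def
  proof (intro conjI ballI)
    fix s assume "s \<in> S"
    then obtain \<tau> where t: "\<tau> \<in> W" "\<forall>i<n. s \<in> C i (\<tau> i)" using W unfolding separating_words_def by blast
    obtain b where "s \<in> C n b" using cover[of n] by blast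
    then have "\<forall>i<Suc n. s \<in> C i ((\<tau>(n := b)) i)" using t by (auto simp: less_Suc_eq)
    moreover have "\<tau>(n := b) \<in> (\<lambda>\<tau>. \<tau>(n := True)) ` W \<union> (\<lambda>\<tau>. \<tau>(n := False)) ` W"
      using t by (cases b) auto
    ultimately show "\<exists>\<tau>\<in>(\<lambda>\<tau>. \<tau>(n := True)) ` W \<union> (\<lambda>\<tau>. \<tau>(n := False)) ` W. \<forall>i<Suc n. s \<in> C i (\<tau> i)"
      by blast
  qed (use W in \<open>simp add: separating_words_def\<close>)
  then show ?case by blast
qed

lemma word_number_attained: "\<exists>W. separating_words C n S W \<and> card W = word_number C n S"
  unfolding word_number_def by (rule LeastI_ex) (use separating_words_exists in blast)

text \<open>Appending the letter \<open>b\<close> to an optimal family for \<open>S\<close> serves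
  all points of \<open>C n b\<close>; only the remaining points, which lie on the other side, need
  words ending in \<open>\<not> b\<close>.\<close>

lemma word_number_Suc_le:
  "word_number C (Suc n) S \<le> word_number C n S + word_number C n {s\<in>S. s \<notin> C n b}"
proof -
  obtain W where W: "separating_words C n S W" "card W = word_number C n S"
    using word_number_attained by blast
  obtain W' where W': "separating_words C n {s\<in>S. s \<notin> C n b} W'"
      "card W' = word_number C n {s\<in>S. s \<notin> C n b}"
    using word_number_attained by blast
  have fin: "finite W" "finite W'" using W W' by (auto simp: separating_words_def)
  let ?W = "(\<lambda>\<tau>. \<tau>(n := b)) ` W \<union> (\<lambda>\<tau>. \<tau>(n := \<not> b)) ` W'"
  have "separating_words C (Suc n) S ?W"
    unfolding separating_words_def
  proof (intro conjI ballI)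
    fix s assume s: "s \<in> S"
    show "\<exists>\<tau>\<in>?W. \<forall>i<Suc n. s \<in> C i (\<tau> i)"
    proof (cases "s \<in> C n b")
      case True
      obtain \<tau> where t: "\<tau> \<in> W" "\<forall>i<n. s \<in> C i (\<tau> i)" using W s unfolding separating_words_def by blast
      then show ?thesis using True by (intro bexI[of _ "\<tau>(n := b)"]) (auto simp: less_Suc_eq)
    next
      case False
      then obtain \<tau> where t: "\<tau> \<in> W'" "\<forall>i<n. s \<in> C i (\<tau> i)"
        using W' s unfolding separating_words_def by blast
      moreover have "s \<in> C n (\<not> b)" using cover[of n] False by (cases b) auto
      ultimately show ?thesis by (intro bexI[of _ "\<tau>(n := \<not> b)"]) (auto simp: less_Suc_eq)
    qed
  qed (use fin in simp)
  then have "word_number C (Suc n) S \<le> card ?W" by (rule word_number_le)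
  also have "\<dots> \<le> card ((\<lambda>\<tau>. \<tau>(n := b)) ` W) + card ((\<lambda>\<tau>. \<tau>(n := \<not> b)) ` W')" by (rule card_Un_le)
  also have "\<dots> \<le> card W + card W'" by (intro add_mono card_image_le fin)
  finally show ?thesis using W W' by simp
qed

text \<open>A Sauer--Shelah lemma for partial binary words. A coordinate is dropped when this loses only a
  small proportion of the word number, and is branched on otherwise.\<close>

lemma word_number_le_shattered:
  assumes q: "q \<ge> 1"
  shows "real (word_number C n S) * (1 - (1/2)^q) ^ n \<le> real (card (shattered C n S)) ^ q"
proof (induction n arbitrary: S)
  case 0
  show ?case
  proof (cases "S = {}")
    case True
    then have "separating_words C 0 S {}" by (simp add: separating_words_def)
    from word_number_le[OF this] show ?thesis by simp
  next
    case False
    have "separating_words C 0 S {\<lambda>_. True}" by (simp add: separating_words_def)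
    from word_number_le[OF this] have "word_number C 0 S \<le> 1" by simp
    moreover have "shattered C 0 S = {{}}" using False by (auto simp: shattered_def)
    ultimately show ?thesis by simp
  qed
next
  case (Suc n)
  define \<eta> :: real where "\<eta> = (1/2)^q"
  have \<eta>: "0 < \<eta>" "\<eta> \<le> 1" by (auto simp: \<eta>_def power_le_one)
  define S' where "S' b = {s\<in>S. s \<notin> C n b}" for b
  let ?N = "\<lambda>n S. real (word_number C n S)" and ?h = "\<lambda>n S. real (card (shattered C n S))"
  note IH = Suc[folded \<eta>_def]
  show ?case
  proof (cases "\<exists>b. ?N n (S' b) < \<eta> * ?N (Suc n) S")
    case True
    then obtain b where b: "?N n (S' b) < \<eta> * ?N (Suc n) S" by blast
    have "?N (Suc n) S \<le> ?N n S + ?N n (S' b)"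
      using word_number_Suc_le[of n S b] unfolding S'_def by linarith
    with b have "?N (Suc n) S * (1 - \<eta>) \<le> ?N n S" by (simp add: algebra_simps)
    then have "?N (Suc n) S * (1 - \<eta>) * (1 - \<eta>) ^ n \<le> ?N n S * (1 - \<eta>) ^ n"
      using \<eta> by (intro mult_right_mono) auto
    also have "\<dots> \<le> ?h n S ^ q" by (rule IH)
    also have "\<dots> \<le> ?h (Suc n) S ^ q"
      using card_mono[OF finite_shattered shattered_mono, of C n S] by (intro power_mono) auto
    finally show ?thesis by (simp add: \<eta>_def mult.assoc)
  next
    case False
    define x where "x = ?N (Suc n) S * (1 - \<eta>) ^ n"
    \<comment> \<open>Both parts keep at least the share \<open>\<eta>\<close> of the word number.
      By \<open>card_shattered_split\<close> the shattered count is at least twice the smaller one,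
      and this doubling gains the factor \<open>2 ^ q\<close>, the inverse of \<open>\<eta>\<close>,
      in the \<open>q\<close>-th power.\<close>
    define a where "a = min (?h n (S' True)) (?h n (S' False))"
    have *: "\<eta> * x \<le> ?h n (S' b) ^ q" for b
    proof -
      have "\<eta> * ?N (Suc n) S \<le> ?N n (S' b)" using False by (meson not_less)
      then have "\<eta> * ?N (Suc n) S * (1 - \<eta>) ^ n \<le> ?N n (S' b) * (1 - \<eta>) ^ n"
        using \<eta> by (intro mult_right_mono) auto
      then show ?thesis using IH[of "S' b"] by (simp add: x_def mult.assoc)
    qed
    have "\<eta> * x \<le> a ^ q" unfolding a_def min_def using * by simp
    then have "2 ^ q * (\<eta> * x) \<le> 2 ^ q * a ^ q" by (intro mult_left_mono) auto
    then have "x \<le> (2 * a) ^ q"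
      by (simp add: \<eta>_def power_mult_distrib power_divide)
    also have "\<dots> \<le> ?h (Suc n) S ^ q"
    proof (rule power_mono)
      have "?h n (S' True) + ?h n (S' False) \<le> ?h (Suc n) S"
        using card_shattered_split[of C n S] unfolding S'_def by linarith
      then show "2 * a \<le> ?h (Suc n) S" unfolding a_def by linarith
    qed (simp add: a_def)
    finally have "x \<le> ?h (Suc n) S ^ q" .
    moreover have "x * (1 - \<eta>) \<le> x"
      using \<eta> by (intro mult_right_le_one_le) (auto simp: x_def)
    ultimately show ?thesis by (simp add: x_def \<eta>_def mult_ac)
  qed
qed

end

lemma sum_power_card_Pow:
  "finite A \<Longrightarrow> (\<Sum>J\<in>Pow A. x ^ card J) = (1 + x :: real) ^ card A"
  using prod_add[of A "\<lambda>_. x" "\<lambda>_. 1"] by (simp add: add.commute)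

text \<open>An exponential Markov bound. With weight \<open>x ^ card J\<close> for \<open>J\<close>,
  all subsets of \<open>{..<n}\<close> together weigh \<open>(1 + x) ^ n\<close>, at most
  \<open>exp (x * n)\<close>; a family of size \<open>exp (a * n)\<close> with only small members
  would weigh more.\<close>

lemma large_set_in_exponential_family:
  assumes a: "a > 0"
  obtains c :: real where "c > 0"
    "\<And>n H. n \<ge> 1 \<Longrightarrow> H \<subseteq> Pow {..<n} \<Longrightarrow> real (card H) \<ge> exp (a * real n) \<Longrightarrow> \<exists>J\<in>H. real (card J) \<ge> c * real n"
proof -
  define x where "x = min (a/3) (1/2)"
  have x: "0 < x" "x \<le> a/3" "x < 1" using a by (auto simp: x_def)
  \<comment> \<open>\<open>c\<close> solves \<open>c * ln x = - a / 3\<close>. The weights and the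
    total then use up a third of the exponent \<open>a\<close> each, and a third is left for the
    contradiction.\<close>
  define c where "c = a / 3 / (- ln x)"
  have lnx: "- ln x > 0" using x by simp
  have c: "c > 0" unfolding c_def by (intro divide_pos_pos lnx) (use a in auto)
  show ?thesis
  proof (rule that[OF c], rule ccontr)
    fix n :: nat and H assume n: "n \<ge> 1" and H: "H \<subseteq> Pow {..<n}" "real (card H) \<ge> exp (a * real n)"
      and no: "\<not> (\<exists>J\<in>H. real (card J) \<ge> c * real n)"
    have fin: "finite H" using H finite_subset by blast
    have "exp (a * real n) * exp (- (a / 3) * real n) \<le> real (card H) * exp (- (a/3) * real n)"
      using H by (intro mult_right_mono) auto
    also have "\<dots> = (\<Sum>J\<in>H. exp (- (a/3) * real n))" by simp
    also have "\<dots> \<le> (\<Sum>J\<in>H. x ^ card J)"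
    proof (rule sum_mono)
      fix J assume "J \<in> H"
      then have "real (card J) \<le> c * real n" using no by force
      then have "real (card J) * (- ln x) \<le> c * real n * (- ln x)" using lnx by (intro mult_right_mono) auto
      also have "\<dots> = (a/3) * real n" using lnx by (simp add: c_def)
      finally have "- (a/3) * real n \<le> real (card J) * ln x" by simp
      then have "exp (- (a/3) * real n) \<le> exp (real (card J) * ln x)" by simp
      also have "\<dots> = x ^ card J" using x by (simp add: exp_of_nat_mult)
      finally show "exp (- (a/3) * real n) \<le> x ^ card J" .
    qed
    also have "\<dots> \<le> (\<Sum>J\<in>Pow {..<n}. x ^ card J)" using H x by (intro sum_mono2) auto
    also have "\<dots> = (1 + x) ^ n" by (simp add: sum_power_card_Pow)
    also have "\<dots> \<le> exp x ^ n" using x by (intro power_mono) auto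
    also have "\<dots> = exp (real n * x)" by (simp add: exp_of_nat_mult)
    also have "\<dots> \<le> exp (real n * (a/3))"
      unfolding exp_le_cancel_iff using x(2) by (intro mult_left_mono) auto
    finally have "a * real n - (a/3) * real n \<le> real n * (a/3)" by (simp add: exp_add[symmetric])
    then have "a * real n \<le> 0" by (simp add: algebra_simps)
    then show False using a n by (simp add: mult_le_0_iff)
  qed
qed

lemma cover_number_le_word_number:
  assumes "U \<union> V = UNIV"
  shows "cover_number (cover_iterate T {U, V} n)
    \<le> word_number (\<lambda>i b. (T ^^ i) -` (if b then U else V)) n UNIV"
proof -
  let ?C = "\<lambda>i b. (T ^^ i) -` (if b then U else V)"
  have "\<And>i. ?C i True \<union> ?C i False = UNIV" using assms by auto
  from word_number_attained[of ?C, OF this]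
  obtain W where W: "separating_words ?C n UNIV W" "card W = word_number ?C n UNIV" by blast
  define w where "w \<tau> = (\<Inter>i<n. ?C i (\<tau> i))" for \<tau>
  have fin: "finite W" using W by (simp add: separating_words_def)
  have "cover_number (cover_iterate T {U, V} n) \<le> card (w ` W)"
  proof (rule cover_number_le)
    show "w ` W \<subseteq> cover_iterate T {U, V} n"
      unfolding cover_iterate_eq w_def
    proof
      fix A assume "A \<in> (\<lambda>\<tau>. \<Inter>i<n. ?C i (\<tau> i)) ` W"
      then obtain \<tau> where "A = (\<Inter>i<n. ?C i (\<tau> i))" by blast
      then show "A \<in> {\<Inter>k<n. (T ^^ k) -` u k |u. \<forall>k<n. u k \<in> {U, V}}"
        by (intro CollectI exI[of _ "\<lambda>i. if \<tau> i then U else V"]) auto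
    qed
    show "finite (w ` W)" using fin by simp
    have "x \<in> \<Union>(w ` W)" for x
    proof -
      obtain \<tau> where "\<tau> \<in> W" "\<forall>i<n. x \<in> ?C i (\<tau> i)" using W(1) unfolding separating_words_def by blast
      then have "\<tau> \<in> W" "x \<in> w \<tau>" by (auto simp: w_def)
      then show ?thesis by blast
    qed
    then show "\<Union>(w ` W) = UNIV" by blast
  qed
  also have "\<dots> \<le> card W" by (rule card_image_le[OF fin])
  finally show ?thesis using W by simp
qed

text \<open>With \<open>h\<close> the entropy of the cover, at least
  \<open>exp (h / (4 * q) * n)\<close> sets are shattered for large \<open>n\<close>, and an
  exponentially large family of subsets of \<open>{..<n}\<close> has a member of positive
  density.\<close>

lemma positive_entropy_independence:
  fixes T :: "'x \<Rightarrow> 'x"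
  assumes UV: "U \<union> V = UNIV" and h: "h_top T {U, V} > 0"
  obtains c :: real where "c > 0"
    "\<forall>\<^sub>F n in sequentially. \<exists>J\<subseteq>{..<n}. real (card J) \<ge> c * real n \<and>
       (\<forall>\<sigma>. \<exists>z. \<forall>i\<in>J. (T ^^ i) z \<notin> (if \<sigma> i then U else V))"
proof -
  define h where "h = h_top T {U, V}"
  let ?C = "\<lambda>i b. (T ^^ i) -` (if b then U else V)"
  have cov: "\<And>i. ?C i True \<union> ?C i False = UNIV" using UV by auto
  let ?N = "\<lambda>n. cover_number (cover_iterate T {U, V} n)"
  \<comment> \<open>\<open>q\<close> is so large that the factor \<open>(1 - (1/2) ^ q) ^ n\<close>
    of the Sauer-Shelah bound costs no more than \<open>exp (- h / 4) ^ n\<close>, half of the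
    exponent \<open>h / 2\<close> guaranteed for the cover numbers.\<close>
  have "(\<lambda>q. (1/2::real) ^ q) \<longlonglongrightarrow> 0" by (rule LIMSEQ_power_zero) simp
  moreover have "0 < 1 - exp (- h / 4)" using h by (simp add: h_def)
  ultimately have "\<forall>\<^sub>F q in sequentially. (1/2::real) ^ q < 1 - exp (- h / 4)"
    by (rule order_tendstoD)
  then have "\<forall>\<^sub>F q in sequentially. (1/2::real) ^ q < 1 - exp (- h / 4) \<and> q \<ge> 1"
    using eventually_ge_at_top[of "1::nat"] by (rule eventually_conj)
  then obtain q where q: "(1/2::real) ^ q < 1 - exp (- h / 4)" "q \<ge> 1"
    using eventually_happens' sequentially_bot by blast
  have "(\<lambda>n. ln (real (?N n)) / real n) \<longlonglongrightarrow> h"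
    unfolding h_def by (rule h_top_limit) (use UV in auto)
  moreover have "h / 2 < h" using h by (simp add: h_def)
  ultimately have ev: "\<forall>\<^sub>F n in sequentially. ln (real (?N n)) / real n > h / 2"
    by (rule order_tendstoD)
  obtain c where c: "c > 0" "\<And>n H. n \<ge> 1 \<Longrightarrow> H \<subseteq> Pow {..<n} \<Longrightarrow>
      real (card H) \<ge> exp (h / (4 * real q) * real n) \<Longrightarrow> \<exists>J\<in>H. real (card J) \<ge> c * real n"
    by (rule large_set_in_exponential_family[of "h / (4 * real q)"]) (use h q in \<open>auto simp: h_def\<close>)
  have "\<forall>\<^sub>F n in sequentially. \<exists>J\<in>shattered ?C n UNIV. real (card J) \<ge> c * real n"
    using ev eventually_ge_at_top[of "1::nat"]
  proof eventually_elim
    case (elim n)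
    have np: "real n > 0" using elim by simp
    have "?N n \<ge> 1" by (intro cover_number_pos finite_cover_iterate Union_cover_iterate) (use UV in auto)
    then have N0: "real (?N n) > 0" by simp
    have "h / 2 * real n < ln (real (?N n))" using elim np by (simp add: less_divide_eq)
    then have "exp (h / 2 * real n) < exp (ln (real (?N n)))" by simp
    then have "exp (h / 2 * real n) \<le> real (?N n)" using N0 by simp
    also have "\<dots> \<le> real (word_number ?C n UNIV)"
      using cover_number_le_word_number[OF UV] by simp
    finally have "exp (h / 2 * real n) * exp (- h / 4) ^ n
        \<le> real (word_number ?C n UNIV) * (1 - (1/2) ^ q) ^ n"
      by (rule mult_mono) (use q in \<open>auto intro: power_mono\<close>)
    also have "\<dots> \<le> real (card (shattered ?C n UNIV)) ^ q"
      by (rule word_number_le_shattered[OF cov q(2)])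
    finally have "exp (h / 2 * real n) * exp (real n * (- h / 4)) \<le> real (card (shattered ?C n UNIV)) ^ q"
      by (simp only: exp_of_nat_mult)
    moreover have "exp (h / (4 * real q) * real n) ^ q = exp (h / 2 * real n) * exp (real n * (- h / 4))"
      using q(2) by (simp add: exp_of_nat_mult[symmetric] exp_add[symmetric] field_simps)
    ultimately have "exp (h / (4 * real q) * real n) ^ q \<le> real (card (shattered ?C n UNIV)) ^ q" by simp
    then have "exp (h / (4 * real q) * real n) \<le> real (card (shattered ?C n UNIV))"
      using q(2) by (subst (asm) power_mono_iff) auto
    then show ?case
      using elim by (intro c(2)) (auto simp: shattered_def)
  qed
  then have "\<forall>\<^sub>F n in sequentially. \<exists>J\<subseteq>{..<n}. real (card J) \<ge> c * real n \<and>
       (\<forall>\<sigma>. \<exists>z. \<forall>i\<in>J. (T ^^ i) z \<notin> (if \<sigma> i then U else V))"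
  proof (rule eventually_mono)
    fix n assume "\<exists>J\<in>shattered ?C n UNIV. real (card J) \<ge> c * real n"
    then obtain J where J: "J \<subseteq> {..<n}" "\<forall>\<sigma>. \<exists>s\<in>UNIV. \<forall>i\<in>J. s \<notin> ?C i (\<sigma> i)" "real (card J) \<ge> c * real n"
      unfolding shattered_def by blast
    then have "\<forall>\<sigma>. \<exists>z. \<forall>i\<in>J. (T ^^ i) z \<notin> (if \<sigma> i then U else V)" by (simp add: vimage_def)
    with J show "\<exists>J\<subseteq>{..<n}. real (card J) \<ge> c * real n \<and>
       (\<forall>\<sigma>. \<exists>z. \<forall>i\<in>J. (T ^^ i) z \<notin> (if \<sigma> i then U else V))" by blast
  qed
  with c(1) show ?thesis by (rule that)
qed


section \<open>Representations of C(X) on a Hilbert space\<close>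

lemma cinner_add_left: "cinner (x + y) z = cinner x z + cinner y z"
  for x :: "'h::chilbert_space"
  by (metis cinner_add_right cinner_commute complex_cnj_add)

lemma cinner_scaleC_left: "cinner (scaleC c x) y = cnj c * cinner x y"
  for x :: "'h::chilbert_space"
  by (metis cinner_commute cinner_scaleC_right complex_cnj_mult)

lemma cinner_scaleR_right: "cinner x (scaleR r y) = of_real r * cinner x y"
  for x :: "'h::chilbert_space"
  by (metis cinner_scaleC_right scaleC_of_real)

lemma cinner_scaleR_left: "cinner (scaleR r x) y = of_real r * cinner x y"
  for x :: "'h::chilbert_space"
  by (metis cinner_scaleC_left scaleC_of_real complex_cnj_complex_of_real)

lemma cinner_diff_right: "cinner x (y - z) = cinner x y - cinner x z"
  for x :: "'h::chilbert_space"
  using cinner_add_right[of x "y - z" z] by simp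

lemma cinner_diff_left: "cinner (x - y) z = cinner x z - cinner y z"
  for x :: "'h::chilbert_space"
  using cinner_add_left[of "x - y" y z] by simp

lemma norm_power2_eq_cinner: "(norm x)\<^sup>2 = Re (cinner x x)"
  for x :: "'h::chilbert_space"
  by (simp add: norm_eq_sqrt_cinner cinner_ge_zero)

lemma norm_power2_add: "(norm (x + y))\<^sup>2 = (norm x)\<^sup>2 + 2 * Re (cinner x y) + (norm y)\<^sup>2"
  for x :: "'h::chilbert_space"
proof -
  have "Re (cinner y x) = Re (cinner x y)" by (metis cinner_commute cnj.sel(1))
  then show ?thesis by (simp add: norm_power2_eq_cinner cinner_add_right cinner_add_left)
qed

lemma cinner_minus_right: "cinner x (- y) = - cinner x y"
  for x :: "'h::chilbert_space"
  using cinner_scaleR_right[of x "-1" y] by simp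

lemma norm_power2_diff: "(norm (x - y))\<^sup>2 = (norm x)\<^sup>2 - 2 * Re (cinner x y) + (norm y)\<^sup>2"
  for x :: "'h::chilbert_space"
  using norm_power2_add[of x "- y"] by (simp add: cinner_minus_right)

lemma Re_cinner_le: "Re (cinner x y) \<le> norm x * norm y"
  for x :: "'h::chilbert_space"
proof -
  have "(norm (x + y))\<^sup>2 \<le> (norm x + norm y)\<^sup>2" by (rule power_mono[OF norm_triangle_ineq]) simp
  then show ?thesis by (simp add: norm_power2_add power2_sum)
qed

lemma cinner_ext: "(\<And>z. Re (cinner x z) = Re (cinner y z)) \<Longrightarrow> x = y"
  for x :: "'h::chilbert_space"
proof -
  assume "\<And>z. Re (cinner x z) = Re (cinner y z)"
  then have "Re (cinner (x - y) (x - y)) = 0" by (simp add: cinner_diff_left)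
  then show "x = y" using norm_power2_eq_cinner[of "x - y"] by simp
qed

text \<open>The representing vector minimises the strictly convex functional
  \<open>\<parallel>z\<parallel>\<^sup>2 / 2 - l z\<close>; the parallelogram law makes minimising sequences Cauchy.\<close>

lemma riesz_representation:
  fixes l :: "'h::chilbert_space \<Rightarrow> real"
  assumes l: "bounded_linear l"
  obtains z where "\<And>y. Re (cinner z y) = l y"
proof -
  interpret l: bounded_linear l by (rule l)
  define \<Phi> where "\<Phi> z = (norm z)\<^sup>2 / 2 - l z" for z
  obtain K where K: "\<And>z. norm (l z) \<le> norm z * K" using l.bounded by blast
  have low: "- (K\<^sup>2 / 2) \<le> \<Phi> z" for z
  proof -
    have "l z \<le> norm z * K" using K[of z] by simp
    moreover have "0 \<le> (norm z - K)\<^sup>2" by simp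
    ultimately show ?thesis by (simp add: \<Phi>_def power2_eq_square algebra_simps)
  qed
  define m where "m = (INF z. \<Phi> z)"
  have bdd: "bdd_below (range \<Phi>)" by (rule bdd_belowI2) (rule low)
  have m: "m \<le> \<Phi> z" for z unfolding m_def by (rule cINF_lower[OF bdd]) simp
  have "\<exists>z. \<Phi> z < m + 1 / real (Suc n)" for n
  proof -
    have "(INF z. \<Phi> z) < m + 1 / real (Suc n)" by (simp add: m_def)
    then show ?thesis using cINF_less_iff[OF _ bdd] by blast
  qed
  then obtain z where z: "\<And>n. \<Phi> (z n) < m + 1 / real (Suc n)" by metis
  have par: "(norm (a - b))\<^sup>2 \<le> 4 * (\<Phi> a - m) + 4 * (\<Phi> b - m)" for a b
  proof -
    have n1: "(norm (a + b))\<^sup>2 = (norm a)\<^sup>2 + 2 * Re (cinner a b) + (norm b)\<^sup>2" by (rule norm_power2_add)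
    have n2: "(norm (a - b))\<^sup>2 = (norm a)\<^sup>2 - 2 * Re (cinner a b) + (norm b)\<^sup>2"
      by (rule norm_power2_diff)
    have "m \<le> \<Phi> ((1/2) *\<^sub>R (a + b))" by (rule m)
    also have "\<dots> = (norm (a + b))\<^sup>2 / 8 - (l a + l b) / 2"
      by (simp add: \<Phi>_def l.scaleR l.add power_divide power_mult_distrib)
    finally show ?thesis unfolding \<Phi>_def using n1 n2 by (simp add: field_simps)
  qed
  have "Cauchy z"
  proof (rule CauchyI)
    fix e :: real assume e: "e > 0"
    obtain N where N: "8 / e\<^sup>2 < real N" using reals_Archimedean2 by blast
    show "\<exists>M. \<forall>i\<ge>M. \<forall>j\<ge>M. norm (z i - z j) < e"
    proof (intro exI[of _ N] allI impI)
      fix i j assume ij: "i \<ge> N" "j \<ge> N"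
      have small: "\<Phi> (z i) - m < e\<^sup>2 / 8" if "i \<ge> N" for i
      proof -
        have "8 / e\<^sup>2 < real (Suc i)" using N that by linarith
        then have "1 / real (Suc i) < e\<^sup>2 / 8" using e by (simp add: field_simps)
        then show ?thesis using z[of i] by linarith
      qed
      have "(norm (z i - z j))\<^sup>2 < e\<^sup>2"
      proof -
        have "4 * (\<Phi> (z i) - m) + 4 * (\<Phi> (z j) - m) < 4 * (e\<^sup>2 / 8) + 4 * (e\<^sup>2 / 8)"
          by (intro add_strict_mono mult_strict_left_mono small ij) auto
        with par[of "z i" "z j"] show ?thesis by simp
      qed
      then show "norm (z i - z j) < e" using e by (simp add: power_less_imp_less_base)
    qed
  qed
  then have "convergent z" by (rule Cauchy_convergent)
  then obtain w where w: "z \<longlonglongrightarrow> w" unfolding convergent_def by blast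
  have "(\<lambda>n. \<Phi> (z n)) \<longlonglongrightarrow> \<Phi> w"
    unfolding \<Phi>_def by (intro tendsto_intros w l.tendsto) auto
  moreover have "(\<lambda>n. m + 1 / real (Suc n)) \<longlonglongrightarrow> m + 0"
    by (intro tendsto_intros LIMSEQ_Suc[OF lim_1_over_n])
  ultimately have "\<Phi> w \<le> m + 0"
    by (rule LIMSEQ_le) (use z in \<open>auto intro: less_imp_le\<close>)
  then have min: "\<Phi> w \<le> \<Phi> v" for v using m[of v] by simp
  show ?thesis
  proof (rule that, rule ccontr)
    fix y assume ne: "Re (cinner w y) \<noteq> l y"
    define d where "d = Re (cinner w y) - l y"
    \<comment> \<open>The 1 keeps \<open>n\<close> positive for \<open>y = 0\<close>. A step of
      length \<open>- d / n\<close> along \<open>y\<close> would lower the functional by at least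
      \<open>d\<^sup>2 / (2 * n)\<close>.\<close>
    define n where "n = (norm y)\<^sup>2 + 1"
    have n: "n > 0" "n \<ge> (norm y)\<^sup>2" by (auto simp: n_def add_nonneg_pos)
    have exp: "\<Phi> (w + t *\<^sub>R y) = \<Phi> w + t * d + t\<^sup>2 * (norm y)\<^sup>2 / 2" for t
      by (simp add: \<Phi>_def norm_power2_add cinner_scaleR_right l.add l.scaleR d_def power_mult_distrib field_simps)
    have "0 \<le> (- d / n) * d + (- d / n)\<^sup>2 * (norm y)\<^sup>2 / 2"
      using min[of "w + (- d / n) *\<^sub>R y"] exp[of "- d / n"] by linarith
    also have "\<dots> \<le> (- d / n) * d + (- d / n)\<^sup>2 * n / 2"
      using n by (intro add_left_mono divide_right_mono mult_left_mono) auto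
    also have "\<dots> = - (d\<^sup>2 / (2 * n))" using n by (simp add: field_simps power2_eq_square)
    finally have "d\<^sup>2 / (2 * n) \<le> 0" by simp
    moreover have "d\<^sup>2 / (2 * n) > 0" using ne n by (simp add: d_def)
    ultimately show False by simp
  qed
qed

text \<open>The representation theorem handles real functionals, so at first only real parts agree;
  testing with \<open>scaleC (- \<i>) y\<close> recovers the imaginary parts.\<close>

lemma adjoint_exists:
  fixes S :: "'h::chilbert_space \<Rightarrow> 'h"
  assumes S: "S \<in> bounded_operators"
  shows "\<exists>R\<in>bounded_operators. \<forall>x y. cinner (R x) y = cinner x (S y)"
proof -
  have blS: "bounded_linear S" and cS: "\<And>c x. S (scaleC c x) = scaleC c (S x)"
    using S by (auto simp: bounded_operators_def)
  interpret S: bounded_linear S by (rule blS)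
  obtain K where K: "K > 0" "\<And>y. norm (S y) \<le> norm y * K" using S.pos_bounded by blast
  have "\<exists>r. \<forall>y. Re (cinner r y) = Re (cinner x (S y))" for x
  proof -
    have "bounded_linear (\<lambda>y. Re (cinner x (S y)))"
    proof (rule bounded_linear_intro)
      fix y
      have *: "Re (cinner x (S y)) \<le> norm y * (norm x * K)" for y
      proof -
        have "Re (cinner x (S y)) \<le> norm x * norm (S y)" by (rule Re_cinner_le)
        also have "\<dots> \<le> norm x * (norm y * K)" by (intro mult_left_mono K) simp
        finally show ?thesis by (simp add: mult_ac)
      qed
      have "- Re (cinner x (S y)) = Re (cinner x (S (- y)))"
        by (simp add: S.neg cinner_minus_right)
      then show "norm (Re (cinner x (S y))) \<le> norm y * (norm x * K)" using *[of y] *[of "- y"] by simp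
    qed (simp_all add: S.add S.scaleR cinner_add_right cinner_scaleR_right)
    from riesz_representation[OF this] show ?thesis by metis
  qed
  then obtain R where R: "\<And>x y. Re (cinner (R x) y) = Re (cinner x (S y))" by metis
  have R': "cinner (R x) y = cinner x (S y)" for x y
  proof (rule complex_eqI)
    show "Im (cinner (R x) y) = Im (cinner x (S y))"
      using R[of x "scaleC (- \<i>) y"] by (simp add: cS cinner_scaleC_right)
  qed (rule R)
  have "bounded_linear R"
  proof (rule bounded_linear_intro)
    fix x
    have "(norm (R x))\<^sup>2 = Re (cinner x (S (R x)))" by (simp add: norm_power2_eq_cinner R)
    also have "\<dots> \<le> norm x * norm (S (R x))" by (rule Re_cinner_le)
    also have "\<dots> \<le> norm x * (norm (R x) * K)" by (intro mult_left_mono K) simp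
    finally have "norm (R x) * norm (R x) \<le> norm (R x) * (norm x * K)"
      by (simp add: power2_eq_square mult_ac)
    then show "norm (R x) \<le> norm x * K"
      using K(1) by (cases "norm (R x) = 0") auto
  qed (rule cinner_ext, simp add: R cinner_add_left cinner_scaleR_left)+
  moreover have "R (scaleC c x) = scaleC c (R x)" for c x
    by (rule cinner_ext) (simp add: R' cinner_scaleC_left)
  ultimately show ?thesis using R' by (auto simp: bounded_operators_def)
qed

text \<open>Existence and uniqueness of the adjoint give the definite description in
  \<open>operator_algebra\<close> its meaning.\<close>

lemma star_operator_algebra:
  fixes S :: "'h::chilbert_space \<Rightarrow> 'h"
  assumes "S \<in> bounded_operators"
  shows "cinner (star operator_algebra S x) y = cinner x (S y)"
proof -
  have "\<exists>!R. R \<in> bounded_operators \<and> (\<forall>x y. cinner (R x) y = cinner x (S y))"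
  proof (rule ex_ex1I)
    show "\<exists>R. R \<in> bounded_operators \<and> (\<forall>x y. cinner (R x) y = cinner x (S y))"
      using adjoint_exists[OF assms] by blast
    fix R R' assume *: "R \<in> bounded_operators \<and> (\<forall>x y. cinner (R x) y = cinner x (S y))"
      "R' \<in> bounded_operators \<and> (\<forall>x y. cinner (R' x) y = cinner x (S y))"
    show "R = R'" by (rule ext, rule cinner_ext) (use * in simp)
  qed
  from theI'[OF this] show ?thesis by (simp add: operator_algebra_def)
qed

section \<open>Order and norm under a representation of C(X)\<close>

locale function_representation =
  fixes \<pi> :: "('x::topological_space \<Rightarrow> complex) \<Rightarrow> 'h::chilbert_space \<Rightarrow> 'h"
  assumes faithful: "faithful_representation continuous_functions \<pi>"
begin

lemma hom: "star_homomorphism continuous_functions operator_algebra \<pi>"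
  and inj: "inj_on \<pi> {f. continuous_on UNIV f}"
  using faithful by (auto simp: faithful_representation_def continuous_functions_def)

lemma bounded_operator: "continuous_on UNIV f \<Longrightarrow> \<pi> f \<in> bounded_operators"
  using hom by (auto simp: star_homomorphism_def continuous_functions_def operator_algebra_def)

lemma bounded_linear: "continuous_on UNIV f \<Longrightarrow> bounded_linear (\<pi> f)"
  using bounded_operator by (auto simp: bounded_operators_def)

lemma add: "continuous_on UNIV f \<Longrightarrow> continuous_on UNIV g \<Longrightarrow> \<pi> (\<lambda>x. f x + g x) h = \<pi> f h + \<pi> g h"
  using hom by (auto simp: star_homomorphism_def continuous_functions_def operator_algebra_def)

lemma mult: "continuous_on UNIV f \<Longrightarrow> continuous_on UNIV g \<Longrightarrow> \<pi> (\<lambda>x. f x * g x) h = \<pi> f (\<pi> g h)"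
  using hom by (auto simp: star_homomorphism_def continuous_functions_def operator_algebra_def)

lemma smult:
  assumes f: "continuous_on UNIV f"
  shows "\<pi> (\<lambda>x. c * f x) h = scaleC c (\<pi> f h)"
proof -
  have "f \<in> carrier continuous_functions" using f by (simp add: continuous_functions_def)
  then have "\<pi> (c \<odot>\<^bsub>continuous_functions\<^esub> f) = c \<odot>\<^bsub>operator_algebra\<^esub> \<pi> f"
    using hom unfolding star_homomorphism_def by blast
  then have "\<pi> (\<lambda>x. c * f x) = (\<lambda>h. scaleC c (\<pi> f h))"
    unfolding continuous_functions_def operator_algebra_def by simp
  then show ?thesis by simp
qed

lemma star: "continuous_on UNIV f \<Longrightarrow> \<pi> (\<lambda>x. cnj (f x)) = star operator_algebra (\<pi> f)"
  using hom by (auto simp: star_homomorphism_def continuous_functions_def)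

lemma adjoint: "continuous_on UNIV f \<Longrightarrow> cinner (\<pi> (\<lambda>x. cnj (f x)) u) v = cinner u (\<pi> f v)"
  using star_operator_algebra[OF bounded_operator] by (simp add: star)

lemma diff:
  assumes "continuous_on UNIV f" "continuous_on UNIV g"
  shows "\<pi> (\<lambda>x. f x - g x) h = \<pi> f h - \<pi> g h"
proof -
  have "\<pi> (\<lambda>x. (f x - g x) + g x) h = \<pi> (\<lambda>x. f x - g x) h + \<pi> g h"
    by (rule add) (intro continuous_intros assms)+
  then show ?thesis by (simp add: algebra_simps)
qed

text \<open>Norms of images become quadratic forms of nonnegative functions, which can be compared
  pointwise.\<close>

lemma norm_power2:
  assumes f: "continuous_on UNIV f"
  shows "(norm (\<pi> f h))\<^sup>2 = Re (cinner h (\<pi> (\<lambda>x. of_real ((cmod (f x))\<^sup>2)) h))"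
proof -
  have cf: "continuous_on UNIV (\<lambda>x. cnj (f x))" by (intro continuous_intros f)
  have "(\<lambda>x. complex_of_real ((cmod (f x))\<^sup>2)) = (\<lambda>x. cnj (f x) * f x)"
    by (rule ext) (simp add: complex_norm_square mult.commute del: of_real_power)
  then have "\<pi> (\<lambda>x. of_real ((cmod (f x))\<^sup>2)) h = \<pi> (\<lambda>x. cnj (f x)) (\<pi> f h)"
    by (simp add: mult[OF cf f])
  then show ?thesis using adjoint[OF cf, of h "\<pi> f h"] by (simp add: norm_power2_eq_cinner)
qed

lemma positive:
  fixes p :: "'x \<Rightarrow> real"
  assumes "continuous_on UNIV p" "\<And>x. p x \<ge> 0"
  shows "Re (cinner h (\<pi> (\<lambda>x. of_real (p x)) h)) \<ge> 0"
proof -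
  have "continuous_on UNIV (\<lambda>x. complex_of_real (sqrt (p x)))" by (intro continuous_intros assms)
  from norm_power2[OF this, of h] assms(2) show ?thesis by simp (metis zero_le_power2)
qed

lemma mono:
  fixes p q :: "'x \<Rightarrow> real"
  assumes p: "continuous_on UNIV p" and q: "continuous_on UNIV q" and le: "\<And>x. p x \<le> q x"
  shows "Re (cinner h (\<pi> (\<lambda>x. of_real (p x)) h)) \<le> Re (cinner h (\<pi> (\<lambda>x. of_real (q x)) h))"
proof -
  have cp: "continuous_on UNIV (\<lambda>x. complex_of_real (p x))" "continuous_on UNIV (\<lambda>x. complex_of_real (q x))"
    by (intro continuous_intros p q)+
  have "0 \<le> Re (cinner h (\<pi> (\<lambda>x. of_real (q x - p x)) h))"
    by (rule positive) (use le in \<open>auto intro!: continuous_intros p q\<close>)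
  then show ?thesis using diff[OF cp(2,1), of h] by (simp add: cinner_diff_right)
qed

lemma norm_le:
  assumes f: "continuous_on UNIV f" and c: "\<And>x. cmod (f x) \<le> c"
  shows "norm (\<pi> f h) \<le> c * norm h"
proof -
  have c0: "c \<ge> 0" using c[of undefined] norm_ge_zero order_trans by blast
  have one: "continuous_on UNIV (\<lambda>x::'x. 1 :: complex)" by simp
  \<comment> \<open>A homomorphism may send the unit to a proper projection, so that this image is a
    contraction needs its own argument.\<close>
  have unit: "norm (\<pi> (\<lambda>x. 1) h) \<le> norm h"
  proof -
    have "(norm (\<pi> (\<lambda>x. 1) h))\<^sup>2 = Re (cinner h (\<pi> (\<lambda>x. 1) h))"
      using norm_power2[OF one, of h] by simp
    also have "\<dots> \<le> norm h * norm (\<pi> (\<lambda>x. 1) h)" by (rule Re_cinner_le)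
    finally show ?thesis by (cases "norm (\<pi> (\<lambda>x. 1) h) = 0") (auto simp: power2_eq_square)
  qed
  have "(norm (\<pi> f h))\<^sup>2 \<le> Re (cinner h (\<pi> (\<lambda>x. of_real (c\<^sup>2)) h))"
    unfolding norm_power2[OF f] using c by (intro mono continuous_intros f power_mono) auto
  also have "\<dots> = Re (cinner h (\<pi> (\<lambda>x. of_real ((cmod (of_real c * (1::complex)))\<^sup>2)) h))"
    by (simp add: norm_mult)
  also have "\<dots> = (norm (\<pi> (\<lambda>x. of_real c * 1) h))\<^sup>2"
    by (rule norm_power2[symmetric]) simp
  also have "\<dots> = (c * norm (\<pi> (\<lambda>x. 1) h))\<^sup>2"
    using smult[OF one, of "of_real c" h] c0 by (simp add: scaleC_of_real)
  also have "\<dots> \<le> (c * norm h)\<^sup>2" using c0 unit by (intro power_mono mult_left_mono) auto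
  finally show ?thesis using c0 by (simp add: power2_le_iff_abs_le)
qed

lemma onorm_le:
  assumes "continuous_on UNIV f" "\<And>x. cmod (f x) \<le> c"
  shows "onorm (\<pi> f) \<le> c"
proof -
  have "c \<ge> 0" using assms(2)[of undefined] norm_ge_zero order_trans by blast
  then show ?thesis by (rule onorm_bound) (rule norm_le[OF assms])
qed

text \<open>This is where faithfulness enters. If the operator norm were below some
  \<open>c < cmod (g x0)\<close>, take \<open>u\<close> positive exactly where
  \<open>cmod (g x) > c\<close>. By injectivity \<open>\<pi> u v\<close> is nonzero for some
  \<open>v\<close>, and \<open>\<pi> g\<close> stretches this vector at least by
  \<open>c\<close>.\<close>

lemma onorm_ge:
  assumes g: "continuous_on UNIV g"
  shows "cmod (g x0) \<le> onorm (\<pi> g)"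
proof (rule ccontr)
  assume "\<not> ?thesis"
  then obtain c where c: "onorm (\<pi> g) < c" "c < cmod (g x0)" using dense not_le by metis
  have c0: "c > 0" using c onorm_pos_le[OF bounded_linear[OF g]] by linarith
  define r where "r x = max 0 ((cmod (g x))\<^sup>2 - c\<^sup>2)" for x
  define u where "u x = complex_of_real (r x)" for x
  have r: "continuous_on UNIV r" unfolding r_def by (intro continuous_intros g)
  have u: "continuous_on UNIV u" unfolding u_def by (intro continuous_intros r)
  have "c\<^sup>2 < (cmod (g x0))\<^sup>2" using c c0 by (intro power_strict_mono) auto
  then have "r x0 \<noteq> 0" by (simp add: r_def)
  then have "u x0 \<noteq> 0" by (simp add: u_def)
  moreover have zero: "continuous_on UNIV (\<lambda>x::'x. 0 :: complex)" by simp
  ultimately have "\<pi> u \<noteq> \<pi> (\<lambda>x. 0)" using inj_onD[OF inj, of u "\<lambda>x. 0"] u by auto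
  then obtain v where "\<pi> u v \<noteq> \<pi> (\<lambda>x. 0) v" by blast
  moreover have "\<pi> (\<lambda>x. 0) v = 0" using add[OF zero zero, of v] by simp
  ultimately have v: "\<pi> u v \<noteq> 0" by simp
  define w where "w = \<pi> u v"
  have cu: "(\<lambda>x. cnj (u x)) = u" by (simp add: u_def fun_eq_iff)
  have sym: "cinner (\<pi> u a) b = cinner a (\<pi> u b)" for a b using adjoint[OF u, of a b] by (simp add: cu)
  have cg: "continuous_on UNIV (\<lambda>x. complex_of_real ((cmod (g x))\<^sup>2))" by (intro continuous_intros g)
  have 1: "(norm (\<pi> g w))\<^sup>2 = Re (cinner v (\<pi> (\<lambda>x. of_real ((r x)\<^sup>2 * (cmod (g x))\<^sup>2)) v))"
  proof -
    have "\<pi> (\<lambda>x. u x * (of_real ((cmod (g x))\<^sup>2) * u x)) v = \<pi> u (\<pi> (\<lambda>x. of_real ((cmod (g x))\<^sup>2)) (\<pi> u v))"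
      by (subst mult[OF u], (intro continuous_intros cg u), subst mult[OF cg u], rule refl)
    moreover have "(\<lambda>x. u x * (of_real ((cmod (g x))\<^sup>2) * u x)) = (\<lambda>x. of_real ((r x)\<^sup>2 * (cmod (g x))\<^sup>2))"
      by (simp add: u_def fun_eq_iff power2_eq_square)
    ultimately show ?thesis unfolding norm_power2[OF g] w_def by (simp add: sym)
  qed
  have 2: "(c * norm w)\<^sup>2 = Re (cinner v (\<pi> (\<lambda>x. of_real ((r x)\<^sup>2 * c\<^sup>2)) v))"
  proof -
    have "c * norm w = norm (\<pi> (\<lambda>x. of_real c * u x) v)"
      using smult[OF u, of "of_real c" v] c0 by (simp add: w_def scaleC_of_real)
    then have "(c * norm w)\<^sup>2 = Re (cinner v (\<pi> (\<lambda>x. of_real ((cmod (of_real c * u x))\<^sup>2)) v))"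
      by (simp only: norm_power2 continuous_on_mult continuous_on_const u)
    moreover have "(cmod (of_real c * u x))\<^sup>2 = (r x)\<^sup>2 * c\<^sup>2" for x
      by (simp add: u_def norm_mult power_mult_distrib mult.commute)
    ultimately show ?thesis by (simp del: of_real_power of_real_mult)
  qed
  have "(c * norm w)\<^sup>2 \<le> (norm (\<pi> g w))\<^sup>2"
    unfolding 1 2
  proof (rule mono)
    fix x show "(r x)\<^sup>2 * c\<^sup>2 \<le> (r x)\<^sup>2 * (cmod (g x))\<^sup>2"
      by (cases "(cmod (g x))\<^sup>2 \<le> c\<^sup>2") (auto simp: r_def intro!: mult_left_mono)
  qed (intro continuous_intros r g)+
  then have "c * norm w \<le> norm (\<pi> g w)" by (rule power2_le_imp_le) simp
  also have "\<dots> \<le> onorm (\<pi> g) * norm w" by (rule onorm[OF bounded_linear[OF g]])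
  also have "\<dots> < c * norm w" using c v by (simp add: w_def)
  finally show False by simp
qed

end


section \<open>Continuous square roots of Gram matrices\<close>

definition sqrt_coeff :: "nat \<Rightarrow> real" where
  "sqrt_coeff k = (- 1) ^ k * ((1/2) gchoose k)"

lemma sqrt_coeff_0 [simp]: "sqrt_coeff 0 = 1"
  by (simp add: sqrt_coeff_def)

lemma sqrt_coeff_Suc: "sqrt_coeff (Suc k) * (real k + 1) = sqrt_coeff k * (real k - 1/2)"
proof -
  have "((1/2) gchoose (Suc k)) * (real k + 1) = ((1/2) gchoose k) * (1/2 - real k)"
    using gbinomial_mult_1[of "1/2::real" k] by (simp add: algebra_simps)
  then have "(- 1) ^ Suc k * (((1/2) gchoose (Suc k)) * (real k + 1)) =
      (- 1) ^ Suc k * (((1/2) gchoose k) * (1/2 - real k))" by simp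
  then show ?thesis by (simp add: sqrt_coeff_def right_diff_distrib mult.assoc)
qed

lemma sqrt_coeff_Suc_nonpos: "sqrt_coeff (Suc k) \<le> 0"
proof (induction k)
  case 0
  show ?case using sqrt_coeff_Suc[of 0] by simp
next
  case (Suc k)
  have "sqrt_coeff (Suc k) * (real (Suc k) - 1/2) \<le> 0"
    using Suc by (intro mult_nonpos_nonneg) auto
  then have "sqrt_coeff (Suc (Suc k)) * (real (Suc k) + 1) \<le> 0" by (simp only: sqrt_coeff_Suc)
  then show ?case by (simp add: mult_le_0_iff)
qed

lemma sum_sqrt_coeff: "(\<Sum>k\<le>n. sqrt_coeff k) = (1 - 2 * real n) * sqrt_coeff n"
proof (induction n)
  case (Suc n)
  then show ?case using sqrt_coeff_Suc[of n] by (simp add: algebra_simps)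
qed simp

text \<open>Only the first coefficient is positive, so the sums of absolute values are 2 minus the
  plain partial sums, which are nonnegative by their closed form. Convergence up to the boundary is
  required because the series is applied to matrices that are merely contractions.\<close>

lemma summable_abs_sqrt_coeff: "summable (\<lambda>k. \<bar>sqrt_coeff k\<bar>)"
proof (rule bounded_imp_summable)
  fix n
  have 1: "\<bar>sqrt_coeff k\<bar> = 2 * (if k = 0 then 1 else 0) - sqrt_coeff k" for k
    by (cases k) (use sqrt_coeff_Suc_nonpos in auto)
  have "(\<Sum>k\<le>n. \<bar>sqrt_coeff k\<bar>) = 2 * (\<Sum>k\<le>n. if k = 0 then 1 else 0) - (\<Sum>k\<le>n. sqrt_coeff k)"
    unfolding 1 sum_subtractf sum_distrib_left ..
  moreover have "(\<Sum>k\<le>n. if k = 0 then 1 else 0 :: real) = 1" by (subst sum.delta) auto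
  moreover have "(\<Sum>k\<le>n. sqrt_coeff k) \<ge> 0"
    unfolding sum_sqrt_coeff by (cases n) (use sqrt_coeff_Suc_nonpos in \<open>auto intro: mult_nonpos_nonpos\<close>)
  ultimately show "(\<Sum>k\<le>n. \<bar>sqrt_coeff k\<bar>) \<le> 2" by linarith
qed simp

text \<open>The series squares to \<open>1 - z\<close>: Vandermonde's identity for the exponents
  \<open>1/2 + 1/2 = 1\<close>.\<close>

lemma sqrt_coeff_convolution:
  "(\<Sum>i\<le>k. sqrt_coeff i * sqrt_coeff (k - i)) = (if k = 0 then 1 else if k = 1 then - 1 else 0)"
proof -
  have "(\<Sum>i\<le>k. sqrt_coeff i * sqrt_coeff (k - i))
      = (\<Sum>i\<le>k. (- 1) ^ k * (((1/2) gchoose i) * ((1/2) gchoose (k - i))))"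
  proof (rule sum.cong[OF refl])
    fix i assume "i \<in> {..k}"
    then have "(- 1 :: real) ^ k = (- 1) ^ i * (- 1) ^ (k - i)" by (simp flip: power_add)
    then show "sqrt_coeff i * sqrt_coeff (k - i) = (- 1) ^ k * (((1/2) gchoose i) * ((1/2) gchoose (k - i)))"
      by (simp add: sqrt_coeff_def)
  qed
  also have "\<dots> = (- 1) ^ k * (1 gchoose k)"
    using gbinomial_Vandermonde[of "1/2::real" "1/2" k] by (simp add: sum_distrib_left[symmetric] atLeast0AtMost)
  also have "(1 gchoose k :: real) = of_nat (1 choose k)" by (simp add: binomial_gbinomial)
  finally show ?thesis by (cases k) (auto simp: binomial_eq_0)
qed

section \<open>Powers of contractive matrices and Gram matrices\<close>

primrec mat_pow :: "nat \<Rightarrow> (nat \<Rightarrow> nat \<Rightarrow> complex) \<Rightarrow> nat \<Rightarrow> nat \<Rightarrow> nat \<Rightarrow> complex" where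
  "mat_pow n b 0 i j = (if i = j then 1 else 0)"
| "mat_pow n b (Suc k) i j = (\<Sum>l<n. b i l * mat_pow n b k l j)"

lemma mat_pow_add:
  assumes "i < n"
  shows "mat_pow n b (k + m) i j = (\<Sum>l<n. mat_pow n b k i l * mat_pow n b m l j)"
  using assms
proof (induction k arbitrary: i)
  case 0
  have "(\<Sum>l<n. mat_pow n b 0 i l * mat_pow n b m l j) = (\<Sum>l<n. if i = l then mat_pow n b m l j else 0)"
    by (intro sum.cong) auto
  then show ?case using 0 by simp
next
  case (Suc k)
  have "mat_pow n b (Suc k + m) i j = (\<Sum>r<n. b i r * (\<Sum>l<n. mat_pow n b k r l * mat_pow n b m l j))"
    using Suc.IH by simp
  also have "\<dots> = (\<Sum>r<n. \<Sum>l<n. b i r * mat_pow n b k r l * mat_pow n b m l j)"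
    by (simp add: sum_distrib_left mult.assoc)
  also have "\<dots> = (\<Sum>l<n. \<Sum>r<n. b i r * mat_pow n b k r l * mat_pow n b m l j)" by (rule sum.swap)
  also have "\<dots> = (\<Sum>l<n. mat_pow n b (Suc k) i l * mat_pow n b m l j)" by (simp add: sum_distrib_right)
  finally show ?case .
qed

lemma mat_pow_1: "j < n \<Longrightarrow> mat_pow n b 1 i j = b i j"
proof -
  assume j: "j < n"
  have "mat_pow n b 1 i j = (\<Sum>l<n. if l = j then b i l else 0)"
    unfolding One_nat_def mat_pow.simps by (intro sum.cong) auto
  then show ?thesis using j by simp
qed

lemma mat_pow_hermitian:
  assumes herm: "\<And>i j. i < n \<Longrightarrow> j < n \<Longrightarrow> b j i = cnj (b i j)" and ij: "i < n" "j < n"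
  shows "mat_pow n b k j i = cnj (mat_pow n b k i j)"
  using ij
proof (induction k arbitrary: i j)
  case (Suc k)
  have "mat_pow n b (Suc k) j i = mat_pow n b (k + 1) j i" by simp
  also have "\<dots> = (\<Sum>l<n. mat_pow n b k j l * mat_pow n b 1 l i)" by (rule mat_pow_add) (use Suc in simp)
  also have "\<dots> = (\<Sum>l<n. cnj (b i l * mat_pow n b k l j))"
  proof (rule sum.cong[OF refl])
    fix l assume l: "l \<in> {..<n}"
    have "mat_pow n b 1 l i = cnj (b i l)" using mat_pow_1[of i n b l] herm[of i l] l Suc.prems by simp
    moreover have "mat_pow n b k j l = cnj (mat_pow n b k l j)" using Suc.IH[of l j] l Suc.prems by simp
    ultimately show "mat_pow n b k j l * mat_pow n b 1 l i = cnj (b i l * mat_pow n b k l j)" by simp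
  qed
  also have "\<dots> = cnj (mat_pow n b (Suc k) i j)" by simp
  finally show ?case .
qed auto

text \<open>A column of the power is the image of a standard basis vector (or of 0, for
  \<open>j\<close> out of range) under iterated contractions, so its Euclidean norm is at most
  1.\<close>

lemma norm_mat_pow_le:
  assumes contr: "\<And>v. (\<Sum>i<n. (cmod (\<Sum>j<n. b i j * v j))\<^sup>2) \<le> (\<Sum>i<n. (cmod (v i))\<^sup>2)"
    and ij: "i < n"
  shows "cmod (mat_pow n b k i j) \<le> 1"
proof -
  have "(\<Sum>i<n. (cmod (mat_pow n b k i j))\<^sup>2) \<le> 1"
  proof (induction k)
    case 0
    have "(\<Sum>i<n. (cmod (mat_pow n b 0 i j))\<^sup>2) = (\<Sum>i<n. if i = j then 1 else 0)"
      by (intro sum.cong) auto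
    then show ?case by simp
  next
    case (Suc k)
    have "(\<Sum>i<n. (cmod (mat_pow n b (Suc k) i j))\<^sup>2) \<le> (\<Sum>i<n. (cmod (mat_pow n b k i j))\<^sup>2)"
      using contr[of "\<lambda>l. mat_pow n b k l j"] by simp
    then show ?case using Suc by linarith
  qed
  moreover have "(cmod (mat_pow n b k i j))\<^sup>2 \<le> (\<Sum>i<n. (cmod (mat_pow n b k i j))\<^sup>2)"
    by (rule member_le_sum) (use ij in auto)
  ultimately have "(cmod (mat_pow n b k i j))\<^sup>2 \<le> 1\<^sup>2" by simp
  then show ?thesis by (rule power2_le_imp_le) simp
qed

lemma Cauchy_Schwarz_complex_sum:
  "(cmod (\<Sum>t\<in>I. x t * y t))\<^sup>2 \<le> (\<Sum>t\<in>I. (cmod (x t))\<^sup>2) * (\<Sum>t\<in>I. (cmod (y t))\<^sup>2)"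
proof -
  have "cmod (\<Sum>t\<in>I. x t * y t) \<le> (\<Sum>t\<in>I. cmod (x t) * cmod (y t))"
    using norm_sum[of "\<lambda>t. x t * y t" I] by (simp add: norm_mult)
  then have "(cmod (\<Sum>t\<in>I. x t * y t))\<^sup>2 \<le> (\<Sum>t\<in>I. cmod (x t) * cmod (y t))\<^sup>2"
    by (rule power_mono) simp
  also have "\<dots> \<le> (\<Sum>t\<in>I. (cmod (x t))\<^sup>2) * (\<Sum>t\<in>I. (cmod (y t))\<^sup>2)" by (rule Cauchy_Schwarz_ineq_sum)
  finally show ?thesis .
qed

text \<open>\<open>R\<close> bounds the trace of the Gram matrix and hence its operator norm. With
  \<open>w\<close> the Gram matrix applied to \<open>v\<close>, the square norm of
  \<open>v - w / R\<close> is that of \<open>v\<close> minus \<open>2 * Y / R\<close> plus that of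
  \<open>w\<close> over \<open>R\<^sup>2\<close>; Cauchy-Schwarz bounds the last term by
  \<open>Y / R\<close>.\<close>

lemma one_minus_gram_contraction:
  fixes d :: "'t \<Rightarrow> nat \<Rightarrow> complex"
  assumes R: "R > 0" "(\<Sum>t\<in>I. \<Sum>i<n. (cmod (d t i))\<^sup>2) \<le> R"
  defines "b \<equiv> \<lambda>i j. (if i = j then 1 else 0) - (\<Sum>t\<in>I. cnj (d t i) * d t j) / of_real R"
  shows "(\<Sum>i<n. (cmod (\<Sum>j<n. b i j * v j))\<^sup>2) \<le> (\<Sum>i<n. (cmod (v i))\<^sup>2)"
proof -
  define y where "y t = (\<Sum>j<n. d t j * v j)" for t
  define w where "w i = (\<Sum>t\<in>I. cnj (d t i) * y t)" for i
  define Y where "Y = (\<Sum>t\<in>I. (cmod (y t))\<^sup>2)"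
  have Y0: "Y \<ge> 0" by (simp add: Y_def sum_nonneg)
  have bv: "(\<Sum>j<n. b i j * v j) = v i - w i / of_real R" if "i < n" for i
  proof -
    have "(\<Sum>j<n. b i j * v j) = (\<Sum>j<n. (if i = j then v j else 0)) -
        (\<Sum>j<n. (\<Sum>t\<in>I. cnj (d t i) * d t j) * v j) / of_real R"
      unfolding sum_divide_distrib sum_subtractf[symmetric]
      by (intro sum.cong refl) (simp add: b_def left_diff_distrib)
    also have "(\<Sum>j<n. (\<Sum>t\<in>I. cnj (d t i) * d t j) * v j) = (\<Sum>j<n. \<Sum>t\<in>I. cnj (d t i) * d t j * v j)"
      by (simp add: sum_distrib_right)
    also have "\<dots> = (\<Sum>t\<in>I. \<Sum>j<n. cnj (d t i) * d t j * v j)" by (rule sum.swap)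
    also have "\<dots> = w i" by (simp add: w_def y_def sum_distrib_left mult.assoc)
    finally show ?thesis using that by simp
  qed
  have w2: "(\<Sum>i<n. (cmod (w i))\<^sup>2) \<le> R * Y"
  proof -
    have "(\<Sum>i<n. (cmod (w i))\<^sup>2) \<le> (\<Sum>i<n. (\<Sum>t\<in>I. (cmod (d t i))\<^sup>2) * Y)"
      unfolding w_def Y_def
      by (rule sum_mono, rule order_trans[OF Cauchy_Schwarz_complex_sum]) simp
    also have "\<dots> = (\<Sum>t\<in>I. \<Sum>i<n. (cmod (d t i))\<^sup>2) * Y"
      by (simp add: sum_distrib_right[symmetric] sum.swap[of _ I])
    also have "\<dots> \<le> R * Y" using R Y0 by (intro mult_right_mono) auto
    finally show ?thesis .
  qed
  have vw: "(\<Sum>i<n. Re (cnj (v i) * w i)) = Y"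
  proof -
    have "(\<Sum>i<n. cnj (v i) * w i) = (\<Sum>i<n. \<Sum>t\<in>I. cnj (v i) * (cnj (d t i) * y t))"
      by (simp add: w_def sum_distrib_left)
    also have "\<dots> = (\<Sum>t\<in>I. \<Sum>i<n. cnj (v i) * (cnj (d t i) * y t))" by (rule sum.swap)
    also have "\<dots> = (\<Sum>t\<in>I. cnj (y t) * y t)"
    proof (rule sum.cong[OF refl])
      fix t
      have "cnj (y t) = (\<Sum>i<n. cnj (v i) * cnj (d t i))" by (simp add: y_def mult.commute)
      then show "(\<Sum>i<n. cnj (v i) * (cnj (d t i) * y t)) = cnj (y t) * y t"
        by (simp add: sum_distrib_right mult.assoc)
    qed
    also have "\<dots> = of_real Y" by (simp add: Y_def complex_norm_square mult.commute del: of_real_power)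
    finally have "Re (\<Sum>i<n. cnj (v i) * w i) = Y" by simp
    then show ?thesis by simp
  qed
  have sq: "(cmod (a - c / of_real R))\<^sup>2 = (cmod a)\<^sup>2 - 2 / R * Re (cnj a * c) + (cmod c)\<^sup>2 / R\<^sup>2" for a c
    unfolding cmod_power2 using R(1) by (simp add: Re_divide_of_real Im_divide_of_real field_simps power2_eq_square)
  have "(\<Sum>i<n. (cmod (\<Sum>j<n. b i j * v j))\<^sup>2) = (\<Sum>i<n. (cmod (v i - w i / of_real R))\<^sup>2)"
    by (intro sum.cong) (auto simp: bv)
  also have "\<dots> = (\<Sum>i<n. (cmod (v i))\<^sup>2) - 2 / R * Y + (\<Sum>i<n. (cmod (w i))\<^sup>2) / R\<^sup>2"
    unfolding sq vw[symmetric] sum.distrib sum_subtractf sum_distrib_left sum_divide_distrib ..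
  also have "\<dots> \<le> (\<Sum>i<n. (cmod (v i))\<^sup>2) - 2 / R * Y + R * Y / R\<^sup>2"
    using w2 by (intro add_left_mono divide_right_mono) auto
  also have "\<dots> = (\<Sum>i<n. (cmod (v i))\<^sup>2) - Y / R"
    using R(1) by (simp add: field_simps power2_eq_square)
  also have "\<dots> \<le> (\<Sum>i<n. (cmod (v i))\<^sup>2)" using R(1) Y0 by simp
  finally show ?thesis .
qed

text \<open>The square root is \<open>sqrt R\<close> times the binomial series of \<open>sqrt (1 - z)\<close> at the contraction
  \<open>1 - a / R\<close>, where \<open>a\<close> is the Gram matrix; the series converges uniformly.\<close>

lemma continuous_square_root_of_gram_matrix:
  fixes d :: "'t \<Rightarrow> nat \<Rightarrow> 'x::topological_space \<Rightarrow> complex"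
  assumes R: "R > 0" "\<And>x. (\<Sum>t\<in>I. \<Sum>i<n. (cmod (d t i x))\<^sup>2) \<le> R"
    and cont: "\<And>t i. t \<in> I \<Longrightarrow> i < n \<Longrightarrow> continuous_on UNIV (d t i)"
  shows "\<exists>s. (\<forall>i<n. \<forall>j<n. continuous_on UNIV (s i j)) \<and>
    (\<forall>i<n. \<forall>j<n. \<forall>x. (\<Sum>t\<in>I. cnj (d t i x) * d t j x) = (\<Sum>k<n. cnj (s k i x) * s k j x))"
proof -
  define a where "a x i j = (\<Sum>t\<in>I. cnj (d t i x) * d t j x)" for x i j
  define b where "b x i j = (if i = j then 1 else 0) - a x i j / of_real R" for x i j
  define P where "P x k i j = mat_pow n (b x) k i j" for x k i j
  define s where "s i j x = of_real (sqrt R) * (\<Sum>k. of_real (sqrt_coeff k) * P x k i j)" for i j x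
  have contr: "(\<Sum>i<n. (cmod (\<Sum>j<n. b x i j * v j))\<^sup>2) \<le> (\<Sum>i<n. (cmod (v i))\<^sup>2)" for x v
    unfolding b_def a_def by (rule one_minus_gram_contraction[OF R])
  have P1: "cmod (P x k i j) \<le> 1" if "i < n" for x k i j
    unfolding P_def by (rule norm_mat_pow_le[OF contr that])
  have bound: "cmod (of_real (sqrt_coeff k) * P x k i j) \<le> \<bar>sqrt_coeff k\<bar>" if "i < n" for x k i j
    using mult_left_mono[OF P1[OF that, of x k j], of "\<bar>sqrt_coeff k\<bar>"] by (simp add: norm_mult)
  have sumn: "summable (\<lambda>k. cmod (of_real (sqrt_coeff k) * P x k i j))" if "i < n" for x i j
    by (rule summable_comparison_test'[OF summable_abs_sqrt_coeff, of 0]) (use bound[OF that] in simp)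
  have herm: "b x j i = cnj (b x i j)" for x i j
    by (auto simp: b_def a_def mult.commute)
  have cont_b: "continuous_on UNIV (\<lambda>x. b x i j)" if "i < n" "j < n" for i j
    unfolding b_def a_def divide_inverse using that by (intro continuous_intros cont)
  have cont_P: "continuous_on UNIV (\<lambda>x. P x k i j)" if "i < n" "j < n" for k i j
    using that
  proof (induction k arbitrary: i)
    case (Suc k)
    have "continuous_on UNIV (\<lambda>x. \<Sum>l<n. b x i l * P x k l j)"
      by (intro continuous_intros cont_b Suc) auto
    then show ?case by (simp add: P_def)
  qed (simp add: P_def)
  have cont_s: "continuous_on UNIV (s i j)" if ij: "i < n" "j < n" for i j
  proof -
    have ul: "uniform_limit UNIV (\<lambda>N x. \<Sum>k<N. of_real (sqrt_coeff k) * P x k i j)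
        (\<lambda>x. \<Sum>k. of_real (sqrt_coeff k) * P x k i j) sequentially"
      by (rule Weierstrass_m_test[OF bound[OF ij(1)] summable_abs_sqrt_coeff])
    have ev: "\<forall>\<^sub>F N in sequentially. continuous_on UNIV (\<lambda>x. \<Sum>k<N. of_real (sqrt_coeff k) * P x k i j)"
      by (intro always_eventually allI continuous_intros cont_P ij)
    have "continuous_on UNIV (\<lambda>x. \<Sum>k. of_real (sqrt_coeff k) * P x k i j)"
      by (rule uniform_limit_theorem[OF ev ul]) simp
    then show ?thesis unfolding s_def[abs_def] by (intro continuous_intros)
  qed
  \<comment> \<open>\<open>s\<close> is Hermitian, so its adjoint times itself is its
    square.\<close>
  have s_sym: "cnj (s k i x) = s i k x" if "i < n" "k < n" for i k x
  proof -
    have "cnj (\<Sum>m. of_real (sqrt_coeff m) * P x m k i) = (\<Sum>m. cnj (of_real (sqrt_coeff m) * P x m k i))"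
      using summable_norm_cancel[OF sumn[OF that(2), of x i]]
      by (rule bounded_linear.suminf[OF bounded_linear_cnj])
    also have "\<dots> = (\<Sum>m. of_real (sqrt_coeff m) * P x m i k)"
    proof (rule suminf_cong)
      fix m
      have "P x m i k = cnj (P x m k i)"
        unfolding P_def by (rule mat_pow_hermitian) (use that in \<open>auto intro: herm\<close>)
      then show "cnj (of_real (sqrt_coeff m) * P x m k i) = of_real (sqrt_coeff m) * P x m i k" by simp
    qed
    finally show ?thesis by (simp add: s_def)
  qed
  have main: "a x i j = (\<Sum>k<n. cnj (s k i x) * s k j x)" if ij: "i < n" "j < n" for i j x
  proof -
    let ?f = "\<lambda>i j k. of_real (sqrt_coeff k) * P x k i j"
    have R': "of_real (sqrt R) * (of_real (sqrt R) :: complex) = of_real R"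
      using R(1) by (simp flip: of_real_mult)
    have "(\<Sum>k<n. cnj (s k i x) * s k j x) = (\<Sum>l<n. s i l x * s l j x)"
      using s_sym ij by (intro sum.cong) auto
    also have "\<dots> = (\<Sum>l<n. of_real R * ((\<Sum>k. ?f i l k) * (\<Sum>k. ?f l j k)))"
      by (intro sum.cong refl) (simp add: s_def R'[symmetric] mult_ac)
    \<comment> \<open>The Cauchy product regroups the square of the series by powers of
      \<open>b\<close>; the convolution of the coefficients leaves only the powers 0 and 1, that is
      \<open>R * (1 - b)\<close>, the Gram matrix.\<close>
    also have "\<dots> = of_real R * (\<Sum>l<n. \<Sum>k. \<Sum>m\<le>k. ?f i l m * ?f l j (k - m))"
      using ij by (simp add: Cauchy_product[OF sumn sumn] sum_distrib_left)
    also have "(\<Sum>l<n. \<Sum>k. \<Sum>m\<le>k. ?f i l m * ?f l j (k - m)) = (\<Sum>k. \<Sum>l<n. \<Sum>m\<le>k. ?f i l m * ?f l j (k - m))"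
      by (rule suminf_sum[symmetric])
        (use ij in \<open>auto intro!: sums_summable[OF Cauchy_product_sums] sumn\<close>)
    also have "(\<lambda>k. \<Sum>l<n. \<Sum>m\<le>k. ?f i l m * ?f l j (k - m))
        = (\<lambda>k. of_real (if k = 0 then 1 else if k = 1 then - 1 else 0) * P x k i j)"
    proof
      fix k
      have "(\<Sum>l<n. \<Sum>m\<le>k. ?f i l m * ?f l j (k - m)) = (\<Sum>m\<le>k. \<Sum>l<n. ?f i l m * ?f l j (k - m))"
        by (rule sum.swap)
      also have "\<dots> = (\<Sum>m\<le>k. of_real (sqrt_coeff m * sqrt_coeff (k - m)) * P x k i j)"
      proof (rule sum.cong[OF refl])
        fix m assume "m \<in> {..k}"
        then have "P x k i j = (\<Sum>l<n. P x m i l * P x (k - m) l j)"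
          using mat_pow_add[OF ij(1), of "b x" m "k - m" j] by (simp add: P_def)
        then show "(\<Sum>l<n. ?f i l m * ?f l j (k - m)) = of_real (sqrt_coeff m * sqrt_coeff (k - m)) * P x k i j"
          by (simp add: sum_distrib_left mult_ac)
      qed
      also have "\<dots> = of_real (\<Sum>m\<le>k. sqrt_coeff m * sqrt_coeff (k - m)) * P x k i j"
        by (simp add: sum_distrib_right)
      finally show "(\<Sum>l<n. \<Sum>m\<le>k. ?f i l m * ?f l j (k - m))
          = of_real (if k = 0 then 1 else if k = 1 then - 1 else 0) * P x k i j"
        unfolding sqrt_coeff_convolution .
    qed
    also have "(\<Sum>k. of_real (if k = 0 then 1 else if k = 1 then - 1 else 0) * P x k i j)
        = (\<Sum>k\<in>{0, 1}. of_real (if k = 0 then 1 else if k = 1 then - 1 else 0) * P x k i j)"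
      by (rule suminf_finite) auto
    also have "\<dots> = (if i = j then 1 else 0) - b x i j"
      using mat_pow_1[OF ij(2), of "b x" i] by (simp add: P_def del: mat_pow.simps(2))
    also have "\<dots> = a x i j / of_real R" by (simp add: b_def)
    finally show ?thesis using R(1) by simp
  qed
  show ?thesis
    by (intro exI[of _ s] conjI allI impI cont_s) (simp_all add: main[unfolded a_def])
qed


section \<open>The diagonal algebras\<close>

text \<open>Separated from its infimum because a lower bound for \<open>rcp\<close> has to be
  applied to a member, and an infimum of naturals is a member only of a nonempty set.\<close>

definition rcp_ranks ::
    "'a cstar \<Rightarrow> ('a \<Rightarrow> 'h::chilbert_space \<Rightarrow> 'h) \<Rightarrow> 'a set \<Rightarrow> real \<Rightarrow> nat set" where
  "rcp_ranks A \<pi> \<Omega> \<delta> = {r. \<exists>(B :: (nat \<Rightarrow> complex) cstar) \<phi> \<psi>.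
            cstar_algebra B \<and> finite_dimensional B \<and> \<one>\<^bsub>B\<^esub> \<noteq> \<zero>\<^bsub>B\<^esub> \<and>
            contractive_cp A B \<phi> \<and> contractive_cp B operator_algebra \<psi> \<and>
            (\<forall>x\<in>\<Omega>. onorm (\<lambda>h. \<psi> (\<phi> x) h - \<pi> x h) < \<delta>) \<and>
            has_rank B r}"

lemma rcp_eq_Inf: "rcp A \<pi> \<Omega> \<delta> = Inf (rcp_ranks A \<pi> \<Omega> \<delta>)"
  by (simp add: rcp_def rcp_ranks_def)

text \<open>Continuous functions, operators and diagonal algebras all add pointwise; this turns
  their abstract finite sums into ordinary ones.\<close>

lemma finsum_pointwise:
  fixes G :: "('i \<Rightarrow> 'b::comm_monoid_add, 'm) ring_scheme"
  assumes G: "abelian_monoid G" and add: "add G = (\<lambda>f g x. f x + g x)" and zero: "zero G = (\<lambda>x. 0)"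
    and "finite I" and "\<And>i. i \<in> I \<Longrightarrow> F i \<in> carrier G"
  shows "finsum G F I = (\<lambda>x. \<Sum>i\<in>I. F i x)"
  using assms(4,5)
proof (induction I)
  case empty
  show ?case by (simp add: abelian_monoid.finsum_empty[OF G] zero)
next
  case (insert i I)
  then have "finsum G F (insert i I) = F i \<oplus>\<^bsub>G\<^esub> finsum G F I"
    by (intro abelian_monoid.finsum_insert[OF G]) auto
  then show ?case using insert by (simp add: add)
qed

lemma scaleC_zero_right: "scaleC c (0 :: 'h::chilbert_space) = 0"
  using scaleC_add_right[of c 0 "0 :: 'h"] by simp

lemma abelian_monoid_operator_algebra:
  "abelian_monoid (operator_algebra :: ('h::chilbert_space \<Rightarrow> 'h) cstar)"
  by (rule abelian_monoidI)
    (auto simp: operator_algebra_def bounded_operators_def scaleC_add_right bounded_linear_add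
      add.assoc add.commute scaleC_zero_right)

lemma abelian_monoid_continuous_functions: "abelian_monoid continuous_functions"
  by (rule abelian_monoidI)
    (auto simp: continuous_functions_def add.assoc add.commute intro!: continuous_intros)

text \<open>Sequences vanishing from \<open>N\<close> on put all dimensions into the one element
  type that \<open>rcp\<close> prescribes. The norm is a maximum over \<open>{..<N}\<close>, hence
  meaningful for \<open>N \<ge> 1\<close>.\<close>

definition diagonal_algebra :: "nat \<Rightarrow> (nat \<Rightarrow> complex) cstar" where
  "diagonal_algebra N =
     \<lparr>carrier = {f. \<forall>i\<ge>N. f i = 0},
      mult = (\<lambda>f g i. f i * g i),
      one = (\<lambda>i. if i < N then 1 else 0),
      zero = (\<lambda>i. 0),
      add = (\<lambda>f g i. f i + g i),
      smult = (\<lambda>c f i. c * f i),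
      star = (\<lambda>f i. cnj (f i)),
      cnorm = (\<lambda>f. Max ((\<lambda>i. cmod (f i)) ` {..<N}))\<rparr>"

lemma diagonal_algebra_simps [simp]:
  "f \<in> carrier (diagonal_algebra N) \<longleftrightarrow> (\<forall>i\<ge>N. f i = 0)"
  "f \<otimes>\<^bsub>diagonal_algebra N\<^esub> g = (\<lambda>i. f i * g i)"
  "\<one>\<^bsub>diagonal_algebra N\<^esub> = (\<lambda>i. if i < N then 1 else 0)"
  "\<zero>\<^bsub>diagonal_algebra N\<^esub> = (\<lambda>i. 0)"
  "f \<oplus>\<^bsub>diagonal_algebra N\<^esub> g = (\<lambda>i. f i + g i)"
  "c \<odot>\<^bsub>diagonal_algebra N\<^esub> f = (\<lambda>i. c * f i)"
  "star (diagonal_algebra N) f = (\<lambda>i. cnj (f i))"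
  "cnorm (diagonal_algebra N) f = Max ((\<lambda>i. cmod (f i)) ` {..<N})"
  by (simp_all add: diagonal_algebra_def)



lemma abelian_group_diagonal_algebra: "abelian_group (diagonal_algebra N)"
proof (rule abelian_groupI)
  fix f assume "f \<in> carrier (diagonal_algebra N)"
  then show "\<exists>g\<in>carrier (diagonal_algebra N). g \<oplus>\<^bsub>diagonal_algebra N\<^esub> f = \<zero>\<^bsub>diagonal_algebra N\<^esub>"
    by (intro bexI[of _ "\<lambda>i. - f i"]) auto
qed (auto simp: add.assoc add.commute)

lemma minus_diagonal_algebra:
  assumes "g \<in> carrier (diagonal_algebra N)"
  shows "f \<ominus>\<^bsub>diagonal_algebra N\<^esub> g = (\<lambda>i. f i - g i)"
proof -
  have "\<ominus>\<^bsub>diagonal_algebra N\<^esub> g = (\<lambda>i. - g i)"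
    by (rule abelian_group.minus_equality[OF abelian_group_diagonal_algebra]) (use assms in auto)
  then show ?thesis by (simp add: a_minus_def)
qed

lemma finsum_diagonal_algebra:
  assumes "finite I" "\<And>i. i \<in> I \<Longrightarrow> F i \<in> carrier (diagonal_algebra N)"
  shows "finsum (diagonal_algebra N) F I = (\<lambda>x. \<Sum>i\<in>I. F i x)"
  by (rule finsum_pointwise)
    (use assms abelian_group.axioms(1)[OF abelian_group_diagonal_algebra] in \<open>auto simp: diagonal_algebra_def\<close>)

lemma cring_complex_ring: "cring complex_ring"
proof (rule cringI)
  show "abelian_group complex_ring"
  proof (rule abelian_groupI)
    fix x assume "x \<in> carrier complex_ring"
    show "\<exists>y\<in>carrier complex_ring. y \<oplus>\<^bsub>complex_ring\<^esub> x = \<zero>\<^bsub>complex_ring\<^esub>"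
      by (intro bexI[of _ "- x"]) (auto simp: complex_ring_def)
  qed (auto simp: complex_ring_def)
  show "Group.comm_monoid complex_ring" by (rule comm_monoidI) (auto simp: complex_ring_def)
qed (auto simp: complex_ring_def algebra_simps)

lemma cmod_le_cnorm_diagonal: "i < N \<Longrightarrow> cmod (f i) \<le> cnorm (diagonal_algebra N) f"
  by (auto intro: Max_ge)

lemma cnorm_diagonal_le_iff:
  "N \<ge> 1 \<Longrightarrow> cnorm (diagonal_algebra N) f \<le> c \<longleftrightarrow> (\<forall>i<N. cmod (f i) \<le> c)"
  by (subst diagonal_algebra_simps, subst Max_le_iff) (auto simp: lessThan_empty_iff)

lemma cnorm_diagonal_attained:
  assumes "N \<ge> 1"
  obtains i where "i < N" "cnorm (diagonal_algebra N) f = cmod (f i)"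
proof -
  have "Max ((\<lambda>i. cmod (f i)) ` {..<N}) \<in> (\<lambda>i. cmod (f i)) ` {..<N}"
    using assms by (intro Max_in) (auto simp: lessThan_empty_iff)
  then show ?thesis using that by auto
qed

lemma cstar_algebra_diagonal:
  assumes N: "N \<ge> 1"
  shows "cstar_algebra (diagonal_algebra N)"
proof (intro cstar_algebra.intro)
  let ?A = "diagonal_algebra N"
  note le = cmod_le_cnorm_diagonal and le_iff = cnorm_diagonal_le_iff[OF N]
  show "ring ?A"
  proof (rule ringI[OF abelian_group_diagonal_algebra])
    show "Group.monoid ?A" by (rule monoidI) (auto simp: fun_eq_iff mult.assoc)
  qed (auto simp: algebra_simps)
  show "module complex_ring ?A"
    by (rule moduleI[OF cring_complex_ring abelian_group_diagonal_algebra])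
      (auto simp: complex_ring_def algebra_simps)
  show "cstar_algebra_axioms ?A"
  proof (rule cstar_algebra_axioms.intro)
    fix f assume f: "f \<in> carrier ?A"
    obtain i where i: "i < N" "cnorm ?A f = cmod (f i)" by (rule cnorm_diagonal_attained[OF N])
    show pos: "0 \<le> cnorm ?A f" using i(2) by simp
    show "cnorm ?A f = 0 \<longleftrightarrow> f = \<zero>\<^bsub>?A\<^esub>"
    proof
      assume "cnorm ?A f = 0"
      then have "\<forall>j<N. f j = 0" using le[of _ N f] by auto
      then show "f = \<zero>\<^bsub>?A\<^esub>" using f by (auto simp: fun_eq_iff) (metis not_less)
    next
      assume "f = \<zero>\<^bsub>?A\<^esub>" then show "cnorm ?A f = 0" using i(2) by simp
    qed
    show "cnorm ?A (star ?A f \<otimes>\<^bsub>?A\<^esub> f) = (cnorm ?A f)\<^sup>2"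
    proof (rule antisym)
      show "cnorm ?A (star ?A f \<otimes>\<^bsub>?A\<^esub> f) \<le> (cnorm ?A f)\<^sup>2"
        unfolding le_iff
        by (auto simp: norm_mult power2_eq_square simp del: diagonal_algebra_simps(8) intro!: mult_mono le pos)
      show "(cnorm ?A f)\<^sup>2 \<le> cnorm ?A (star ?A f \<otimes>\<^bsub>?A\<^esub> f)"
        using le[OF i(1), of "star ?A f \<otimes>\<^bsub>?A\<^esub> f"] unfolding i(2) by (simp add: norm_mult power2_eq_square)
    qed
    show "cnorm ?A (c \<odot>\<^bsub>?A\<^esub> f) = cmod c * cnorm ?A f" for c
    proof (rule antisym)
      show "cnorm ?A (c \<odot>\<^bsub>?A\<^esub> f) \<le> cmod c * cnorm ?A f"
        unfolding le_iff
        by (auto simp: norm_mult simp del: diagonal_algebra_simps(8) intro!: mult_left_mono le)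
      show "cmod c * cnorm ?A f \<le> cnorm ?A (c \<odot>\<^bsub>?A\<^esub> f)"
        using le[OF i(1), of "c \<odot>\<^bsub>?A\<^esub> f"] unfolding i(2) by (simp add: norm_mult)
    qed
    fix g assume g: "g \<in> carrier ?A"
    obtain j where j: "j < N" "cnorm ?A g = cmod (g j)" by (rule cnorm_diagonal_attained[OF N])
    show "cnorm ?A (f \<oplus>\<^bsub>?A\<^esub> g) \<le> cnorm ?A f + cnorm ?A g"
      unfolding le_iff
      by (auto simp del: diagonal_algebra_simps(8) intro!: norm_triangle_mono le)
    show "cnorm ?A (f \<otimes>\<^bsub>?A\<^esub> g) \<le> cnorm ?A f * cnorm ?A g"
      unfolding le_iff
      by (auto simp: norm_mult simp del: diagonal_algebra_simps(8) intro!: mult_mono le pos)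
  next
    fix s :: "nat \<Rightarrow> nat \<Rightarrow> complex"
    assume s: "range s \<subseteq> carrier ?A"
      and cauchy: "\<forall>e>0. \<exists>M. \<forall>m\<ge>M. \<forall>n\<ge>M. cnorm ?A (s m \<ominus>\<^bsub>?A\<^esub> s n) < e"
    have sc: "s n \<in> carrier ?A" for n using s by blast
    have diff: "s m \<ominus>\<^bsub>?A\<^esub> s n = (\<lambda>i. s m i - s n i)" for m n by (rule minus_diagonal_algebra[OF sc])
    have "\<exists>l. (\<lambda>n. s n i) \<longlonglongrightarrow> l" if "i < N" for i
    proof -
      have "Cauchy (\<lambda>n. s n i)"
      proof (rule CauchyI)
        fix e :: real assume "e > 0"
        with cauchy obtain M where M: "\<forall>m\<ge>M. \<forall>n\<ge>M. cnorm ?A (s m \<ominus>\<^bsub>?A\<^esub> s n) < e" by blast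
        have "norm (s m i - s n i) < e" if "m \<ge> M" "n \<ge> M" for m n
          using le[OF \<open>i < N\<close>, of "s m \<ominus>\<^bsub>?A\<^esub> s n"] M that unfolding diff by fastforce
        then show "\<exists>M. \<forall>m\<ge>M. \<forall>n\<ge>M. norm (s m i - s n i) < e" by blast
      qed
      then show ?thesis using Cauchy_convergent unfolding convergent_def by blast
    qed
    then obtain l where l: "\<And>i. i < N \<Longrightarrow> (\<lambda>n. s n i) \<longlonglongrightarrow> l i" by metis
    define x where "x i = (if i < N then l i else 0)" for i
    have x: "x \<in> carrier ?A" by (simp add: x_def)
    have "(\<lambda>n. cnorm ?A (s n \<ominus>\<^bsub>?A\<^esub> x)) \<longlonglongrightarrow> 0"
    proof (rule tendsto_sandwich[of "\<lambda>_. 0" _ _ "\<lambda>n. \<Sum>i<N. cmod (s n i - l i)"])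
      show "(\<lambda>n. \<Sum>i<N. cmod (s n i - l i)) \<longlonglongrightarrow> 0"
        by (intro tendsto_null_sum tendsto_norm_zero) (use l in \<open>simp add: LIM_zero\<close>)
      have d: "s n \<ominus>\<^bsub>?A\<^esub> x = (\<lambda>i. s n i - x i)" for n by (rule minus_diagonal_algebra[OF x])
      show "\<forall>\<^sub>F n in sequentially. 0 \<le> cnorm ?A (s n \<ominus>\<^bsub>?A\<^esub> x)"
        using cnorm_diagonal_attained[OF N] norm_ge_zero by (metis (no_types, lifting) always_eventually)
      show "\<forall>\<^sub>F n in sequentially. cnorm ?A (s n \<ominus>\<^bsub>?A\<^esub> x) \<le> (\<Sum>i<N. cmod (s n i - l i))"
      proof (rule always_eventually, rule allI)
        fix n
        obtain j where j: "j < N" "cnorm ?A (s n \<ominus>\<^bsub>?A\<^esub> x) = cmod ((s n \<ominus>\<^bsub>?A\<^esub> x) j)"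
          by (rule cnorm_diagonal_attained[OF N])
        have "cmod (s n j - l j) \<le> (\<Sum>i<N. cmod (s n i - l i))"
          by (rule member_le_sum) (use j in auto)
        then show "cnorm ?A (s n \<ominus>\<^bsub>?A\<^esub> x) \<le> (\<Sum>i<N. cmod (s n i - l i))"
          using j unfolding d by (simp add: x_def)
      qed
    qed simp
    then show "\<exists>x\<in>carrier ?A. (\<lambda>n. cnorm ?A (s n \<ominus>\<^bsub>?A\<^esub> x)) \<longlonglongrightarrow> 0" using x by blast
  qed (auto simp: fun_eq_iff algebra_simps)
qed

lemma has_dimension_diagonal: "has_dimension (diagonal_algebra N) (carrier (diagonal_algebra N)) N"
proof -
  define b where "b i = (\<lambda>j. if j = i then 1 else 0 :: complex)" for i :: nat
  have fs: "(\<Oplus>\<^bsub>diagonal_algebra N\<^esub>i\<in>{..<N}. c i \<odot>\<^bsub>diagonal_algebra N\<^esub> b i) = (\<lambda>j. if j < N then c j else 0)" for c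
  proof -
    have "(\<Oplus>\<^bsub>diagonal_algebra N\<^esub>i\<in>{..<N}. c i \<odot>\<^bsub>diagonal_algebra N\<^esub> b i)
        = (\<lambda>j. \<Sum>i<N. (c i \<odot>\<^bsub>diagonal_algebra N\<^esub> b i) j)"
      by (rule finsum_diagonal_algebra) (auto simp: b_def)
    also have "\<dots> = (\<lambda>j. \<Sum>i<N. if j = i then c i else 0)"
      by (simp add: b_def if_distrib cong: if_cong)
    finally show ?thesis by simp
  qed
  show ?thesis
    unfolding has_dimension_def
  proof (rule exI[of _ b], unfold fs, intro conjI ballI)
    show "\<forall>i<N. b i \<in> carrier (diagonal_algebra N)" by (simp add: b_def)
    fix x assume x: "x \<in> carrier (diagonal_algebra N)"
    show "\<exists>!c. (\<forall>i\<ge>N. c i = 0) \<and> x = (\<lambda>j. if j < N then c j else 0)"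
    proof (rule ex1I[of _ x])
      show "(\<forall>i\<ge>N. x i = 0) \<and> x = (\<lambda>j. if j < N then x j else 0)" using x by auto
      fix c assume "(\<forall>i\<ge>N. c i = 0) \<and> x = (\<lambda>j. if j < N then c j else 0)"
      then show "c = x" by (auto simp: fun_eq_iff)
    qed
  qed
qed

text \<open>A commutative algebra is its own maximal abelian subalgebra.\<close>

lemma has_rank_diagonal: "has_rank (diagonal_algebra N) N"
proof -
  let ?A = "diagonal_algebra N"
  have "cstar_subalgebra ?A (carrier ?A)" unfolding cstar_subalgebra_def by simp
  then have "abelian_cstar_subalgebra ?A (carrier ?A)"
    unfolding abelian_cstar_subalgebra_def by (simp add: mult.commute)
  moreover have "E \<subseteq> carrier ?A" if "abelian_cstar_subalgebra ?A E" for E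
    using that unfolding abelian_cstar_subalgebra_def cstar_subalgebra_def by blast
  ultimately have "maximal_abelian_cstar_subalgebra ?A (carrier ?A)"
    unfolding maximal_abelian_cstar_subalgebra_def by blast
  then show ?thesis using has_dimension_diagonal unfolding has_rank_def by blast
qed


section \<open>Approximation by partitions of unity\<close>

lemma bdd_above_continuous_function:
  fixes g :: "'x::topological_space \<Rightarrow> complex"
  assumes "compact (UNIV :: 'x set)" "continuous_on UNIV g"
  shows "bdd_above (range (\<lambda>x. cmod (g x)))"
  using compact_imp_bounded[OF compact_continuous_image[OF continuous_on_norm[OF assms(2)] assms(1)]]
  by (rule bounded_imp_bdd_above)

lemma cmod_le_cnorm_continuous_functions:
  fixes g :: "'x::topological_space \<Rightarrow> complex"
  assumes "compact (UNIV :: 'x set)" "continuous_on UNIV g"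
  shows "cmod (g x) \<le> cnorm continuous_functions g"
  using cSUP_upper[OF UNIV_I bdd_above_continuous_function[OF assms]]
  by (simp add: continuous_functions_def)

lemma cnorm_continuous_functions_le:
  assumes "\<And>x. cmod (g x) \<le> c"
  shows "cnorm continuous_functions g \<le> c"
  using assms by (auto simp: continuous_functions_def intro: cSUP_least)



text \<open>Evaluation is multiplicative and respects adjoints, so it carries the factorisation of a
  positive matrix entry by entry to one of the image.\<close>

lemma contractive_cp_evaluation:
  fixes pt :: "nat \<Rightarrow> 'x::topological_space"
  assumes X: "compact (UNIV :: 'x set)" and N: "N \<ge> 1"
  shows "contractive_cp continuous_functions (diagonal_algebra N) (\<lambda>g i. if i < N then g (pt i) else 0)"
    (is "contractive_cp ?C ?D ?\<phi>")
  unfolding contractive_cp_def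
proof (intro conjI ballI allI impI)
  fix g assume "g \<in> carrier ?C"
  then have g: "continuous_on UNIV g" by (simp add: continuous_functions_def)
  show "cnorm ?D (?\<phi> g) \<le> cnorm ?C g"
    unfolding cnorm_diagonal_le_iff[OF N] using cmod_le_cnorm_continuous_functions[OF X g] by auto
next
  fix n and a :: "nat \<Rightarrow> nat \<Rightarrow> 'x \<Rightarrow> complex"
  assume "positive_matrix ?C n a"
  then obtain c where c: "\<And>i j. i < n \<Longrightarrow> j < n \<Longrightarrow> c i j \<in> carrier ?C"
    and a: "\<And>i j. i < n \<Longrightarrow> j < n \<Longrightarrow> a i j = (\<Oplus>\<^bsub>?C\<^esub>k\<in>{..<n}. star ?C (c k i) \<otimes>\<^bsub>?C\<^esub> c k j)"
    unfolding positive_matrix_def by blast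
  have a': "a i j = (\<lambda>x. \<Sum>k<n. cnj (c k i x) * c k j x)" if "i < n" "j < n" for i j
  proof -
    have "a i j = (\<lambda>x. \<Sum>k<n. (star ?C (c k i) \<otimes>\<^bsub>?C\<^esub> c k j) x)"
      unfolding a[OF that]
      by (rule finsum_pointwise[OF abelian_monoid_continuous_functions])
        (use c that in \<open>auto simp: continuous_functions_def intro!: continuous_intros\<close>)
    then show ?thesis by (simp add: continuous_functions_def)
  qed
  show "positive_matrix ?D n (\<lambda>i j. ?\<phi> (a i j))"
    unfolding positive_matrix_def
  proof (intro exI[of _ "\<lambda>i j. ?\<phi> (c i j)"] conjI allI impI)
    fix i j assume ij: "i < n" "j < n"
    have "(\<Oplus>\<^bsub>?D\<^esub>k\<in>{..<n}. star ?D (?\<phi> (c k i)) \<otimes>\<^bsub>?D\<^esub> ?\<phi> (c k j))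
        = (\<lambda>m. \<Sum>k<n. (star ?D (?\<phi> (c k i)) \<otimes>\<^bsub>?D\<^esub> ?\<phi> (c k j)) m)"
      by (rule finsum_diagonal_algebra) auto
    then show "?\<phi> (a i j) = (\<Oplus>\<^bsub>?D\<^esub>k\<in>{..<n}. star ?D (?\<phi> (c k i)) \<otimes>\<^bsub>?D\<^esub> ?\<phi> (c k j))"
      by (auto simp: a'[OF ij])
  qed auto
qed (auto simp: continuous_functions_def)

context function_representation
begin

lemma sum:
  assumes "finite I" "\<And>k. k \<in> I \<Longrightarrow> continuous_on UNIV (f k)"
  shows "\<pi> (\<lambda>x. \<Sum>k\<in>I. f k x) h = (\<Sum>k\<in>I. \<pi> (f k) h)"
  using assms
proof (induction I)
  case empty
  have zero: "continuous_on UNIV (\<lambda>x::'x. 0 :: complex)" by simp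
  show ?case using add[OF zero zero, of h] by simp
next
  case (insert k I)
  then have "continuous_on UNIV (f k)" "continuous_on UNIV (\<lambda>x. \<Sum>k\<in>I. f k x)"
    by (auto intro!: continuous_intros)
  from add[OF this, of h] show ?case using insert by simp
qed

text \<open>Positivity of matrices is the delicate point. If \<open>c\<close> factors the given
  matrix, the image is the Gram matrix of the functions \<open>sqrt (p m) * c k i m\<close>, indexed
  by the pairs \<open>(k, m)\<close>; only its continuous square root has the \<open>n\<close> rows
  that \<open>positive_matrix\<close> asks for.\<close>

lemma contractive_cp_partition_of_unity:
  fixes p :: "nat \<Rightarrow> 'x \<Rightarrow> real"
  assumes N: "N \<ge> 1" and p: "\<And>m. m < N \<Longrightarrow> continuous_on UNIV (p m)"
    and p0: "\<And>m x. m < N \<Longrightarrow> p m x \<ge> 0" and p1: "\<And>x. (\<Sum>m<N. p m x) = 1"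
  shows "contractive_cp (diagonal_algebra N) operator_algebra (\<lambda>c. \<pi> (\<lambda>x. \<Sum>m<N. c m * of_real (p m x)))"
    (is "contractive_cp ?D ?O ?\<psi>")
  unfolding contractive_cp_def
proof (intro conjI ballI allI impI)
  have cont: "continuous_on UNIV (\<lambda>x. \<Sum>m<N. c m * complex_of_real (p m x))" for c :: "nat \<Rightarrow> complex"
    by (intro continuous_intros p) auto
  show "?\<psi> \<in> carrier ?D \<rightarrow> carrier ?O"
    using bounded_operator[OF cont] by (auto simp: operator_algebra_def)
  fix c
  show "cnorm ?O (?\<psi> c) \<le> cnorm ?D c"
  proof -
    have "cmod (\<Sum>m<N. c m * complex_of_real (p m x)) \<le> cnorm ?D c" for x
    proof -
      have "cmod (\<Sum>m<N. c m * complex_of_real (p m x)) \<le> (\<Sum>m<N. cmod (c m * complex_of_real (p m x)))"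
        by (rule norm_sum)
      also have "\<dots> \<le> (\<Sum>m<N. cnorm ?D c * p m x)"
      proof (rule sum_mono)
        fix m assume "m \<in> {..<N}"
        then show "cmod (c m * complex_of_real (p m x)) \<le> cnorm ?D c * p m x"
          using p0[of m x] cmod_le_cnorm_diagonal[of m N c] by (simp add: norm_mult mult_right_mono)
      qed
      also have "\<dots> = cnorm ?D c" by (simp add: sum_distrib_left[symmetric] p1)
      finally show ?thesis .
    qed
    from onorm_le[OF cont this] show ?thesis by (simp add: operator_algebra_def)
  qed
  show "?\<psi> (c \<oplus>\<^bsub>?D\<^esub> c') = ?\<psi> c \<oplus>\<^bsub>?O\<^esub> ?\<psi> c'" for c'
    using add[OF cont[of c] cont[of c']]
    by (simp add: operator_algebra_def fun_eq_iff distrib_right sum.distrib)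
  show "?\<psi> (z \<odot>\<^bsub>?D\<^esub> c) = z \<odot>\<^bsub>?O\<^esub> ?\<psi> c" for z
    using smult[OF cont[of c], of z]
    by (simp add: operator_algebra_def fun_eq_iff sum_distrib_left mult.assoc)
next
  fix n and a :: "nat \<Rightarrow> nat \<Rightarrow> nat \<Rightarrow> complex"
  assume "positive_matrix ?D n a"
  then obtain c where c: "\<And>i j. i < n \<Longrightarrow> j < n \<Longrightarrow> c i j \<in> carrier ?D"
    and a: "\<And>i j. i < n \<Longrightarrow> j < n \<Longrightarrow> a i j = (\<Oplus>\<^bsub>?D\<^esub>k\<in>{..<n}. star ?D (c k i) \<otimes>\<^bsub>?D\<^esub> c k j)"
    unfolding positive_matrix_def by blast
  have a': "a i j = (\<lambda>m. \<Sum>k<n. cnj (c k i m) * c k j m)" if "i < n" "j < n" for i j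
  proof -
    have "a i j = (\<lambda>m. \<Sum>k<n. (star ?D (c k i) \<otimes>\<^bsub>?D\<^esub> c k j) m)"
      unfolding a[OF that] by (rule finsum_diagonal_algebra) (use c that in auto)
    then show ?thesis by simp
  qed
  define d where "d t i x = of_real (sqrt (p (snd t) x)) * c (fst t) i (snd t)"
    for t :: "nat \<times> nat" and i and x
  \<comment> \<open>A bound independent of \<open>x\<close> since all weights are at most 1; the
    summand 1 makes it positive even when all entries vanish.\<close>
  define R where "R = 1 + (\<Sum>t\<in>{..<n} \<times> {..<N}. \<Sum>i<n. (cmod (c (fst t) i (snd t)))\<^sup>2)"
  have ple: "p m x \<le> 1" if "m < N" for m x
    using member_le_sum[of m "{..<N}" "\<lambda>m. p m x"] p0 p1[of x] that by auto
  have R0: "R > 0" unfolding R_def by (intro add_pos_nonneg sum_nonneg) auto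
  have R1: "(\<Sum>t\<in>{..<n} \<times> {..<N}. \<Sum>i<n. (cmod (d t i x))\<^sup>2) \<le> R" for x
    proof -
      have "(\<Sum>t\<in>{..<n} \<times> {..<N}. \<Sum>i<n. (cmod (d t i x))\<^sup>2)
          \<le> (\<Sum>t\<in>{..<n} \<times> {..<N}. \<Sum>i<n. (cmod (c (fst t) i (snd t)))\<^sup>2)"
      proof (intro sum_mono)
        fix t i assume t: "t \<in> {..<n} \<times> {..<N}"
        have "(cmod (d t i x))\<^sup>2 = p (snd t) x * (cmod (c (fst t) i (snd t)))\<^sup>2"
          using t p0[of "snd t" x] by (auto simp: d_def norm_mult power_mult_distrib)
        then show "(cmod (d t i x))\<^sup>2 \<le> (cmod (c (fst t) i (snd t)))\<^sup>2"
          using t ple[of "snd t" x] p0[of "snd t" x] by (auto intro: mult_left_le_one_le)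
      qed
      then show ?thesis by (simp add: R_def)
    qed
  have d: "continuous_on UNIV (d t i)" if "t \<in> {..<n} \<times> {..<N}" "i < n" for t i
    unfolding d_def using that by (intro continuous_intros p) auto
  have "\<exists>s. (\<forall>i<n. \<forall>j<n. continuous_on UNIV (s i j)) \<and> (\<forall>i<n. \<forall>j<n. \<forall>x.
      (\<Sum>t\<in>{..<n} \<times> {..<N}. cnj (d t i x) * d t j x) = (\<Sum>k<n. cnj (s k i x) * s k j x))"
    by (rule continuous_square_root_of_gram_matrix[OF R0 R1]) (rule d)
  then obtain s where s: "\<forall>i<n. \<forall>j<n. continuous_on UNIV (s i j)"
    and s_eq: "\<forall>i<n. \<forall>j<n. \<forall>x.
      (\<Sum>t\<in>{..<n} \<times> {..<N}. cnj (d t i x) * d t j x) = (\<Sum>k<n. cnj (s k i x) * s k j x)"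
    by (elim exE conjE)
  note s = s[rule_format] and s_eq = s_eq[rule_format]
  have fact: "(\<Sum>m<N. a i j m * of_real (p m x)) = (\<Sum>k<n. cnj (s k i x) * s k j x)"
    if ij: "i < n" "j < n" for i j x
  proof -
    have "(\<Sum>m<N. a i j m * of_real (p m x)) = (\<Sum>m<N. \<Sum>k<n. cnj (d (k, m) i x) * d (k, m) j x)"
    proof (rule sum.cong[OF refl])
      fix m assume m: "m \<in> {..<N}"
      have "complex_of_real (p m x) = of_real (sqrt (p m x)) * of_real (sqrt (p m x))"
        using p0[of m x] m by (simp flip: of_real_mult)
      then show "a i j m * of_real (p m x) = (\<Sum>k<n. cnj (d (k, m) i x) * d (k, m) j x)"
        unfolding a'[OF ij] sum_distrib_right by (intro sum.cong refl) (simp add: d_def mult_ac)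
    qed
    also have "\<dots> = (\<Sum>k<n. \<Sum>m<N. cnj (d (k, m) i x) * d (k, m) j x)" by (rule sum.swap)
    also have "\<dots> = (\<Sum>t\<in>{..<n} \<times> {..<N}. cnj (d t i x) * d t j x)"
      by (simp add: sum.cartesian_product case_prod_unfold)
    finally show ?thesis using s_eq[OF ij] by simp
  qed
  have carrier_O: "carrier ?O = bounded_operators" by (simp add: operator_algebra_def)
  show "positive_matrix ?O n (\<lambda>i j. ?\<psi> (a i j))"
    unfolding positive_matrix_def
  proof (intro exI[of _ "\<lambda>i j. \<pi> (s i j)"] conjI allI impI)
    fix i j assume ij: "i < n" "j < n"
    show "\<pi> (s i j) \<in> carrier ?O" using bounded_operator[OF s[OF ij]] by (simp add: operator_algebra_def)
    have cs: "continuous_on UNIV (\<lambda>x. cnj (s k i x))" if "k < n" for k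
      by (intro continuous_intros s ij that)
    have summand: "star ?O (\<pi> (s k i)) \<otimes>\<^bsub>?O\<^esub> \<pi> (s k j) = \<pi> (\<lambda>x. cnj (s k i x) * s k j x)" if "k < n" for k
      using mult[OF cs[OF that] s[OF that ij(2)]] star[OF s[OF that ij(1)]]
      by (simp add: operator_algebra_def fun_eq_iff)
    have "(\<Oplus>\<^bsub>?O\<^esub>k\<in>{..<n}. star ?O (\<pi> (s k i)) \<otimes>\<^bsub>?O\<^esub> \<pi> (s k j))
        = (\<lambda>h. \<Sum>k<n. (star ?O (\<pi> (s k i)) \<otimes>\<^bsub>?O\<^esub> \<pi> (s k j)) h)"
    proof (rule finsum_pointwise[OF abelian_monoid_operator_algebra])
      show "star ?O (\<pi> (s k i)) \<otimes>\<^bsub>?O\<^esub> \<pi> (s k j) \<in> carrier ?O" if "k \<in> {..<n}" for k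
        using that bounded_operator[OF continuous_on_mult[OF cs s[OF _ ij(2)]], of k k]
        by (simp add: summand carrier_O)
    qed (simp_all add: operator_algebra_def)
    also have "\<dots> = ?\<psi> (a i j)"
    proof
      fix h
      have "?\<psi> (a i j) h = (\<Sum>k<n. \<pi> (\<lambda>x. cnj (s k i x) * s k j x) h)"
        unfolding fact[OF ij] by (rule sum) (use cs s ij in \<open>auto intro!: continuous_intros\<close>)
      then show "(\<Sum>k<n. (star ?O (\<pi> (s k i)) \<otimes>\<^bsub>?O\<^esub> \<pi> (s k j)) h) = ?\<psi> (a i j) h"
        by (simp add: summand)
    qed
    finally show "?\<psi> (a i j) = (\<Oplus>\<^bsub>?O\<^esub>k\<in>{..<n}. star ?O (\<pi> (s k i)) \<otimes>\<^bsub>?O\<^esub> \<pi> (s k j))" ..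
  qed
qed

end

lemma partition_of_unity:
  fixes V :: "nat \<Rightarrow> 'x::metric_space set"
  assumes V: "\<And>m. m < N \<Longrightarrow> open (V m)" and cov: "(\<Union>m<N. V m) = UNIV"
  shows "\<exists>p :: nat \<Rightarrow> 'x \<Rightarrow> real. (\<forall>m<N. continuous_on UNIV (p m)) \<and> (\<forall>m<N. \<forall>x. p m x \<ge> 0) \<and>
    (\<forall>x. (\<Sum>m<N. p m x) = 1) \<and> (\<forall>m<N. \<forall>x. x \<notin> V m \<longrightarrow> p m x = 0)"
proof -
  \<comment> \<open>The whole space is treated apart because the distance to the empty set is 0 by
    convention.\<close>
  define d where "d m x = (if V m = UNIV then 1 else infdist x (- V m))" for m x
  have d: "continuous_on UNIV (d m)" for m
    unfolding d_def by (cases "V m = UNIV") (auto intro!: continuous_intros)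
  have d0: "d m x \<ge> 0" for m x by (simp add: d_def infdist_nonneg)
  have dpos: "d m x > 0" if "m < N" "x \<in> V m" for m x
  proof (cases "V m = UNIV")
    case False
    then have "- V m \<noteq> {}" by auto
    then have "infdist x (- V m) \<noteq> 0"
      using V[OF that(1)] that(2) by (subst in_closed_iff_infdist_zero[symmetric]) auto
    then show ?thesis using False infdist_nonneg[of x "- V m"] by (simp add: d_def)
  qed (simp add: d_def)
  have dout: "d m x = 0" if "x \<notin> V m" for m x using that by (auto simp: d_def)
  define S where "S x = (\<Sum>m<N. d m x)" for x
  have S: "S x > 0" for x
  proof -
    obtain m where "m < N" "x \<in> V m" using cov by blast
    then show ?thesis unfolding S_def using dpos d0 by (intro sum_pos2[of _ m]) auto
  qed
  show ?thesis
  proof (intro exI[of _ "\<lambda>m x. d m x / S x"] conjI allI impI)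
    have "continuous_on UNIV S" unfolding S_def by (intro continuous_intros d)
    then show "continuous_on UNIV (\<lambda>x. d m x / S x)" for m
      by (rule continuous_on_divide[OF d]) (use S less_imp_neq in fastforce)
    show "(\<Sum>m<N. d m x / S x) = 1" for x
      using S[of x] by (simp add: sum_divide_distrib[symmetric] S_def[symmetric])
  qed (use d0 S dout in \<open>auto intro: divide_nonneg_pos\<close>)
qed

text \<open>Sampling at one point of each member of the cover and interpolating with a subordinate
  partition of unity replaces \<open>g x\<close> by an average of values that differ from it by no
  more than the oscillation \<open>\<epsilon>\<close>.\<close>

lemma rcp_ranks_le_card_cover:
  fixes \<pi> :: "('x::metric_space \<Rightarrow> complex) \<Rightarrow> 'h::chilbert_space \<Rightarrow> 'h"
  assumes X: "compact (UNIV :: 'x set)" and rep: "faithful_representation continuous_functions \<pi>"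
    and fin: "finite \<V>" and op: "\<And>V. V \<in> \<V> \<Longrightarrow> open V" and cov: "\<Union>\<V> = UNIV"
    and \<Omega>: "\<And>g. g \<in> \<Omega> \<Longrightarrow> continuous_on UNIV g"
    and osc: "\<And>g V x y. g \<in> \<Omega> \<Longrightarrow> V \<in> \<V> \<Longrightarrow> x \<in> V \<Longrightarrow> y \<in> V \<Longrightarrow> cmod (g x - g y) \<le> \<epsilon>"
    and \<epsilon>: "\<epsilon> < \<delta>"
  shows "\<exists>r\<in>rcp_ranks continuous_functions \<pi> \<Omega> \<delta>. r \<le> card \<V>"
proof -
  interpret function_representation \<pi> by (rule function_representation.intro[OF rep])
  \<comment> \<open>Empty members have no point at which to sample.\<close>
  define \<V>' where "\<V>' = \<V> - {{}}"
  define N where "N = card \<V>'"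
  have fin': "finite \<V>'" using fin by (simp add: \<V>'_def)
  have cov': "\<Union>\<V>' = UNIV" using cov by (auto simp: \<V>'_def)
  then have "\<V>' \<noteq> {}" by auto
  then have N: "N \<ge> 1" unfolding N_def using fin' by (simp add: Suc_le_eq card_gt_0_iff)
  obtain V where V: "bij_betw V {..<N} \<V>'"
    using ex_bij_betw_nat_finite[OF fin'] by (auto simp: N_def atLeast0LessThan)
  have VV: "V m \<in> \<V>'" if "m < N" for m using V that by (auto simp: bij_betw_def)
  have "\<exists>x. x \<in> V m" if "m < N" for m using VV[OF that] by (auto simp: \<V>'_def)
  then obtain pt where pt: "\<And>m. m < N \<Longrightarrow> pt m \<in> V m" by metis
  have oV: "open (V m)" if "m < N" for m using VV[OF that] op by (auto simp: \<V>'_def)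
  have cV: "(\<Union>m<N. V m) = UNIV" using V cov' by (auto simp: bij_betw_def)
  have "\<exists>p :: nat \<Rightarrow> 'x \<Rightarrow> real. (\<forall>m<N. continuous_on UNIV (p m)) \<and> (\<forall>m<N. \<forall>x. p m x \<ge> 0) \<and>
    (\<forall>x. (\<Sum>m<N. p m x) = 1) \<and> (\<forall>m<N. \<forall>x. x \<notin> V m \<longrightarrow> p m x = 0)"
    by (rule partition_of_unity[OF _ cV]) (rule oV)
  then obtain p :: "nat \<Rightarrow> 'x \<Rightarrow> real" where "\<forall>m<N. continuous_on UNIV (p m)" "\<forall>m<N. \<forall>x. p m x \<ge> 0"
    "\<forall>x. (\<Sum>m<N. p m x) = 1" "\<forall>m<N. \<forall>x. x \<notin> V m \<longrightarrow> p m x = 0"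
    by (elim exE conjE)
  note p = this[rule_format]
  define \<phi> :: "('x \<Rightarrow> complex) \<Rightarrow> nat \<Rightarrow> complex" where "\<phi> g i = (if i < N then g (pt i) else 0)" for g i
  define \<psi> where "\<psi> c = \<pi> (\<lambda>x. \<Sum>m<N. c m * of_real (p m x))" for c :: "nat \<Rightarrow> complex"
  have approx: "onorm (\<lambda>h. \<psi> (\<phi> g) h - \<pi> g h) < \<delta>" if g: "g \<in> \<Omega>" for g
  proof -
    let ?g = "\<lambda>x. \<Sum>m<N. \<phi> g m * complex_of_real (p m x)"
    have c: "continuous_on UNIV ?g" by (intro continuous_intros p) auto
    have c': "continuous_on UNIV (\<lambda>x. ?g x - g x)" by (intro continuous_on_diff c \<Omega>[OF g])
    have "cmod (?g x - g x) \<le> \<epsilon>" for x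
    proof -
      have "g x = (\<Sum>m<N. g x * complex_of_real (p m x))"
        by (simp add: sum_distrib_left[symmetric] p(3) flip: of_real_sum)
      then have "?g x - g x = (\<Sum>m<N. (g (pt m) - g x) * complex_of_real (p m x))"
        by (simp add: \<phi>_def left_diff_distrib sum_subtractf)
      also have "cmod \<dots> \<le> (\<Sum>m<N. cmod ((g (pt m) - g x) * complex_of_real (p m x)))" by (rule norm_sum)
      also have "\<dots> \<le> (\<Sum>m<N. \<epsilon> * p m x)"
      proof (rule sum_mono)
        fix m assume "m \<in> {..<N}"
        then have m: "m < N" by simp
        show "cmod ((g (pt m) - g x) * complex_of_real (p m x)) \<le> \<epsilon> * p m x"
        proof (cases "x \<in> V m")
          case True
          have "cmod (g (pt m) - g x) \<le> \<epsilon>"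
            using VV[OF m] by (intro osc[OF g _ pt[OF m] True]) (simp add: \<V>'_def)
          then show ?thesis using p(2)[OF m, of x] by (simp add: norm_mult mult_right_mono)
        qed (use p(4)[OF m] in simp)
      qed
      also have "\<dots> = \<epsilon>" by (simp add: sum_distrib_left[symmetric] p(3))
      finally show ?thesis .
    qed
    from onorm_le[OF c' this] have "onorm (\<pi> (\<lambda>x. ?g x - g x)) \<le> \<epsilon>" .
    moreover have "(\<lambda>h. \<psi> (\<phi> g) h - \<pi> g h) = \<pi> (\<lambda>x. ?g x - g x)"
      using diff[OF c \<Omega>[OF g]] by (simp add: \<psi>_def fun_eq_iff)
    ultimately show ?thesis using \<epsilon> by simp
  qed
  have "N \<in> rcp_ranks continuous_functions \<pi> \<Omega> \<delta>"
    unfolding rcp_ranks_def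
  proof (intro CollectI exI[of _ "diagonal_algebra N"] exI[of _ \<phi>] exI[of _ \<psi>] conjI ballI)
    show "cstar_algebra (diagonal_algebra N)" by (rule cstar_algebra_diagonal[OF N])
    show "finite_dimensional (diagonal_algebra N)"
      unfolding finite_dimensional_def using has_dimension_diagonal by blast
    show "\<one>\<^bsub>diagonal_algebra N\<^esub> \<noteq> \<zero>\<^bsub>diagonal_algebra N\<^esub>" using N by (auto simp: fun_eq_iff intro!: exI[of _ 0])
    show "contractive_cp continuous_functions (diagonal_algebra N) \<phi>"
      unfolding \<phi>_def by (rule contractive_cp_evaluation[OF X N])
    show "contractive_cp (diagonal_algebra N) operator_algebra \<psi>"
      unfolding \<psi>_def by (rule contractive_cp_partition_of_unity[OF N p(1-3)])
  qed (use approx has_rank_diagonal in auto)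
  moreover have "N \<le> card \<V>" unfolding N_def \<V>'_def using fin by (intro card_mono) auto
  ultimately show ?thesis by blast
qed


section \<open>Minimal projections of a finite-dimensional C*-algebra\<close>

text \<open>One step of Gaussian elimination: a pivot \<open>M j k\<close> removes the equation
  \<open>k\<close> together with the unknown \<open>j\<close>.\<close>

lemma underdetermined_system:
  fixes M :: "'i \<Rightarrow> 'k \<Rightarrow> 'a::field"
  assumes "finite K" "finite I" "card K < card I"
  shows "\<exists>c. (\<exists>i\<in>I. c i \<noteq> 0) \<and> (\<forall>k\<in>K. (\<Sum>i\<in>I. c i * M i k) = 0)"
  using assms
proof (induction K arbitrary: I M)
  case empty
  then have "I \<noteq> {}" by auto
  then show ?case by (intro exI[of _ "\<lambda>_. 1"]) auto
next
  case (insert k K)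
  show ?case
  proof (cases "\<forall>i\<in>I. M i k = 0")
    case True
    have "card K < card I" using insert by simp
    from insert.IH[OF \<open>finite I\<close> this, of M] obtain c where
      "\<exists>i\<in>I. c i \<noteq> 0" "\<forall>l\<in>K. (\<Sum>i\<in>I. c i * M i l) = 0" by blast
    then show ?thesis using True by (intro exI[of _ c]) auto
  next
    case False
    then obtain j where j: "j \<in> I" "M j k \<noteq> 0" by blast
    define J where "J = I - {j}"
    have J: "finite J" "card K < card J" "j \<notin> J" "I = insert j J"
      using insert.prems insert.hyps j by (auto simp: J_def)
    from insert.IH[OF J(1,2), of "\<lambda>i l. M i l - M i k / M j k * M j l"] obtain c where
      c: "\<exists>i\<in>J. c i \<noteq> 0" "\<forall>l\<in>K. (\<Sum>i\<in>J. c i * (M i l - M i k / M j k * M j l)) = 0" by blast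
    define c' where "c' = c(j := - (\<Sum>i\<in>J. c i * M i k) / M j k)"
    have split: "(\<Sum>i\<in>I. c' i * M i l) = (\<Sum>i\<in>J. c i * M i l) - (\<Sum>i\<in>J. c i * M i k) / M j k * M j l" for l
    proof -
      have "(\<Sum>i\<in>J. c' i * M i l) = (\<Sum>i\<in>J. c i * M i l)"
        using J by (intro sum.cong) (auto simp: c'_def)
      then show ?thesis using J by (simp add: c'_def)
    qed
    have "(\<Sum>i\<in>I. c' i * M i l) = 0" if "l \<in> insert k K" for l
    proof (cases "l = k")
      case True then show ?thesis using split[of k] j by simp
    next
      case False
      then have "(\<Sum>i\<in>J. c i * (M i l - M i k / M j k * M j l)) = 0" using c that by blast
      then show ?thesis unfolding split
        by (simp add: right_diff_distrib sum_subtractf sum_divide_distrib sum_distrib_right mult.assoc)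
    qed
    moreover have "\<exists>i\<in>I. c' i \<noteq> 0" using c(1) J by (auto simp: c'_def)
    ultimately show ?thesis by blast
  qed
qed

section \<open>Arithmetic in a unital C*-algebra with plain complex scalars\<close>

locale unital_cstar = ring A for A :: "'a cstar" (structure) +
  assumes cstar: "cstar_algebra A"
begin

lemma carrier_complex_ring: "carrier complex_ring = UNIV"
  by (simp add: complex_ring_def)

lemma module_complex: "module complex_ring A"
  using cstar by (rule cstar_algebra.axioms(2))

lemma scale_closed [simp, intro]: "x \<in> carrier A \<Longrightarrow> c \<odot> x \<in> carrier A"
  using module.smult_closed[OF module_complex] by (simp add: carrier_complex_ring)

lemma scale_add_left: "x \<in> carrier A \<Longrightarrow> (c + d) \<odot> x = c \<odot> x \<oplus> d \<odot> x"
  using module.smult_l_distr[OF module_complex, of c d x] by (simp add: complex_ring_def)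

lemma scale_add_right: "x \<in> carrier A \<Longrightarrow> y \<in> carrier A \<Longrightarrow> c \<odot> (x \<oplus> y) = c \<odot> x \<oplus> c \<odot> y"
  using module.smult_r_distr[OF module_complex, of c x y] by (simp add: complex_ring_def)

lemma scale_scale: "x \<in> carrier A \<Longrightarrow> c \<odot> (d \<odot> x) = (c * d) \<odot> x"
  using module.smult_assoc1[OF module_complex, of c d x] by (simp add: complex_ring_def)

lemma scale_one [simp]: "x \<in> carrier A \<Longrightarrow> 1 \<odot> x = x"
  using module.smult_one[OF module_complex, of x] by (simp add: complex_ring_def)

lemma scale_zero_left [simp]: "x \<in> carrier A \<Longrightarrow> 0 \<odot> x = \<zero>"
  using module.smult_l_null[OF module_complex, of x] by (simp add: complex_ring_def)

lemma scale_zero_right [simp]: "c \<odot> \<zero> = \<zero>"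
  using module.smult_r_null[OF module_complex, of c] by (simp add: complex_ring_def)

lemma scale_minus_one: "x \<in> carrier A \<Longrightarrow> (- 1) \<odot> x = \<ominus> x"
  using scale_add_left[of x "- 1" 1] by (intro minus_equality[symmetric]) auto

lemma scale_eq_zero:
  assumes "x \<in> carrier A" "c \<odot> x = \<zero>" "c \<noteq> 0"
  shows "x = \<zero>"
proof -
  have "inverse c \<odot> (c \<odot> x) = x" unfolding scale_scale[OF assms(1)] using assms by simp
  then show ?thesis unfolding assms(2) by simp
qed

lemma minus_eq_zero_iff: "x \<in> carrier A \<Longrightarrow> y \<in> carrier A \<Longrightarrow> x \<ominus> y = \<zero> \<longleftrightarrow> x = y"
  by (metis a_minus_def minus_equality minus_minus r_neg a_inv_closed)

lemma mult_scale_left: "x \<in> carrier A \<Longrightarrow> y \<in> carrier A \<Longrightarrow> (c \<odot> x) \<otimes> y = c \<odot> (x \<otimes> y)"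
  using cstar_algebra.smult_mult_left[OF cstar] .

lemma mult_scale_right: "x \<in> carrier A \<Longrightarrow> y \<in> carrier A \<Longrightarrow> x \<otimes> (c \<odot> y) = c \<odot> (x \<otimes> y)"
  using cstar_algebra.smult_mult_right[OF cstar] .

lemma star_closed [simp, intro]: "x \<in> carrier A \<Longrightarrow> star A x \<in> carrier A"
  using cstar_algebra.star_closed[OF cstar] .

lemma star_star [simp]: "x \<in> carrier A \<Longrightarrow> star A (star A x) = x"
  using cstar_algebra.star_star[OF cstar] .

lemma star_add: "x \<in> carrier A \<Longrightarrow> y \<in> carrier A \<Longrightarrow> star A (x \<oplus> y) = star A x \<oplus> star A y"
  using cstar_algebra.star_add[OF cstar] .

lemma star_scale: "x \<in> carrier A \<Longrightarrow> star A (c \<odot> x) = cnj c \<odot> star A x"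
  using cstar_algebra.star_smult[OF cstar] .

lemma star_mult: "x \<in> carrier A \<Longrightarrow> y \<in> carrier A \<Longrightarrow> star A (x \<otimes> y) = star A y \<otimes> star A x"
  using cstar_algebra.star_mult[OF cstar] .

lemma star_minus: "x \<in> carrier A \<Longrightarrow> y \<in> carrier A \<Longrightarrow> star A (x \<ominus> y) = star A x \<ominus> star A y"
  unfolding a_minus_def by (simp add: star_add star_scale flip: scale_minus_one)

lemma star_one [simp]: "star A \<one> = \<one>"
  by (metis l_one one_closed r_one star_closed star_mult star_star)

lemma norm_nonneg: "x \<in> carrier A \<Longrightarrow> cnorm A x \<ge> 0"
  using cstar_algebra.cnorm_nonneg[OF cstar] .

lemma norm_eq_0: "x \<in> carrier A \<Longrightarrow> cnorm A x = 0 \<longleftrightarrow> x = \<zero>"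
  using cstar_algebra.cnorm_eq_0_iff[OF cstar] .

lemma norm_zero [simp]: "cnorm A \<zero> = 0"
  by (simp add: norm_eq_0)

lemma norm_triangle: "x \<in> carrier A \<Longrightarrow> y \<in> carrier A \<Longrightarrow> cnorm A (x \<oplus> y) \<le> cnorm A x + cnorm A y"
  using cstar_algebra.cnorm_triangle[OF cstar] .

lemma norm_scale: "x \<in> carrier A \<Longrightarrow> cnorm A (c \<odot> x) = cmod c * cnorm A x"
  using cstar_algebra.cnorm_smult[OF cstar] .

lemma norm_minus_le: "x \<in> carrier A \<Longrightarrow> y \<in> carrier A \<Longrightarrow> cnorm A (x \<ominus> y) \<le> cnorm A x + cnorm A y"
  using norm_triangle[of x "\<ominus> y"] norm_scale[of y "- 1"] by (simp add: a_minus_def scale_minus_one)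

lemma norm_mult: "x \<in> carrier A \<Longrightarrow> y \<in> carrier A \<Longrightarrow> cnorm A (x \<otimes> y) \<le> cnorm A x * cnorm A y"
  using cstar_algebra.cnorm_mult[OF cstar] .

lemma norm_star_mult: "x \<in> carrier A \<Longrightarrow> cnorm A (star A x \<otimes> x) = (cnorm A x)\<^sup>2"
  using cstar_algebra.cstar_identity[OF cstar] .

lemma star_mult_eq_zero:
  assumes "x \<in> carrier A" "star A x \<otimes> x = \<zero>"
  shows "x = \<zero>"
  using norm_star_mult[OF assms(1)] assms norm_eq_0[OF assms(1)] by simp

lemma norm_star: "x \<in> carrier A \<Longrightarrow> cnorm A (star A x) = cnorm A x"
proof -
  have le: "cnorm A x \<le> cnorm A (star A x)" if x: "x \<in> carrier A" for x
  proof (cases "cnorm A x = 0")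
    case True then show ?thesis using norm_nonneg[of "star A x"] x by simp
  next
    case False
    have "(cnorm A x)\<^sup>2 \<le> cnorm A (star A x) * cnorm A x"
      using norm_mult[of "star A x" x] norm_star_mult[OF x] x by simp
    then show ?thesis using False norm_nonneg[OF x] by (simp add: power2_eq_square)
  qed
  assume "x \<in> carrier A"
  then show ?thesis using le[of x] le[of "star A x"] by simp
qed

section \<open>Commutants and maximal abelian subalgebras\<close>

definition commutant :: "'a set \<Rightarrow> 'a set" where
  "commutant Q = {x \<in> carrier A. \<forall>y\<in>Q. x \<otimes> y = y \<otimes> x}"

lemma commutant_subalgebra:
  assumes Q: "Q \<subseteq> carrier A" "\<And>y. y \<in> Q \<Longrightarrow> star A y \<in> Q"
  shows "cstar_subalgebra A (commutant Q)"
  unfolding cstar_subalgebra_def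
proof (intro conjI ballI allI impI)
  have QA: "y \<in> carrier A" if "y \<in> Q" for y using Q that by blast
  show "commutant Q \<subseteq> carrier A" by (auto simp: commutant_def)
  show "\<zero> \<in> commutant Q" using QA by (simp add: commutant_def)
  fix x assume "x \<in> commutant Q"
  then have x: "x \<in> carrier A" "\<And>y. y \<in> Q \<Longrightarrow> x \<otimes> y = y \<otimes> x" by (auto simp: commutant_def)
  show "c \<odot> x \<in> commutant Q" for c
    using x QA by (simp add: commutant_def mult_scale_left mult_scale_right)
  show "star A x \<in> commutant Q"
  proof -
    have "star A x \<otimes> y = y \<otimes> star A x" if y: "y \<in> Q" for y
    proof -
      have "star A (x \<otimes> star A y) = star A (star A y \<otimes> x)" using x Q(2)[OF y] by simp
      then show ?thesis using x QA[OF y] by (simp add: star_mult)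
    qed
    then show ?thesis using x by (simp add: commutant_def)
  qed
  fix x' assume "x' \<in> commutant Q"
  then have x': "x' \<in> carrier A" "\<And>y. y \<in> Q \<Longrightarrow> x' \<otimes> y = y \<otimes> x'" by (auto simp: commutant_def)
  show "x \<oplus> x' \<in> commutant Q" using x x' QA by (simp add: commutant_def l_distr r_distr)
  have "x \<otimes> x' \<otimes> y = y \<otimes> (x \<otimes> x')" if y: "y \<in> Q" for y
    using x x' QA[OF y] y by (metis m_assoc)
  then show "x \<otimes> x' \<in> commutant Q" using x x' by (simp add: commutant_def)
next
  fix s x assume s: "range s \<subseteq> commutant Q \<and> x \<in> carrier A \<and> (\<lambda>n. cnorm A (s n \<ominus> x)) \<longlonglongrightarrow> 0"
  then have x: "x \<in> carrier A" and sA: "\<And>n. s n \<in> carrier A"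
    and sc: "\<And>n y. y \<in> Q \<Longrightarrow> s n \<otimes> y = y \<otimes> s n" by (auto simp: commutant_def)
  have "x \<otimes> y = y \<otimes> x" if y: "y \<in> Q" for y
  proof -
    have yA: "y \<in> carrier A" using Q y by blast
    have le: "cnorm A (x \<otimes> y \<ominus> y \<otimes> x) \<le> 2 * cnorm A y * cnorm A (s n \<ominus> x)" for n
    proof -
      let ?t = "s n \<ominus> x"
      have t: "?t \<in> carrier A" using sA x by simp
      \<comment> \<open>Since \<open>s n\<close> commutes with \<open>y\<close>, the commutator of
        \<open>y\<close> with the error \<open>s n - x\<close> is that of \<open>x\<close> with
        \<open>y\<close>, whatever \<open>n\<close> is; its norm is therefore as small as the
        error.\<close>
      have "y \<otimes> ?t \<ominus> ?t \<otimes> y = x \<otimes> y \<ominus> y \<otimes> x"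
      proof -
        have "y \<otimes> ?t \<ominus> ?t \<otimes> y = (y \<otimes> s n \<ominus> y \<otimes> x) \<ominus> (s n \<otimes> y \<ominus> x \<otimes> y)"
          using sA[of n] x yA by (simp add: a_minus_def l_distr r_distr l_minus r_minus)
        also have "\<dots> = (y \<otimes> s n \<ominus> y \<otimes> x) \<ominus> (y \<otimes> s n \<ominus> x \<otimes> y)" using sc[OF y] by simp
        also have "\<dots> = x \<otimes> y \<ominus> y \<otimes> x" using sA[of n] x yA by algebra
        finally show ?thesis .
      qed
      then have "cnorm A (x \<otimes> y \<ominus> y \<otimes> x) \<le> cnorm A (y \<otimes> ?t) + cnorm A (?t \<otimes> y)"
        using norm_minus_le[of "y \<otimes> ?t" "?t \<otimes> y"] t yA by simp
      also have "\<dots> \<le> cnorm A y * cnorm A ?t + cnorm A ?t * cnorm A y"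
        by (intro add_mono norm_mult t yA)
      finally show ?thesis by simp
    qed
    have "(\<lambda>n. 2 * cnorm A y * cnorm A (s n \<ominus> x)) \<longlonglongrightarrow> 2 * cnorm A y * 0"
      using s by (intro tendsto_mult tendsto_const) auto
    then have "cnorm A (x \<otimes> y \<ominus> y \<otimes> x) \<le> 2 * cnorm A y * 0"
      by (rule LIMSEQ_le_const) (use le in blast)
    then have "cnorm A (x \<otimes> y \<ominus> y \<otimes> x) = 0"
      using norm_nonneg[of "x \<otimes> y \<ominus> y \<otimes> x"] x yA by simp
    then have "x \<otimes> y \<ominus> y \<otimes> x = \<zero>" using norm_eq_0 x yA by simp
    then show ?thesis using x yA by (simp add: minus_eq_zero_iff)
  qed
  then show "x \<in> commutant Q" using x by (simp add: commutant_def)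
qed

text \<open>The double commutant of a commuting star-closed set is again commutative, so a maximal abelian
  subalgebra absorbs self-adjoint elements of its commutant.\<close>

lemma maximal_abelian_absorbs:
  assumes D: "maximal_abelian_cstar_subalgebra A D"
    and x: "x \<in> carrier A" "star A x = x" "\<And>d. d \<in> D \<Longrightarrow> x \<otimes> d = d \<otimes> x"
  shows "x \<in> D"
proof -
  have abD: "abelian_cstar_subalgebra A D" using D by (simp add: maximal_abelian_cstar_subalgebra_def)
  define Q where "Q = insert x D"
  have DA: "D \<subseteq> carrier A" "\<And>d. d \<in> D \<Longrightarrow> star A d \<in> D" "\<And>d d'. d \<in> D \<Longrightarrow> d' \<in> D \<Longrightarrow> d \<otimes> d' = d' \<otimes> d"
    using abD by (auto simp: abelian_cstar_subalgebra_def cstar_subalgebra_def)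
  have Q: "Q \<subseteq> carrier A" "\<And>y. y \<in> Q \<Longrightarrow> star A y \<in> Q" "\<And>y z. y \<in> Q \<Longrightarrow> z \<in> Q \<Longrightarrow> y \<otimes> z = z \<otimes> y"
    using DA x by (auto simp: Q_def)
  have C: "commutant Q \<subseteq> carrier A" "\<And>y. y \<in> commutant Q \<Longrightarrow> star A y \<in> commutant Q"
    using commutant_subalgebra[OF Q(1,2)] by (auto simp: cstar_subalgebra_def)
  have QC: "Q \<subseteq> commutant Q" using Q by (auto simp: commutant_def)
  have QCC: "Q \<subseteq> commutant (commutant Q)" using Q(1) by (auto simp: commutant_def)
  have "commutant (commutant Q) \<subseteq> commutant Q" using QC by (auto simp: commutant_def)
  then have "abelian_cstar_subalgebra A (commutant (commutant Q))"
    using commutant_subalgebra[OF C] unfolding abelian_cstar_subalgebra_def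
    by (auto simp: commutant_def)
  moreover have "D \<subseteq> commutant (commutant Q)" using QCC by (auto simp: Q_def)
  ultimately have "commutant (commutant Q) = D"
    using D unfolding maximal_abelian_cstar_subalgebra_def by blast
  then show ?thesis using QCC by (auto simp: Q_def)
qed


section \<open>Polynomials in an element and eigenvectors\<close>

definition poly_eval :: "'a \<Rightarrow> complex poly \<Rightarrow> 'a" where
  "poly_eval d q = fold_coeffs (\<lambda>a x. a \<odot> \<one> \<oplus> d \<otimes> x) q \<zero>"

lemma poly_eval_0 [simp]: "poly_eval d 0 = \<zero>"
  by (simp add: poly_eval_def)

lemma poly_eval_pCons:
  assumes d: "d \<in> carrier A"
  shows "poly_eval d (pCons a q) = a \<odot> \<one> \<oplus> d \<otimes> poly_eval d q"
proof (cases "a = 0 \<and> q = 0")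
  case False
  then show ?thesis by (auto simp: poly_eval_def fold_coeffs_pCons_eq)
qed (use d in auto)

lemma poly_eval_closed [simp, intro]: "d \<in> carrier A \<Longrightarrow> poly_eval d q \<in> carrier A"
  by (induction q) (auto simp: poly_eval_pCons)

lemma poly_eval_add:
  assumes d: "d \<in> carrier A"
  shows "poly_eval d (p + q) = poly_eval d p \<oplus> poly_eval d q"
proof (induction p q rule: poly_induct2)
  case (pCons a p b q)
  then show ?case using d by (simp add: poly_eval_pCons scale_add_left r_distr a_ac)
qed simp

lemma poly_eval_smult:
  assumes d: "d \<in> carrier A"
  shows "poly_eval d (Polynomial.smult c q) = c \<odot> poly_eval d q"
proof (induction q)
  case (pCons a q)
  then show ?case using d by (simp add: poly_eval_pCons scale_add_right scale_scale mult_scale_right)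
qed simp

lemma poly_eval_linear_factor:
  assumes d: "d \<in> carrier A"
  shows "poly_eval d ([:- l, 1:] * q) = d \<otimes> poly_eval d q \<oplus> (- l) \<odot> poly_eval d q"
proof -
  have "[:- l, 1:] * q = Polynomial.smult (- l) q + pCons 0 q" by simp
  then show ?thesis
    unfolding \<open>[:- l, 1:] * q = _\<close> poly_eval_add[OF d] poly_eval_smult[OF d] poly_eval_pCons[OF d]
    using d by (simp add: a_comm)
qed

lemma poly_eval_eigenvector:
  assumes d: "d \<in> carrier A" and g: "g \<in> carrier A" "d \<otimes> g = l \<odot> g"
  shows "poly_eval d q \<otimes> g = poly q l \<odot> g"
proof (induction q)
  case (pCons a q)
  have "d \<otimes> poly_eval d q \<otimes> g = d \<otimes> (poly q l \<odot> g)" using d g pCons by (simp add: m_assoc)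
  also have "\<dots> = (l * poly q l) \<odot> g" using d g by (simp add: mult_scale_right scale_scale mult.commute)
  finally show ?case using d g by (simp add: poly_eval_pCons l_distr mult_scale_left scale_add_left)
qed (use g in simp)

lemma poly_eval_in_subalgebra:
  assumes D: "cstar_subalgebra A D" "\<one> \<in> D" and d: "d \<in> D"
  shows "poly_eval d q \<in> D"
proof (induction q)
  case 0
  show ?case using D by (simp add: cstar_subalgebra_def)
next
  case (pCons a q)
  have "d \<in> carrier A" using D d by (auto simp: cstar_subalgebra_def)
  then show ?case using D d pCons unfolding cstar_subalgebra_def by (simp add: poly_eval_pCons)
qed

text \<open>The annihilating polynomial splits into linear factors; the first partial product that
  annihilates \<open>w\<close> yields an eigenvector.\<close>

lemma poly_eval_root_exists:
  assumes d: "d \<in> carrier A" and w: "w \<in> carrier A" "w \<noteq> \<zero>"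
    and q: "q \<noteq> 0" "poly_eval d q \<otimes> w = \<zero>"
  shows "\<exists>q' l. poly_eval d q' \<otimes> w \<noteq> \<zero> \<and> d \<otimes> (poly_eval d q' \<otimes> w) = l \<odot> (poly_eval d q' \<otimes> w)"
  using q
proof (induction "degree q" arbitrary: q rule: less_induct)
  case less
  show ?case
  proof (cases "degree q = 0")
    case True
    then obtain a where a: "q = [:a:]" by (rule degree_eq_zeroE)
    then have "a \<odot> w = \<zero>" using less.prems d w by (simp add: poly_eval_pCons mult_scale_left)
    then show ?thesis using scale_eq_zero[of w a] w a less.prems by auto
  next
    case False
    then have "\<not> constant (poly q)" by (simp add: constant_degree)
    then obtain l where "poly q l = 0" using fundamental_theorem_of_algebra by blast
    then obtain q1 where q1: "q = [:- l, 1:] * q1" by (auto simp: poly_eq_0_iff_dvd)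
    then have q1': "q1 \<noteq> 0" using less.prems by auto
    then have deg: "degree q1 < degree q" unfolding q1 by (subst degree_mult_eq) auto
    show ?thesis
    proof (cases "poly_eval d q1 \<otimes> w = \<zero>")
      case True
      then show ?thesis using less.hyps[OF deg q1'] by blast
    next
      case False
      let ?e = "poly_eval d q1 \<otimes> w"
      have e: "?e \<in> carrier A" using d w by simp
      have "\<zero> = (d \<otimes> poly_eval d q1 \<oplus> (- l) \<odot> poly_eval d q1) \<otimes> w"
        using less.prems(2) unfolding q1 poly_eval_linear_factor[OF d] by simp
      also have "\<dots> = d \<otimes> ?e \<oplus> (- l) \<odot> ?e"
        using d w by (simp add: l_distr m_assoc mult_scale_left)
      finally have "d \<otimes> ?e \<oplus> (- l) \<odot> ?e = \<zero>" ..
      moreover have "(- l) \<odot> ?e = \<ominus> (l \<odot> ?e)"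
        using e scale_scale[of ?e "-1" l] scale_minus_one[of "l \<odot> ?e"] by simp
      ultimately have "d \<otimes> ?e \<ominus> l \<odot> ?e = \<zero>" by (simp add: a_minus_def)
      then have "d \<otimes> ?e = l \<odot> ?e"
        using minus_eq_zero_iff[OF m_closed[OF d e] scale_closed[OF e, of l]] by blast
      then show ?thesis using False by blast
    qed
  qed
qed

lemma linear_combination_swap:
  assumes "finite I" and b: "\<And>k. k < r \<Longrightarrow> b k \<in> carrier A"
  shows "(\<Oplus>i\<in>I. c i \<odot> (\<Oplus>k\<in>{..<r}. M i k \<odot> b k)) = (\<Oplus>k\<in>{..<r::nat}. (\<Sum>i\<in>I. c i * M i k) \<odot> b k)"
  using assms(1)
proof (induction I)
  case empty
  have "(\<Oplus>k\<in>{..<r}. 0 \<odot> b k) = (\<Oplus>k\<in>{..<r}. \<zero>)"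
    by (rule finsum_cong) (use b in auto)
  then show ?case by simp
next
  case (insert i I)
  have inner: "(\<Oplus>k\<in>{..<r}. M i k \<odot> b k) \<in> carrier A" for i
    by (rule finsum_closed) (use b in auto)
  have "(\<Oplus>i\<in>insert i I. c i \<odot> (\<Oplus>k\<in>{..<r}. M i k \<odot> b k))
      = c i \<odot> (\<Oplus>k\<in>{..<r}. M i k \<odot> b k) \<oplus> (\<Oplus>k\<in>{..<r}. (\<Sum>i\<in>I. c i * M i k) \<odot> b k)"
    using insert inner by (subst finsum_insert) auto
  also have "c i \<odot> (\<Oplus>k\<in>{..<r}. M i k \<odot> b k) = (\<Oplus>k\<in>{..<r}. c i \<odot> (M i k \<odot> b k))"
    by (rule module.finsum_smult_ldistr[OF module_complex]) (use b in \<open>auto simp: carrier_complex_ring\<close>)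
  also have "\<dots> \<oplus> (\<Oplus>k\<in>{..<r}. (\<Sum>i\<in>I. c i * M i k) \<odot> b k)
      = (\<Oplus>k\<in>{..<r}. c i \<odot> (M i k \<odot> b k) \<oplus> (\<Sum>i\<in>I. c i * M i k) \<odot> b k)"
    by (rule finsum_addf[symmetric]) (use b in auto)
  also have "\<dots> = (\<Oplus>k\<in>{..<r}. (\<Sum>i\<in>insert i I. c i * M i k) \<odot> b k)"
    by (rule finsum_cong) (use b insert in \<open>auto simp: scale_add_left scale_scale simp_implies_def\<close>)
  finally show ?case .
qed

lemma dependent_if_card_gt_dimension:
  assumes dim: "has_dimension A D r" and D: "D \<subseteq> carrier A"
    and I: "finite I" "r < card I" and x: "\<And>i. i \<in> I \<Longrightarrow> x i \<in> D"
  shows "\<exists>c. (\<exists>i\<in>I. c i \<noteq> 0) \<and> (\<Oplus>i\<in>I. c i \<odot> x i) = \<zero>"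
proof -
  obtain b where b: "\<forall>i<r. b i \<in> D"
    and ex1: "\<forall>x\<in>D. \<exists>!c. (\<forall>i\<ge>r. c i = 0) \<and> x = (\<Oplus>i\<in>{..<r}. c i \<odot> b i)"
    using dim unfolding has_dimension_def by (elim exE conjE)
  have ex: "\<exists>c. x = (\<Oplus>i\<in>{..<r}. c i \<odot> b i)" if "x \<in> D" for x
    using ex1_implies_ex[OF ex1[rule_format, OF that]] by (elim exE conjE) (rule exI)
  have bA: "b k \<in> carrier A" if "k < r" for k using b D that by blast
  have "\<forall>i\<in>I. \<exists>c. x i = (\<Oplus>k\<in>{..<r}. c k \<odot> b k)" using ex x by blast
  then obtain M where M: "\<And>i. i \<in> I \<Longrightarrow> x i = (\<Oplus>k\<in>{..<r}. M i k \<odot> b k)" by metis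
  obtain c where c: "\<exists>i\<in>I. c i \<noteq> 0" "\<forall>k\<in>{..<r}. (\<Sum>i\<in>I. c i * M i k) = 0"
    using underdetermined_system[of "{..<r}" I M] I by auto
  have "(\<Oplus>i\<in>I. c i \<odot> x i) = (\<Oplus>i\<in>I. c i \<odot> (\<Oplus>k\<in>{..<r}. M i k \<odot> b k))"
    by (rule finsum_cong) (use M x D bA in \<open>auto simp: simp_implies_def intro!: scale_closed finsum_closed\<close>)
  also have "\<dots> = (\<Oplus>k\<in>{..<r}. (\<Sum>i\<in>I. c i * M i k) \<odot> b k)"
    by (rule linear_combination_swap[OF I(1) bA])
  also have "\<dots> = (\<Oplus>k\<in>{..<r}. \<zero>)"
    by (rule finsum_cong) (use c bA in \<open>auto simp: simp_implies_def\<close>)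
  finally show ?thesis using c(1) by auto
qed

text \<open>The powers of \<open>d\<close> with exponents \<open>0, ..., r\<close> are one more than
  the dimension. Writing them as values of monomials turns a linear dependence directly into a
  polynomial.\<close>

lemma annihilating_polynomial:
  assumes dim: "has_dimension A D r" and D: "cstar_subalgebra A D" "\<one> \<in> D" and d: "d \<in> D"
  obtains q where "q \<noteq> 0" "poly_eval d q = \<zero>"
proof -
  have DA: "D \<subseteq> carrier A" using D by (simp add: cstar_subalgebra_def)
  then have dA: "d \<in> carrier A" using d by blast
  obtain c where c: "\<exists>i\<in>{..r}. c i \<noteq> 0" "(\<Oplus>i\<in>{..r}. c i \<odot> poly_eval d (monom 1 i)) = \<zero>"
    using dependent_if_card_gt_dimension[OF dim DA, of "{..r}" "\<lambda>i. poly_eval d (monom 1 i)"]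
      poly_eval_in_subalgebra[OF D d] by auto
  define q where "q = (\<Sum>i\<le>r. Polynomial.smult (c i) (monom 1 i))"
  have "poly_eval d (\<Sum>i\<in>I. Polynomial.smult (c i) (monom 1 i)) = (\<Oplus>i\<in>I. c i \<odot> poly_eval d (monom 1 i))"
    if "finite I" for I :: "nat set"
    using that
    by (induction I) (use dA in \<open>auto simp: poly_eval_add poly_eval_smult\<close>)
  then have "poly_eval d q = \<zero>" using c by (simp add: q_def)
  moreover have "q \<noteq> 0"
  proof -
    obtain i where i: "i \<le> r" "c i \<noteq> 0" using c(1) by auto
    have "coeff q i = (\<Sum>j\<le>r. if j = i then c j else 0)"
      unfolding q_def coeff_sum by (intro sum.cong) auto
    then show ?thesis using i by auto
  qed
  ultimately show ?thesis by (rule that[rotated])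
qed


section \<open>Orthogonal resolutions of the unit\<close>

text \<open>Zero is excluded, so that every projection has norm 1 and orthogonal projections are
  linearly independent.\<close>

definition projection :: "'a \<Rightarrow> bool" where
  "projection p \<longleftrightarrow> p \<in> carrier A \<and> p \<noteq> \<zero> \<and> star A p = p \<and> p \<otimes> p = p"

lemma projectionD:
  assumes "projection p"
  shows "p \<in> carrier A" "p \<noteq> \<zero>" "star A p = p" "p \<otimes> p = p"
  using assms by (auto simp: projection_def)

lemma norm_projection: "projection p \<Longrightarrow> cnorm A p = 1"
proof -
  assume p: "projection p"
  have "(cnorm A p)\<^sup>2 = cnorm A p" using norm_star_mult[of p] projectionD[OF p] by simp
  then show ?thesis using projectionD[OF p] norm_eq_0[of p] by (simp add: power2_eq_square)
qed

text \<open>If \<open>e\<close> is an eigenvector of \<open>d\<close> of the form \<open>q(d) p\<close>, then \<open>star e \<otimes> e\<close> is a multiple of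
  a projection below \<open>p\<close>.\<close>

lemma scalar_or_smaller_projection:
  assumes D: "abelian_cstar_subalgebra A D" "\<one> \<in> D" and dim: "has_dimension A D r"
    and p: "projection p" "p \<in> D" and d: "d \<in> D" "d \<otimes> p = d"
  shows "(\<exists>l. d = l \<odot> p) \<or> (\<exists>h\<in>D. projection h \<and> h \<noteq> p \<and> h \<otimes> p = h)"
proof -
  have sub: "cstar_subalgebra A D" and comm: "\<And>x y. x \<in> D \<Longrightarrow> y \<in> D \<Longrightarrow> x \<otimes> y = y \<otimes> x"
    using D by (auto simp: abelian_cstar_subalgebra_def)
  have clos: "x \<otimes> y \<in> D" "star A x \<in> D" "c \<odot> x \<in> D" if "x \<in> D" "y \<in> D" for x y c
    using sub that by (auto simp: cstar_subalgebra_def)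
  have DA: "x \<in> carrier A" if "x \<in> D" for x using sub that by (auto simp: cstar_subalgebra_def)
  note pp = projectionD[OF p(1)]
  have dA: "d \<in> carrier A" by (rule DA[OF d(1)])
  obtain q where q: "q \<noteq> 0" "poly_eval d q = \<zero>"
    by (rule annihilating_polynomial[OF dim sub D(2) d(1)])
  have "poly_eval d q \<otimes> p = \<zero>" using q pp by simp
  from poly_eval_root_exists[OF dA pp(1,2) q(1) this] obtain q' l where
    e: "poly_eval d q' \<otimes> p \<noteq> \<zero>" "d \<otimes> (poly_eval d q' \<otimes> p) = l \<odot> (poly_eval d q' \<otimes> p)" by blast
  define u where "u = poly_eval d q'"
  define e where "e = u \<otimes> p"
  define g where "g = star A e \<otimes> e"
  have uD: "u \<in> D" unfolding u_def by (rule poly_eval_in_subalgebra[OF sub D(2) d(1)])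
  have eD: "e \<in> D" unfolding e_def using clos uD p by blast
  have gD: "g \<in> D" unfolding g_def using clos eD by blast
  have A: "u \<in> carrier A" "e \<in> carrier A" "g \<in> carrier A" "star A e \<in> carrier A"
    using DA uD eD gD star_closed by simp_all
  have e0: "e \<noteq> \<zero>" "d \<otimes> e = l \<odot> e" using e by (auto simp: e_def u_def)
  have g0: "g \<noteq> \<zero>" using star_mult_eq_zero[OF A(2)] e0 by (auto simp: g_def)
  have sg: "star A g = g" using A by (simp add: g_def star_mult)
  have ep: "e \<otimes> p = e" using A pp by (simp add: e_def m_assoc)
  have gp: "g \<otimes> p = g" using A pp ep by (simp add: g_def m_assoc)
  have dg: "d \<otimes> g = l \<odot> g"
  proof -
    have "d \<otimes> g = star A e \<otimes> (d \<otimes> e)"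
      unfolding g_def using comm[OF d(1) clos(2)[OF eD eD]] A dA by (simp add: m_assoc[symmetric])
    then show ?thesis using A e0 by (simp add: g_def mult_scale_right)
  qed
  define \<mu> where "\<mu> = poly q' l"
  have eg: "e \<otimes> g = \<mu> \<odot> g"
  proof -
    have "e \<otimes> g = u \<otimes> (g \<otimes> p)" unfolding e_def using A pp comm[OF p(2) gD] by (simp add: m_assoc)
    then show ?thesis using gp poly_eval_eigenvector[OF dA A(3) dg, of q'] by (simp add: u_def \<mu>_def)
  qed
  have seg: "star A e \<otimes> g = cnj \<mu> \<odot> g"
  proof -
    have "star A (e \<otimes> g) = star A e \<otimes> g"
      using A sg comm[OF gD clos(2)[OF eD eD]] by (simp add: star_mult)
    then show ?thesis using eg A sg by (simp add: star_scale)
  qed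
  \<comment> \<open>\<open>e\<close> acts on \<open>g\<close> as the scalar \<open>\<mu>\<close> and
    its adjoint as \<open>cnj \<mu>\<close>, so \<open>g\<close> is idempotent up to the factor
    \<open>\<nu>\<close>. This factor is nonzero because a nonzero self-adjoint element cannot have
    square zero.\<close>
  define \<nu> where "\<nu> = cnj \<mu> * \<mu>"
  have gg: "g \<otimes> g = \<nu> \<odot> g"
  proof -
    have "g \<otimes> g = star A e \<otimes> (e \<otimes> g)" using A by (simp add: g_def m_assoc)
    also have "\<dots> = \<mu> \<odot> (star A e \<otimes> g)" using A by (simp add: eg mult_scale_right)
    finally show ?thesis using A by (simp add: seg scale_scale \<nu>_def mult.commute)
  qed
  have \<nu>0: "\<nu> \<noteq> 0"
  proof
    assume "\<nu> = 0"
    then have "star A g \<otimes> g = \<zero>" using gg sg A by simp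
    then show False using star_mult_eq_zero[OF A(3)] g0 by blast
  qed
  have \<nu>r: "cnj (1 / \<nu>) = 1 / \<nu>" by (simp add: \<nu>_def mult.commute)
  define h where "h = (1 / \<nu>) \<odot> g"
  have hD: "h \<in> D" using clos gD by (simp add: h_def)
  have "projection h"
    unfolding projection_def
  proof (intro conjI)
    show "h \<in> carrier A" using A by (simp add: h_def)
    show "h \<noteq> \<zero>" using scale_eq_zero[OF A(3), of "1 / \<nu>"] g0 \<nu>0 by (auto simp: h_def)
    show "star A h = h" unfolding h_def star_scale[OF A(3)] \<nu>r sg ..
    show "h \<otimes> h = h" unfolding h_def using A \<nu>0 by (simp add: mult_scale_left mult_scale_right gg scale_scale)
  qed
  moreover have "h \<otimes> p = h" using gp A pp by (simp add: h_def mult_scale_left)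
  \<comment> \<open>If nothing smaller than \<open>p\<close> has been found, the eigenvector
    equation for \<open>h\<close> is one for \<open>p\<close> itself and makes \<open>d\<close>
    scalar.\<close>
  moreover have "d = l \<odot> p" if "h = p"
  proof -
    have "d \<otimes> h = l \<odot> h" using dg A dA by (simp add: h_def mult_scale_right scale_scale mult.commute)
    then show ?thesis using that d by simp
  qed
  ultimately show ?thesis using hD by blast
qed

definition orthogonal_resolution :: "'a set \<Rightarrow> 'a set \<Rightarrow> bool" where
  "orthogonal_resolution D P \<longleftrightarrow> finite P \<and> P \<subseteq> D \<and> (\<forall>p\<in>P. projection p) \<and>
     (\<forall>p\<in>P. \<forall>q\<in>P. p \<noteq> q \<longrightarrow> p \<otimes> q = \<zero>) \<and> (\<Oplus>p\<in>P. p) = \<one>"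

text \<open>Multiplying a linear relation by one of the projections isolates its coefficient, so the
  projections are independent.\<close>

lemma card_orthogonal_resolution_le:
  assumes P: "orthogonal_resolution D P" and D: "D \<subseteq> carrier A" and dim: "has_dimension A D r"
  shows "card P \<le> r"
proof (rule ccontr)
  assume "\<not> card P \<le> r"
  have fin: "finite P" and PD: "P \<subseteq> D" and proj: "\<And>p. p \<in> P \<Longrightarrow> projection p"
    and orth: "\<And>p q. p \<in> P \<Longrightarrow> q \<in> P \<Longrightarrow> p \<noteq> q \<Longrightarrow> p \<otimes> q = \<zero>"
    using P by (auto simp: orthogonal_resolution_def)
  have PA: "p \<in> carrier A" if "p \<in> P" for p using proj[OF that] by (simp add: projection_def)
  obtain c where c: "\<exists>p\<in>P. c p \<noteq> 0" "(\<Oplus>p\<in>P. c p \<odot> p) = \<zero>"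
    using dependent_if_card_gt_dimension[OF dim D fin, of "\<lambda>p. p"] \<open>\<not> card P \<le> r\<close> PD by auto
  then obtain q where q: "q \<in> P" "c q \<noteq> 0" by blast
  have "\<zero> = (\<Oplus>p\<in>P. c p \<odot> p) \<otimes> q" using c PA[OF q(1)] by simp
  also have "\<dots> = (\<Oplus>p\<in>P. c p \<odot> p \<otimes> q)"
    by (rule finsum_ldistr[OF fin]) (use PA q in auto)
  also have "\<dots> = (\<Oplus>p\<in>P. if q = p then c p \<odot> p else \<zero>)"
  proof (rule finsum_cong'[OF refl])
    show "(\<lambda>p. if q = p then c p \<odot> p else \<zero>) \<in> P \<rightarrow> carrier A" using PA by auto
    fix p assume p: "p \<in> P"
    then show "c p \<odot> p \<otimes> q = (if q = p then c p \<odot> p else \<zero>)"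
      using projectionD(4)[OF proj[OF q(1)]] orth[OF p q(1)] PA q by (auto simp: mult_scale_left)
  qed
  also have "\<dots> = c q \<odot> q"
    by (rule add.finprod_singleton[OF q(1) fin]) (use PA in auto)
  finally have "c q \<odot> q = \<zero>" ..
  then have "q = \<zero>" using scale_eq_zero[OF PA[OF q(1)]] q(2) by blast
  then show False using projectionD(2)[OF proj[OF q(1)]] by blast
qed

text \<open>\<open>p\<close> is replaced by \<open>h\<close> and \<open>p - h\<close>; both are
  below \<open>p\<close> and thus remain orthogonal to the other projections.\<close>

lemma orthogonal_resolution_split:
  assumes P: "orthogonal_resolution D P" and D: "abelian_cstar_subalgebra A D"
    and p: "p \<in> P" and h: "h \<in> D" "projection h" "h \<noteq> p" "h \<otimes> p = h"
  shows "\<exists>P'. orthogonal_resolution D P' \<and> card P' = Suc (card P)"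
proof -
  have comm: "\<And>x y. x \<in> D \<Longrightarrow> y \<in> D \<Longrightarrow> x \<otimes> y = y \<otimes> x"
    and clos: "\<And>x y. x \<in> D \<Longrightarrow> y \<in> D \<Longrightarrow> x \<oplus> y \<in> D" "\<And>x c. x \<in> D \<Longrightarrow> c \<odot> x \<in> D"
    using D by (auto simp: abelian_cstar_subalgebra_def cstar_subalgebra_def)
  have fin: "finite P" and PD: "P \<subseteq> D" and proj: "\<And>p. p \<in> P \<Longrightarrow> projection p"
    and orth: "\<And>p q. p \<in> P \<Longrightarrow> q \<in> P \<Longrightarrow> p \<noteq> q \<Longrightarrow> p \<otimes> q = \<zero>" and one: "(\<Oplus>p\<in>P. p) = \<one>"
    using P by (auto simp: orthogonal_resolution_def)
  have PA: "p \<in> carrier A" if "p \<in> P" for p using proj[OF that] by (simp add: projection_def)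
  note hh = projectionD[OF h(2)] and pp = projectionD[OF proj[OF p]]
  have ph: "p \<otimes> h = h" using comm[OF h(1), of p] PD p h(4) by auto
  define k where "k = p \<ominus> h"
  have kA: "k \<in> carrier A" using pp hh by (simp add: k_def)
  have k0: "k \<noteq> \<zero>" unfolding k_def using minus_eq_zero_iff[OF pp(1) hh(1)] h(3) by blast
  have "k = p \<oplus> (- 1) \<odot> h" using hh by (simp add: k_def a_minus_def scale_minus_one)
  then have kD: "k \<in> D" using clos PD p h by auto
  have hk: "h \<otimes> k = \<zero>" "k \<otimes> h = \<zero>"
    using hh pp h(4) ph by (simp_all add: k_def a_minus_def r_distr l_distr r_minus l_minus r_neg)
  have pk: "p \<otimes> k = k"
    using hh pp ph by (simp add: k_def a_minus_def r_distr r_minus)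
  have kk: "k \<otimes> k = k"
  proof -
    have "k \<otimes> k = p \<otimes> k \<ominus> h \<otimes> k" using hh pp kA by (subst (1) k_def) (simp add: a_minus_def l_distr l_minus)
    then show ?thesis using hk pk kA by (simp add: a_minus_def)
  qed
  have kp: "k \<otimes> p = k" using comm[OF kD, of p] PD p pk by auto
  have sk: "star A k = k" using hh pp by (simp add: k_def star_minus)
  have projk: "projection k" using kA k0 sk kk by (simp add: projection_def)
  define Q where "Q = P - {p}"
  have Qorth: "q \<otimes> x = \<zero> \<and> x \<otimes> q = \<zero>" if q: "q \<in> Q" and x: "x \<in> carrier A" "p \<otimes> x = x" "x \<otimes> p = x" for q x
  proof -
    have qA: "q \<in> carrier A" and z: "q \<otimes> p = \<zero>" "p \<otimes> q = \<zero>"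
      using q orth[of q p] orth[of p q] p PA by (auto simp: Q_def)
    have "q \<otimes> x = q \<otimes> p \<otimes> x" using qA pp x by (simp add: m_assoc)
    moreover have "x \<otimes> q = x \<otimes> (p \<otimes> q)" using qA pp x by (simp add: m_assoc[symmetric])
    ultimately show ?thesis using z x qA by simp
  qed
  have hQ: "h \<notin> Q" using Qorth[of h h] hh ph h(4) by auto
  have kQ: "k \<notin> Q" using Qorth[of k k] kA kk k0 pk kp by auto
  have hk': "h \<noteq> k" using hk hh by auto
  have finQ: "finite Q" using fin by (simp add: Q_def)
  define P' where "P' = insert h (insert k Q)"
  have "orthogonal_resolution D P'"
    unfolding orthogonal_resolution_def
  proof (intro conjI ballI impI)
    show "finite P'" "P' \<subseteq> D" using finQ kD h PD by (auto simp: P'_def Q_def)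
    show "projection x" if "x \<in> P'" for x using that projk h proj by (auto simp: P'_def Q_def)
    show "x \<otimes> y = \<zero>" if "x \<in> P'" "y \<in> P'" "x \<noteq> y" for x y
      using that hk Qorth[of x y] Qorth[of y x] hh ph h(4) kA pk kp orth[of x y]
      unfolding P'_def Q_def by auto
    have idQ: "(\<lambda>x. x) \<in> Q \<rightarrow> carrier A" using PA by (auto simp: Q_def)
    have S: "(\<Oplus>x\<in>Q. x) \<in> carrier A" by (rule finsum_closed[OF idQ])
    have "(\<Oplus>x\<in>P'. x) = h \<oplus> (k \<oplus> (\<Oplus>x\<in>Q. x))"
      unfolding P'_def using finQ hQ kQ hk' hh kA idQ by (subst finsum_insert, auto)+
    also have "\<dots> = (h \<oplus> k) \<oplus> (\<Oplus>x\<in>Q. x)" using hh kA S by (simp add: a_assoc)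
    also have "h \<oplus> k = p"
    proof -
      have "h \<oplus> k = p \<oplus> (h \<oplus> \<ominus> h)"
        unfolding k_def a_minus_def by (rule a_lcomm) (use hh pp in auto)
      then show ?thesis using hh pp by (simp add: r_neg)
    qed
    also have "p \<oplus> (\<Oplus>x\<in>Q. x) = (\<Oplus>x\<in>insert p Q. x)"
      using finQ idQ pp by (subst finsum_insert) (auto simp: Q_def)
    also have "insert p Q = P" using p by (auto simp: Q_def)
    finally show "(\<Oplus>x\<in>P'. x) = \<one>" using one by simp
  qed
  moreover have "card P' = Suc (card P)"
    using finQ hQ kQ hk' p fin card_Suc_Diff1[OF fin p] by (simp add: P'_def Q_def)
  ultimately show ?thesis by blast
qed

text \<open>A resolution of maximal cardinality consists of minimal projections of the maximal abelian
  subalgebra \<open>D\<close>, and then \<open>p \<otimes> b \<otimes> p\<close> is a multiple of \<open>p\<close> for all \<open>b\<close> by maximality of \<open>D\<close>.\<close>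

lemma minimal_projections_exist:
  assumes rank: "has_rank A r" and ne: "\<one> \<noteq> \<zero>"
  shows "\<exists>P. finite P \<and> card P \<le> r \<and> (\<forall>p\<in>P. projection p) \<and> (\<Oplus>p\<in>P. p) = \<one> \<and>
    (\<forall>p\<in>P. \<forall>b\<in>carrier A. \<exists>c. p \<otimes> b \<otimes> p = c \<odot> p)"
proof -
  obtain D where D: "maximal_abelian_cstar_subalgebra A D" and dim: "has_dimension A D r"
    using rank by (auto simp: has_rank_def)
  have ab: "abelian_cstar_subalgebra A D" using D by (simp add: maximal_abelian_cstar_subalgebra_def)
  have comm: "\<And>x y. x \<in> D \<Longrightarrow> y \<in> D \<Longrightarrow> x \<otimes> y = y \<otimes> x" and DA: "D \<subseteq> carrier A"
    and clos: "\<And>x y. x \<in> D \<Longrightarrow> y \<in> D \<Longrightarrow> x \<otimes> y \<in> D"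
    using ab by (auto simp: abelian_cstar_subalgebra_def cstar_subalgebra_def)
  \<comment> \<open>A subalgebra in the present sense may lack the unit; a maximal abelian one
    absorbs it because the unit commutes with everything.\<close>
  have oneD: "\<one> \<in> D" by (rule maximal_abelian_absorbs[OF D]) (use DA in auto)
  define K where "K k \<longleftrightarrow> (\<exists>P. orthogonal_resolution D P \<and> card P = k)" for k
  have "orthogonal_resolution D {\<one>}"
    using oneD ne by (simp add: orthogonal_resolution_def projection_def)
  then have K1: "K 1" unfolding K_def by (intro exI[of _ "{\<one>}"]) simp
  have Kr: "k \<le> r" if "K k" for k
    using that card_orthogonal_resolution_le[OF _ DA dim] by (auto simp: K_def)
  define m where "m = Greatest K"
  have "K m" unfolding m_def using K1 Kr by (rule GreatestI_nat)
  then obtain P where P: "orthogonal_resolution D P" "card P = m" by (auto simp: K_def)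
  have max: "\<not> K (Suc m)" using Greatest_le_nat[of K "Suc m" r] Kr by (auto simp: m_def)
  have proj: "projection p" and PD: "p \<in> D" if "p \<in> P" for p
    using P that by (auto simp: orthogonal_resolution_def)
  have scalar: "\<exists>l. d = l \<odot> p" if p: "p \<in> P" and d: "d \<in> D" "d \<otimes> p = d" for p d
  proof (rule ccontr)
    assume "\<nexists>l. d = l \<odot> p"
    then obtain h where "h \<in> D" "projection h" "h \<noteq> p" "h \<otimes> p = h"
      using scalar_or_smaller_projection[OF ab oneD dim proj[OF p] PD[OF p] d] by blast
    from orthogonal_resolution_split[OF P(1) ab p this] show False using max P(2) by (auto simp: K_def)
  qed
  have selfadj: "\<exists>c. p \<otimes> b \<otimes> p = c \<odot> p" if p: "p \<in> P" and b: "b \<in> carrier A" "star A b = b" for p b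
  proof -
    note pp = projectionD[OF proj[OF p]]
    define x where "x = p \<otimes> b \<otimes> p"
    have xA: "x \<in> carrier A" using pp b by (simp add: x_def)
    have sx: "star A x = x" using pp b by (simp add: x_def star_mult m_assoc)
    have px: "p \<otimes> x = x" "x \<otimes> p = x"
      using pp b by (simp_all add: x_def m_assoc) (simp add: m_assoc[symmetric])
    \<comment> \<open>Every \<open>d\<close> in \<open>D\<close> acts on \<open>p\<close> as a
      scalar, so it commutes with \<open>x\<close>, which is compressed by \<open>p\<close> on both
      sides.\<close>
    have "x \<in> D"
    proof (rule maximal_abelian_absorbs[OF D xA sx])
      fix d assume d: "d \<in> D"
      then have dA: "d \<in> carrier A" using DA by blast
      have "d \<otimes> p \<otimes> p = d \<otimes> p" using dA pp by (simp add: m_assoc)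
      then obtain l where l: "d \<otimes> p = l \<odot> p" using scalar[OF p clos[OF d PD[OF p]]] by blast
      have "d \<otimes> x = d \<otimes> p \<otimes> x" using px dA pp xA by (simp add: m_assoc)
      then have 1: "d \<otimes> x = l \<odot> x" using l px pp xA by (simp add: mult_scale_left)
      have "x \<otimes> d = x \<otimes> (p \<otimes> d)" using px dA pp xA by (simp add: m_assoc[symmetric])
      also have "p \<otimes> d = l \<odot> p" using comm[OF PD[OF p] d] l by simp
      finally show "x \<otimes> d = d \<otimes> x" using 1 px pp xA by (simp add: mult_scale_right)
    qed
    from scalar[OF p this px(2)] show ?thesis by (simp add: x_def)
  qed
  show ?thesis
  proof (intro exI[of _ P] conjI ballI)
    show "finite P" "(\<Oplus>p\<in>P. p) = \<one>" using P by (simp_all add: orthogonal_resolution_def)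
    show "card P \<le> r" using Kr[OF \<open>K m\<close>] P by simp
    show "projection p" if "p \<in> P" for p by (rule proj[OF that])
    fix p b assume p: "p \<in> P" and b: "b \<in> carrier A"
    note pp = projectionD[OF proj[OF p]]
    \<comment> \<open>Absorption into \<open>D\<close> works for self-adjoint elements, so
      \<open>b\<close> is split into real and imaginary part: \<open>b1\<close> is twice the former
      and \<open>b2\<close> is minus twice the latter.\<close>
    define b1 where "b1 = b \<oplus> star A b"
    define b2 where "b2 = \<i> \<odot> (b \<oplus> (- 1) \<odot> star A b)"
    have bA: "b1 \<in> carrier A" "b2 \<in> carrier A" using b by (auto simp: b1_def b2_def)
    have "star A b1 = b1" using b by (simp add: b1_def star_add a_comm)
    then obtain c1 where c1: "p \<otimes> b1 \<otimes> p = c1 \<odot> p" using selfadj[OF p bA(1)] by blast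
    have "star A b2 = b2"
      using b by (simp add: b2_def star_add star_scale scale_add_right scale_scale a_comm)
    then obtain c2 where c2: "p \<otimes> b2 \<otimes> p = c2 \<odot> p" using selfadj[OF p bA(2)] by blast
    have "b1 \<oplus> (- \<i>) \<odot> b2 = (b \<oplus> star A b) \<oplus> (b \<oplus> (- 1) \<odot> star A b)"
      using b by (simp add: b1_def b2_def scale_scale)
    also have "\<dots> = (b \<oplus> b) \<oplus> (star A b \<oplus> (- 1) \<odot> star A b)"
      using b by (simp add: a_ac)
    also have "star A b \<oplus> (- 1) \<odot> star A b = \<zero>" using b by (simp add: scale_minus_one r_neg)
    also have "b \<oplus> b = 2 \<odot> b" using scale_add_left[OF b, of 1 1] b by simp
    finally have b2b: "b1 \<oplus> (- \<i>) \<odot> b2 = 2 \<odot> b" using b by simp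
    have "b = (1/2) \<odot> (2 \<odot> b)" using b by (simp add: scale_scale)
    also have "\<dots> = (1/2) \<odot> b1 \<oplus> (- \<i> / 2) \<odot> b2"
      unfolding b2b[symmetric] using bA by (simp add: scale_add_right scale_scale)
    finally have bb: "b = (1/2) \<odot> b1 \<oplus> (- \<i> / 2) \<odot> b2" .
    have "p \<otimes> b \<otimes> p = (1/2) \<odot> (p \<otimes> b1 \<otimes> p) \<oplus> (- \<i> / 2) \<odot> (p \<otimes> b2 \<otimes> p)"
      by (subst bb) (use bA pp in \<open>simp add: r_distr l_distr mult_scale_left mult_scale_right\<close>)
    also have "\<dots> = ((1/2) * c1 + (- \<i> / 2) * c2) \<odot> p"
      unfolding c1 c2 scale_scale[OF pp(1)] scale_add_left[OF pp(1)] ..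
    finally show "\<exists>c. p \<otimes> b \<otimes> p = c \<odot> p" by blast
  qed
qed

end


section \<open>Rademacher sums\<close>

definition words :: "'i set \<Rightarrow> nat \<Rightarrow> 'i list set" where
  "words J L = {w. set w \<subseteq> J \<and> length w = L}"

text \<open>Extensional functions make the set finite and let a product of sums over
  \<open>{- 1, 1}\<close> expand into a sum over it.\<close>

definition signs :: "'i set \<Rightarrow> ('i \<Rightarrow> real) set" where
  "signs J = (J \<rightarrow>\<^sub>E {- 1, 1})"



lemma card_signs: "finite J \<Longrightarrow> card (signs J) = 2 ^ card J"
  by (simp add: signs_def card_PiE numeral_2_eq_2)

lemma words_0: "words J 0 = {[]}"
  by (auto simp: words_def)

lemma sum_words_Suc:
  fixes g :: "'i list \<Rightarrow> 'b::comm_monoid_add"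
  shows "(\<Sum>w\<in>words J (Suc L). g w) = (\<Sum>i\<in>J. \<Sum>w\<in>words J L. g (i # w))"
proof -
  have "words J (Suc L) = (\<lambda>(i, w). i # w) ` (J \<times> words J L)"
    unfolding words_def by (auto simp: length_Suc_conv image_iff)
  moreover have "inj_on (\<lambda>(i, w). i # w) (J \<times> words J L)" by (auto simp: inj_on_def)
  ultimately have "(\<Sum>w\<in>words J (Suc L). g w) = (\<Sum>(i, w)\<in>J \<times> words J L. g (i # w))"
    by (simp add: sum.reindex case_prod_unfold)
  then show ?thesis by (simp add: sum.cartesian_product)
qed

lemma sum_words_power:
  fixes e :: "'i \<Rightarrow> 'b::comm_semiring_1"
  shows "(\<Sum>w\<in>words J L. prod_list (map e w)) = (\<Sum>i\<in>J. e i) ^ L"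
proof (induction L)
  case (Suc L)
  have "(\<Sum>w\<in>words J (Suc L). prod_list (map e w)) = (\<Sum>i\<in>J. e i * (\<Sum>w\<in>words J L. prod_list (map e w)))"
    by (simp add: sum_words_Suc sum_distrib_left)
  then show ?case by (simp add: Suc sum_distrib_right)
qed (simp add: words_0)

lemma prod_list_eq_prod_count:
  fixes e :: "'i \<Rightarrow> 'b::comm_monoid_mult"
  assumes "finite J" "set w \<subseteq> J"
  shows "prod_list (map e w) = (\<Prod>i\<in>J. e i ^ count_list w i)"
  using assms(2)
proof (induction w)
  case (Cons j w)
  have "(\<Prod>i\<in>J. e i ^ count_list (j # w) i) = (\<Prod>i\<in>J. (if j = i then e i else 1) * e i ^ count_list w i)"
    by (intro prod.cong) auto
  also have "\<dots> = e j * (\<Prod>i\<in>J. e i ^ count_list w i)"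
    using Cons.prems assms(1) by (simp add: prod.distrib)
  finally show ?case using Cons by simp
qed simp

text \<open>The sum factorises over the letters: a letter contributes 2 if it occurs an even number
  of times and 0 otherwise.\<close>

lemma sum_signs_word_nonneg:
  assumes J: "finite J" and w: "set w \<subseteq> J"
  shows "(\<Sum>e\<in>signs J. prod_list (map e w)) \<ge> 0"
proof -
  have "(\<Sum>e\<in>signs J. prod_list (map e w)) = (\<Sum>e\<in>signs J. \<Prod>i\<in>J. e i ^ count_list w i)"
    by (simp add: prod_list_eq_prod_count[OF J w])
  also have "\<dots> = (\<Prod>i\<in>J. \<Sum>y\<in>{- 1, 1}. y ^ count_list w i)"
    unfolding signs_def by (rule prod_sum_PiE[symmetric]) (use J in auto)
  also have "\<dots> \<ge> 0"
    by (intro prod_nonneg ballI) (simp add: minus_one_power_iff)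
  finally show ?thesis .
qed



text \<open>Comparison with constant coefficients. After expanding the square, each product of two
  coefficients is multiplied by the sign sum of a concatenated word, which is nonnegative; putting
  \<open>K\<close> for all coefficients can only increase the total, and what remains is a power of
  the scalar sum.\<close>

lemma second_moment_le:
  fixes \<alpha> :: "'i list \<Rightarrow> complex"
  assumes J: "finite J" and \<alpha>: "\<And>w. w \<in> words J L \<Longrightarrow> cmod (\<alpha> w) \<le> K"
  shows "(\<Sum>e\<in>signs J. (cmod (\<Sum>w\<in>words J L. of_real (prod_list (map e w)) * \<alpha> w))\<^sup>2)
    \<le> K\<^sup>2 * (\<Sum>e\<in>signs J. (\<Sum>i\<in>J. e i) ^ (2 * L))"
proof -
  let ?E = "\<lambda>e :: 'i \<Rightarrow> real. \<lambda>w. prod_list (map e w)"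
  have 1: "(cmod (\<Sum>w\<in>words J L. of_real (?E e w) * \<alpha> w))\<^sup>2
      = (\<Sum>w\<in>words J L. \<Sum>v\<in>words J L. ?E e (w @ v) * Re (\<alpha> w * cnj (\<alpha> v)))" for e
  proof -
    have "complex_of_real ((cmod (\<Sum>w\<in>words J L. of_real (?E e w) * \<alpha> w))\<^sup>2)
        = (\<Sum>w\<in>words J L. of_real (?E e w) * \<alpha> w) * cnj (\<Sum>w\<in>words J L. of_real (?E e w) * \<alpha> w)"
      by (rule complex_norm_square)
    also have "\<dots> = (\<Sum>w\<in>words J L. \<Sum>v\<in>words J L. of_real (?E e (w @ v)) * (\<alpha> w * cnj (\<alpha> v)))"
      by (simp add: sum_product mult_ac)
    finally have "Re (complex_of_real ((cmod (\<Sum>w\<in>words J L. of_real (?E e w) * \<alpha> w))\<^sup>2))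
        = Re (\<Sum>w\<in>words J L. \<Sum>v\<in>words J L. of_real (?E e (w @ v)) * (\<alpha> w * cnj (\<alpha> v)))" by simp
    then show ?thesis by (simp add: Re_sum del: of_real_power)
  qed
  have "(\<Sum>e\<in>signs J. (cmod (\<Sum>w\<in>words J L. of_real (?E e w) * \<alpha> w))\<^sup>2)
      = (\<Sum>w\<in>words J L. \<Sum>v\<in>words J L. \<Sum>e\<in>signs J. ?E e (w @ v) * Re (\<alpha> w * cnj (\<alpha> v)))"
    unfolding 1 by (subst sum.swap, rule sum.cong[OF refl], rule sum.swap)
  also have "\<dots> \<le> (\<Sum>w\<in>words J L. \<Sum>v\<in>words J L. \<Sum>e\<in>signs J. ?E e (w @ v) * K\<^sup>2)"
  proof (rule sum_mono, rule sum_mono)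
    fix w v assume w: "w \<in> words J L" and v: "v \<in> words J L"
    have "K \<ge> 0" using \<alpha>[OF w] norm_ge_zero order_trans by blast
    then have "cmod (\<alpha> w) * cmod (cnj (\<alpha> v)) \<le> K * K"
      using \<alpha>[OF w] \<alpha>[OF v] by (intro mult_mono) auto
    then have "Re (\<alpha> w * cnj (\<alpha> v)) \<le> K\<^sup>2"
      using complex_Re_le_cmod[of "\<alpha> w * cnj (\<alpha> v)"] by (simp add: norm_mult power2_eq_square)
    moreover have "(\<Sum>e\<in>signs J. ?E e (w @ v)) \<ge> 0"
      by (rule sum_signs_word_nonneg[OF J]) (use w v in \<open>auto simp: words_def\<close>)
    ultimately show "(\<Sum>e\<in>signs J. ?E e (w @ v) * Re (\<alpha> w * cnj (\<alpha> v))) \<le> (\<Sum>e\<in>signs J. ?E e (w @ v) * K\<^sup>2)"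
      unfolding sum_distrib_right[symmetric] by (rule mult_left_mono)
  qed
  also have "\<dots> = (\<Sum>e\<in>signs J. \<Sum>w\<in>words J L. \<Sum>v\<in>words J L. ?E e (w @ v) * K\<^sup>2)"
    by (simp only: sum.swap[of _ "signs J" "words J L"])
  also have "\<dots> = (\<Sum>e\<in>signs J. (\<Sum>i\<in>J. e i) ^ (2 * L) * K\<^sup>2)"
  proof (rule sum.cong[OF refl])
    fix e
    have "(\<Sum>w\<in>words J L. \<Sum>v\<in>words J L. ?E e (w @ v) * K\<^sup>2)
        = (\<Sum>w\<in>words J L. ?E e w) * (\<Sum>v\<in>words J L. ?E e v) * K\<^sup>2"
      unfolding sum_product unfolding sum_distrib_right by simp
    then show "(\<Sum>w\<in>words J L. \<Sum>v\<in>words J L. ?E e (w @ v) * K\<^sup>2) = (\<Sum>i\<in>J. e i) ^ (2 * L) * K\<^sup>2"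
      by (simp add: sum_words_power mult_2 power_add)
  qed
  finally show ?thesis by (simp add: sum_distrib_left mult.commute)
qed

text \<open>The subgaussian estimate for one sign, with exponent \<open>t\<^sup>2\<close> in place
  of the sharp \<open>t\<^sup>2 / 2\<close>, which makes a quadratic Taylor bound
  sufficient.\<close>

lemma cosh_le_exp_square:
  fixes t :: real
  assumes "0 \<le> t" "t \<le> 1"
  shows "exp t + exp (- t) \<le> 2 * exp (t\<^sup>2)"
proof -
  have "exp t \<le> 1 + t + t\<^sup>2" using exp_bound[OF assms] .
  moreover have "exp (- t) \<le> 1 - t + t\<^sup>2"
  proof -
    have "1 \<le> (1 - t + t\<^sup>2) * (1 + t)"
    proof -
      have "(1 - t + t\<^sup>2) * (1 + t) = 1 + t ^ 3" by (simp add: algebra_simps power2_eq_square power3_eq_cube)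
      then show ?thesis using assms by simp
    qed
    also have "\<dots> \<le> (1 - t + t\<^sup>2) * exp t"
      using assms by (intro mult_left_mono exp_ge_add_one_self) auto
    finally have "1 * exp (- t) \<le> (1 - t + t\<^sup>2) * exp t * exp (- t)" by (intro mult_right_mono) auto
    also have "\<dots> = 1 - t + t\<^sup>2" by (simp add: mult.assoc flip: exp_add)
    finally show ?thesis by simp
  qed
  moreover have "1 + t\<^sup>2 \<le> exp (t\<^sup>2)" by (rule exp_ge_add_one_self)
  ultimately show ?thesis by linarith
qed

text \<open>For \<open>y \<ge> 0\<close> the power is one term of the exponential series; adding
  \<open>exp (- y)\<close> covers both signs of \<open>y\<close>.\<close>

lemma power_le_fact_exp:
  fixes y :: real
  shows "y ^ (2 * L) \<le> fact (2 * L) * (exp y + exp (- y))"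
proof -
  have *: "y ^ (2 * L) \<le> fact (2 * L) * exp y" if y: "y \<ge> 0" for y :: real
  proof -
    have s: "(\<lambda>n. inverse (fact n) * y ^ n) sums exp y"
      using exp_converges[of y] by (simp add: real_scaleR_def)
    have "inverse (fact (2 * L)) * y ^ (2 * L) \<le> (\<Sum>n. inverse (fact n) * y ^ n)"
      using sum_le_suminf[OF sums_summable[OF s], of "{2 * L}"] y by simp
    also have "\<dots> = exp y" using sums_unique[OF s] by simp
    finally show ?thesis by (simp add: field_simps)
  qed
  show ?thesis
  proof (cases "y \<ge> 0")
    case True
    have "y ^ (2 * L) \<le> fact (2 * L) * exp y" by (rule *[OF True])
    also have "\<dots> \<le> fact (2 * L) * (exp y + exp (- y))" by (intro mult_left_mono) auto
    finally show ?thesis .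
  next
    case False
    have "y ^ (2 * L) = (- y) ^ (2 * L)" by simp
    also have "\<dots> \<le> fact (2 * L) * exp (- y)" by (rule *) (use False in simp)
    also have "\<dots> \<le> fact (2 * L) * (exp y + exp (- y))" by (intro mult_left_mono) auto
    finally show ?thesis .
  qed
qed

lemma sum_signs_exp:
  assumes J: "finite J"
  shows "(\<Sum>e\<in>signs J. exp (t * (\<Sum>i\<in>J. e i))) = (exp t + exp (- t)) ^ card J"
proof -
  have "(\<Sum>e\<in>signs J. exp (t * (\<Sum>i\<in>J. e i))) = (\<Sum>e\<in>signs J. \<Prod>i\<in>J. exp (t * e i))"
    using J by (simp add: sum_distrib_left exp_sum)
  also have "\<dots> = (\<Prod>i\<in>J. \<Sum>y\<in>{- 1, 1}. exp (t * y))"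
    unfolding signs_def by (rule prod_sum_PiE[symmetric]) (use J in auto)
  finally show ?thesis by (simp add: add.commute)
qed

text \<open>A Khintchine-type bound by way of the exponential moment, which factorises over the
  signs. It enters with the order \<open>(L * m) ^ L\<close> and an explicit constant.\<close>

lemma rademacher_moment_le:
  assumes J: "finite J" and L: "1 \<le> L" "L \<le> card J"
  shows "(\<Sum>e\<in>signs J. (\<Sum>i\<in>J. e i) ^ (2 * L)) \<le> 2 ^ card J * (24 * real L * real (card J)) ^ L"
proof -
  define m where "m = card J"
  have mp: "real m > 0" "real L > 0" using L by (auto simp: m_def)
  \<comment> \<open>With this \<open>t\<close> the average of the exponential stays below
    \<open>exp L\<close>, while division by \<open>t ^ (2 * L)\<close> costs
    \<open>(m / L) ^ L\<close>. The bound \<open>L \<le> card J\<close> keeps \<open>t\<close> in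
    the range of \<open>cosh_le_exp_square\<close>.\<close>
  define t where "t = sqrt (real L / real m)"
  have t2: "t\<^sup>2 = real L / real m" using mp by (simp add: t_def)
  have t: "0 < t" "t \<le> 1" using mp L by (auto simp: t_def m_def)
  have "t ^ (2 * L) * (\<Sum>e\<in>signs J. (\<Sum>i\<in>J. e i) ^ (2 * L)) = (\<Sum>e\<in>signs J. (t * (\<Sum>i\<in>J. e i)) ^ (2 * L))"
    by (simp only: sum_distrib_left[of "t ^ (2 * L)"] power_mult_distrib)
  also have "\<dots> \<le> (\<Sum>e\<in>signs J. fact (2 * L) * (exp (t * (\<Sum>i\<in>J. e i)) + exp (- (t * (\<Sum>i\<in>J. e i)))))"
    by (intro sum_mono power_le_fact_exp)
  also have "\<dots> = fact (2 * L) * ((\<Sum>e\<in>signs J. exp (t * (\<Sum>i\<in>J. e i))) + (\<Sum>e\<in>signs J. exp ((- t) * (\<Sum>i\<in>J. e i))))"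
    unfolding sum_distrib_left[of "fact (2 * L)", symmetric] sum.distrib by simp
  also have "\<dots> = fact (2 * L) * (2 * (exp t + exp (- t)) ^ m)"
    unfolding sum_signs_exp[OF J] m_def by (simp add: add.commute)
  also have "\<dots> \<le> fact (2 * L) * (2 * (2 * exp (t\<^sup>2)) ^ m)"
    using cosh_le_exp_square[of t] t by (intro mult_left_mono power_mono) (auto intro: add_nonneg_nonneg)
  also have "(2 * exp (t\<^sup>2)) ^ m = 2 ^ m * exp (real L)"
    using mp by (simp add: power_mult_distrib t2 flip: exp_of_nat_mult)
  also have "fact (2 * L) * (2 * (2 ^ m * exp (real L))) \<le> real (2 * L) ^ (2 * L) * (2 * (2 ^ m * exp (real L)))"
    using fact_le_power[of "2 * L"] by (intro mult_right_mono) auto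
  finally have main: "t ^ (2 * L) * (\<Sum>e\<in>signs J. (\<Sum>i\<in>J. e i) ^ (2 * L))
      \<le> real (2 * L) ^ (2 * L) * (2 * (2 ^ m * exp (real L)))" .
  \<comment> \<open>The constant 24 is \<open>4 * 2 * 3\<close>: the square of the 2 in
    \<open>real (2 * L)\<close>, the leading 2 absorbed into \<open>2 ^ L\<close>, and
    \<open>exp 1 \<le> 3\<close>.\<close>
  have e3: "exp (1::real) \<le> 3" by (rule exp_le)
  have "exp (real L) = exp 1 ^ L" by (simp flip: exp_of_nat_mult)
  also have "\<dots> \<le> 3 ^ L" using e3 by (intro power_mono) auto
  finally have eL: "exp (real L) \<le> 3 ^ L" .
  have two: "(2::real) \<le> 2 ^ L" using L power_increasing[of 1 L "2::real"] by simp
  have "2 * (2 ^ m * exp (real L)) \<le> 2 ^ L * (2 ^ m * 3 ^ L)"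
    using two eL by (intro mult_mono) auto
  then have "real (2 * L) ^ (2 * L) * (2 * (2 ^ m * exp (real L))) \<le> real (2 * L) ^ (2 * L) * (2 ^ L * (2 ^ m * 3 ^ L))"
    by (intro mult_left_mono) auto
  also have "\<dots> = 2 ^ m * ((4 * (real L * real L)) ^ L * 2 ^ L * 3 ^ L)"
  proof -
    have "(real (2 * L))\<^sup>2 = 4 * (real L * real L)" by (simp add: power2_eq_square)
    then have "real (2 * L) ^ (2 * L) = (4 * (real L * real L)) ^ L" by (simp only: power_mult)
    then show ?thesis by (simp only: mult_ac)
  qed
  also have "(4 * (real L * real L)) ^ L * 2 ^ L * 3 ^ L = (4 * (real L * real L) * 2 * 3) ^ L"
    by (simp only: power_mult_distrib)
  also have "4 * (real L * real L) * 2 * 3 = 24 * real L * real L" by simp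
  also have "2 ^ m * (24 * real L * real L) ^ L = t ^ (2 * L) * (2 ^ m * (24 * real L * real m) ^ L)"
    unfolding power_mult t2 using mp by (simp add: power_divide power_mult_distrib)
  finally have "t ^ (2 * L) * (\<Sum>e\<in>signs J. (\<Sum>i\<in>J. e i) ^ (2 * L)) \<le> t ^ (2 * L) * (2 ^ m * (24 * real L * real m) ^ L)"
    using main by linarith
  then show ?thesis using t by (simp add: m_def)
qed

section \<open>Moments of signed sums in a C*-algebra\<close>

context unital_cstar
begin

lemma norm_finsum_le:
  assumes "finite I" "\<And>i. i \<in> I \<Longrightarrow> f i \<in> carrier A"
  shows "cnorm A (\<Oplus>i\<in>I. f i) \<le> (\<Sum>i\<in>I. cnorm A (f i))"
  using assms
proof (induction I)
  case (insert i I)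
  have c: "(\<Oplus>i\<in>I. f i) \<in> carrier A" by (rule finsum_closed) (use insert in auto)
  have "(\<Oplus>i\<in>insert i I. f i) = f i \<oplus> (\<Oplus>i\<in>I. f i)"
    using insert by (intro finsum_insert) auto
  then have "cnorm A (\<Oplus>i\<in>insert i I. f i) \<le> cnorm A (f i) + cnorm A (\<Oplus>i\<in>I. f i)"
    using norm_triangle[of "f i", OF _ c] insert by simp
  then show ?case using insert by simp
qed simp

text \<open>The bound \<open>C\<close> is a parameter because it grows whenever a factor is absorbed
  into the functional.\<close>

definition linear_functional :: "('a \<Rightarrow> complex) \<Rightarrow> real \<Rightarrow> bool" where
  "linear_functional f C \<longleftrightarrow>
     (\<forall>x\<in>carrier A. \<forall>y\<in>carrier A. f (x \<oplus> y) = f x + f y) \<and>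
     (\<forall>c. \<forall>x\<in>carrier A. f (c \<odot> x) = c * f x) \<and>
     (\<forall>x\<in>carrier A. cmod (f x) \<le> C * cnorm A x)"

text \<open>The compressions \<open>p b p = \<omega> p b \<odot> p\<close> take over the part of the
  trace. Decomposing \<open>s\<close> as the sum of the \<open>s \<otimes> p\<close>, the
  C*-identity turns the square norm of \<open>s \<otimes> p\<close> into
  \<open>cmod (\<omega> p (star A s \<otimes> s))\<close>, and Cauchy-Schwarz costs the factor
  \<open>card P\<close>.\<close>

lemma norming_functionals_exist:
  assumes rank: "has_rank A r" and ne: "\<one> \<noteq> \<zero>"
  shows "\<exists>P (\<omega> :: 'a \<Rightarrow> 'a \<Rightarrow> complex). finite P \<and> card P \<le> r \<and>
    (\<forall>p\<in>P. linear_functional (\<omega> p) 1) \<and>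
    (\<forall>s\<in>carrier A. (cnorm A s)\<^sup>2 \<le> real (card P) * (\<Sum>p\<in>P. cmod (\<omega> p (star A s \<otimes> s))))"
proof -
  obtain P where fin: "finite P" and card: "card P \<le> r" and proj': "\<forall>p\<in>P. projection p"
    and one: "(\<Oplus>p\<in>P. p) = \<one>"
    and ex': "\<forall>p\<in>P. \<forall>b\<in>carrier A. \<exists>c. p \<otimes> b \<otimes> p = c \<odot> p"
    using minimal_projections_exist[OF rank ne] by (elim exE conjE)
  note proj = proj'[rule_format] and ex = ex'[rule_format]
  define \<omega> where "\<omega> p b = (SOME c. p \<otimes> b \<otimes> p = c \<odot> p)" for p b
  have \<omega>: "p \<otimes> b \<otimes> p = \<omega> p b \<odot> p" if "p \<in> P" "b \<in> carrier A" for p b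
    unfolding \<omega>_def by (rule someI_ex[OF ex[OF that]])
  have cancel: "c = d" if p: "p \<in> P" and eq: "c \<odot> p = d \<odot> p" for p c d
  proof (rule ccontr)
    assume "c \<noteq> d"
    note pp = projectionD[OF proj[OF p]]
    have "(c - d) \<odot> p = c \<odot> p \<oplus> (- d) \<odot> p" using scale_add_left[OF pp(1), of c "- d"] by simp
    also have "\<dots> = (d + (- d)) \<odot> p" unfolding eq by (rule scale_add_left[OF pp(1), symmetric])
    finally have "(c - d) \<odot> p = \<zero>" using pp by simp
    then show False using scale_eq_zero[OF pp(1), of "c - d"] \<open>c \<noteq> d\<close> pp by simp
  qed
  have norm_eq: "cnorm A (p \<otimes> b \<otimes> p) = cmod (\<omega> p b)" if "p \<in> P" "b \<in> carrier A" for p b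
    using norm_scale[of p "\<omega> p b"] norm_projection[OF proj[OF that(1)]] projectionD(1)[OF proj[OF that(1)]]
    unfolding \<omega>[OF that] by simp
  have lin: "linear_functional (\<omega> p) 1" if p: "p \<in> P" for p
  proof -
    note pp = projectionD[OF proj[OF p]]
    show ?thesis
      unfolding linear_functional_def
    proof (intro conjI ballI allI)
      fix x assume x: "x \<in> carrier A"
      have "\<omega> p (x \<oplus> y) \<odot> p = (\<omega> p x + \<omega> p y) \<odot> p" if y: "y \<in> carrier A" for y
      proof -
        have "p \<otimes> (x \<oplus> y) \<otimes> p = p \<otimes> x \<otimes> p \<oplus> p \<otimes> y \<otimes> p" using x y pp by (simp add: l_distr r_distr)
        then show ?thesis using \<omega>[OF p] x y pp by (simp add: scale_add_left)
      qed
      then show "\<omega> p (x \<oplus> y) = \<omega> p x + \<omega> p y" if "y \<in> carrier A" for y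
        using cancel[OF p] that by blast
      have "\<omega> p (c \<odot> x) \<odot> p = (c * \<omega> p x) \<odot> p" for c
      proof -
        have "p \<otimes> (c \<odot> x) \<otimes> p = c \<odot> (p \<otimes> x \<otimes> p)" using x pp by (simp add: mult_scale_left mult_scale_right)
        then show ?thesis using \<omega>[OF p] x pp by (simp add: scale_scale)
      qed
      then show "\<omega> p (c \<odot> x) = c * \<omega> p x" for c using cancel[OF p] by blast
      have "cnorm A (p \<otimes> x \<otimes> p) \<le> cnorm A (p \<otimes> x) * cnorm A p" using pp x by (intro norm_mult) auto
      also have "\<dots> \<le> cnorm A p * cnorm A x * cnorm A p"
        using pp x norm_nonneg by (intro mult_right_mono norm_mult) auto
      finally show "cmod (\<omega> p x) \<le> 1 * cnorm A x"
        using norm_eq[OF p x] norm_projection[OF proj[OF p]] by simp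
    qed
  qed
  have bound: "(cnorm A s)\<^sup>2 \<le> real (card P) * (\<Sum>p\<in>P. cmod (\<omega> p (star A s \<otimes> s)))" if s: "s \<in> carrier A" for s
  proof -
    have PA: "p \<in> carrier A" if "p \<in> P" for p using projectionD(1)[OF proj[OF that]] .
    have "s = s \<otimes> (\<Oplus>p\<in>P. p)" using s by (simp add: one)
    also have "\<dots> = (\<Oplus>p\<in>P. s \<otimes> p)" by (rule finsum_rdistr[OF fin s]) (use PA in auto)
    finally have "cnorm A s \<le> (\<Sum>p\<in>P. cnorm A (s \<otimes> p))"
      using norm_finsum_le[OF fin, of "\<lambda>p. s \<otimes> p"] s PA by simp
    then have "(cnorm A s)\<^sup>2 \<le> (\<Sum>p\<in>P. cnorm A (s \<otimes> p))\<^sup>2" using norm_nonneg[OF s] by (rule power_mono)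
    also have "\<dots> = (\<Sum>p\<in>P. 1 * cnorm A (s \<otimes> p))\<^sup>2" by simp
    also have "\<dots> \<le> (\<Sum>p\<in>P. 1\<^sup>2) * (\<Sum>p\<in>P. (cnorm A (s \<otimes> p))\<^sup>2)" by (rule Cauchy_Schwarz_ineq_sum)
    also have "(\<Sum>p\<in>P. (cnorm A (s \<otimes> p))\<^sup>2) = (\<Sum>p\<in>P. cmod (\<omega> p (star A s \<otimes> s)))"
    proof (rule sum.cong[OF refl])
      fix p assume p: "p \<in> P"
      note pp = projectionD[OF proj[OF p]]
      have "(cnorm A (s \<otimes> p))\<^sup>2 = cnorm A (star A (s \<otimes> p) \<otimes> (s \<otimes> p))" using norm_star_mult[of "s \<otimes> p"] s pp by simp
      also have "star A (s \<otimes> p) \<otimes> (s \<otimes> p) = p \<otimes> (star A s \<otimes> s) \<otimes> p" using s pp by (simp add: star_mult m_assoc)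
      finally show "(cnorm A (s \<otimes> p))\<^sup>2 = cmod (\<omega> p (star A s \<otimes> s))" using norm_eq[OF p] s by simp
    qed
    finally show ?thesis by simp
  qed
  show ?thesis by (intro exI[of _ P] exI[of _ \<omega>] conjI ballI fin card lin bound)
qed


text \<open>A product of \<open>L\<close> factors alternating between \<open>s\<close> and its
  adjoint, with \<open>s\<close> rightmost. Even lengths give powers of
  \<open>star A s \<otimes> s\<close>; adding single factors on the left suits the expansion into
  words.\<close>

primrec alternating_power :: "'a \<Rightarrow> nat \<Rightarrow> 'a" where
  "alternating_power s 0 = \<one>"
| "alternating_power s (Suc L) = (if even L then s else star A s) \<otimes> alternating_power s L"

lemma alternating_power_closed [simp, intro]: "s \<in> carrier A \<Longrightarrow> alternating_power s L \<in> carrier A"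
  by (induction L) auto

lemma alternating_power_even:
  assumes s: "s \<in> carrier A"
  shows "alternating_power s (2 * K) = (star A s \<otimes> s) [^] K"
proof (induction K)
  case (Suc K)
  have "alternating_power s (2 * Suc K) = star A s \<otimes> (s \<otimes> alternating_power s (2 * K))" by simp
  also have "\<dots> = (star A s \<otimes> s) \<otimes> (star A s \<otimes> s) [^] K" using s Suc by (simp add: m_assoc)
  also have "\<dots> = (star A s \<otimes> s) [^] Suc K" using s by (intro nat_pow_Suc2[symmetric]) auto
  finally show ?case .
qed simp

lemma star_nat_pow:
  assumes "h \<in> carrier A" "star A h = h"
  shows "star A (h [^] (n::nat)) = h [^] n"
proof (induction n)
  case (Suc n)
  then have "star A (h [^] Suc n) = h \<otimes> h [^] n" using assms by (simp add: star_mult)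
  also have "\<dots> = h [^] Suc n" using assms by (intro nat_pow_Suc2[symmetric]) auto
  finally show ?case .
qed simp

text \<open>The C*-identity evaluates norms of self-adjoint powers by repeated squaring; this is why
  the exponents \<open>L\<close> below are tied to powers of two.\<close>

lemma norm_nat_pow_two_power:
  assumes h: "h \<in> carrier A" "star A h = h"
  shows "cnorm A (h [^] (2 ^ j :: nat)) = cnorm A h ^ (2 ^ j)"
proof (induction j)
  case (Suc j)
  have "h [^] (2 ^ Suc j :: nat) = h [^] (2 ^ j :: nat) \<otimes> h [^] (2 ^ j :: nat)"
    using nat_pow_mult[OF h(1), of "2 ^ j" "2 ^ j"] by (simp add: mult_2)
  also have "\<dots> = star A (h [^] (2 ^ j :: nat)) \<otimes> h [^] (2 ^ j :: nat)" by (simp add: star_nat_pow[OF h])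
  finally have "cnorm A (h [^] (2 ^ Suc j :: nat)) = (cnorm A (h [^] (2 ^ j :: nat)))\<^sup>2"
    using norm_star_mult[of "h [^] (2 ^ j :: nat)"] h by simp
  then show ?case by (simp add: Suc power_mult[symmetric] mult.commute)
qed (use h in simp)

lemma linear_functional_finsum:
  assumes f: "linear_functional f C" and "finite I" "\<And>i. i \<in> I \<Longrightarrow> x i \<in> carrier A"
  shows "f (\<Oplus>i\<in>I. c i \<odot> x i) = (\<Sum>i\<in>I. c i * f (x i))"
  using assms(2,3)
proof (induction I)
  case empty
  have "f (0 \<odot> \<zero>) = 0 * f \<zero>" using f zero_closed unfolding linear_functional_def by blast
  then show ?case by simp
next
  case (insert i I)
  have S: "(\<Oplus>i\<in>I. c i \<odot> x i) \<in> carrier A" by (rule finsum_closed) (use insert in auto)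
  have "(\<Oplus>i\<in>insert i I. c i \<odot> x i) = c i \<odot> x i \<oplus> (\<Oplus>i\<in>I. c i \<odot> x i)"
    using insert by (intro finsum_insert) auto
  moreover have "f (c i \<odot> x i \<oplus> (\<Oplus>i\<in>I. c i \<odot> x i)) = f (c i \<odot> x i) + f (\<Oplus>i\<in>I. c i \<odot> x i)"
    using f S insert unfolding linear_functional_def by simp
  moreover have "f (c i \<odot> x i) = c i * f (x i)"
    using f insert unfolding linear_functional_def by simp
  ultimately show ?case using insert by simp
qed

lemma linear_functional_mult_left:
  assumes f: "linear_functional f C" and C: "C \<ge> 0" and b: "b \<in> carrier A" "cnorm A b \<le> M"
  shows "linear_functional (\<lambda>x. f (b \<otimes> x)) (C * M)"
  unfolding linear_functional_def
proof (intro conjI ballI allI)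
  fix x assume x: "x \<in> carrier A"
  show "f (b \<otimes> (x \<oplus> y)) = f (b \<otimes> x) + f (b \<otimes> y)" if "y \<in> carrier A" for y
    using f b x that by (simp add: linear_functional_def r_distr)
  show "f (b \<otimes> (c \<odot> x)) = c * f (b \<otimes> x)" for c
    using f b x by (simp add: linear_functional_def mult_scale_right)
  have "cmod (f (b \<otimes> x)) \<le> C * cnorm A (b \<otimes> x)" using f b x by (simp add: linear_functional_def)
  also have "\<dots> \<le> C * (cnorm A b * cnorm A x)" using C by (intro mult_left_mono norm_mult b x)
  also have "\<dots> \<le> C * (M * cnorm A x)" using C b norm_nonneg[OF x] by (intro mult_left_mono mult_right_mono) auto
  finally show "cmod (f (b \<otimes> x)) \<le> C * M * cnorm A x" by simp
qed

definition signed_sum :: "'i set \<Rightarrow> ('i \<Rightarrow> 'a) \<Rightarrow> ('i \<Rightarrow> real) \<Rightarrow> 'a" where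
  "signed_sum J a e = (\<Oplus>i\<in>J. complex_of_real (e i) \<odot> a i)"

lemma signed_sum_closed: "(\<And>i. i \<in> J \<Longrightarrow> a i \<in> carrier A) \<Longrightarrow> signed_sum J a e \<in> carrier A"
  unfolding signed_sum_def by (rule finsum_closed) auto

lemma star_signed_sum:
  assumes "finite J" "\<And>i. i \<in> J \<Longrightarrow> a i \<in> carrier A"
  shows "star A (signed_sum J a e) = signed_sum J (\<lambda>i. star A (a i)) e"
  using assms
proof (induction J)
  case empty
  have "star A \<zero> = 0 \<odot> star A \<zero>" using star_scale[of \<zero> 0] by simp
  then have "star A \<zero> = \<zero>" using star_closed[OF zero_closed] by simp
  then show ?case by (simp add: signed_sum_def)
next
  case (insert j J)
  have S: "signed_sum J a e \<in> carrier A" "signed_sum J (\<lambda>i. star A (a i)) e \<in> carrier A"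
    by (rule signed_sum_closed; use insert in auto)+
  have "signed_sum (insert j J) a e = complex_of_real (e j) \<odot> a j \<oplus> signed_sum J a e"
    unfolding signed_sum_def using insert by (intro finsum_insert) auto
  moreover have "signed_sum (insert j J) (\<lambda>i. star A (a i)) e
      = complex_of_real (e j) \<odot> star A (a j) \<oplus> signed_sum J (\<lambda>i. star A (a i)) e"
    unfolding signed_sum_def using insert by (intro finsum_insert) auto
  ultimately show ?case using S insert by (simp add: star_add star_scale)
qed

text \<open>The coefficients are values of \<open>f\<close> on words in the \<open>a i\<close> and
  their adjoints, and they are the same for all signs \<open>e\<close>. The leftmost letter is
  absorbed into the functional, so the induction has to vary \<open>f\<close> and its bound.\<close>

lemma alternating_power_expansion:
  assumes J: "finite J" and a: "\<And>i. i \<in> J \<Longrightarrow> a i \<in> carrier A" "\<And>i. i \<in> J \<Longrightarrow> cnorm A (a i) \<le> M"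
    and M: "M \<ge> 0" and f: "linear_functional f C" "C \<ge> 0"
  shows "\<exists>\<alpha>. (\<forall>w\<in>words J L. cmod (\<alpha> w) \<le> C * cnorm A \<one> * M ^ L) \<and>
    (\<forall>e. f (alternating_power (signed_sum J a e) L) =
      (\<Sum>w\<in>words J L. of_real (prod_list (map e w)) * \<alpha> w))"
  using f
proof (induction L arbitrary: f C)
  case 0
  have "cmod (f \<one>) \<le> C * cnorm A \<one>" using 0 by (simp add: linear_functional_def)
  then show ?case by (intro exI[of _ "\<lambda>_. f \<one>"]) (simp add: words_0)
next
  case (Suc L)
  define b where "b = (if even L then a else (\<lambda>i. star A (a i)))"
  have b: "b i \<in> carrier A" "cnorm A (b i) \<le> M" if "i \<in> J" for i
    using a that by (auto simp: b_def norm_star)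
  have "\<exists>\<alpha>. (\<forall>w\<in>words J L. cmod (\<alpha> w) \<le> C * M * cnorm A \<one> * M ^ L) \<and>
    (\<forall>e. f (b i \<otimes> alternating_power (signed_sum J a e) L) =
      (\<Sum>w\<in>words J L. of_real (prod_list (map e w)) * \<alpha> w))" if "i \<in> J" for i
    by (rule Suc.IH[OF linear_functional_mult_left[OF Suc.prems b[OF that]]]) (use Suc.prems M in simp)
  then have "\<forall>i. \<exists>\<alpha>. i \<in> J \<longrightarrow> (\<forall>w\<in>words J L. cmod (\<alpha> w) \<le> C * M * cnorm A \<one> * M ^ L) \<and>
    (\<forall>e. f (b i \<otimes> alternating_power (signed_sum J a e) L) =
      (\<Sum>w\<in>words J L. of_real (prod_list (map e w)) * \<alpha> w))" by blast
  then obtain \<alpha> where \<alpha>: "\<forall>i. i \<in> J \<longrightarrow> (\<forall>w\<in>words J L. cmod (\<alpha> i w) \<le> C * M * cnorm A \<one> * M ^ L) \<and>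
    (\<forall>e. f (b i \<otimes> alternating_power (signed_sum J a e) L) =
      (\<Sum>w\<in>words J L. of_real (prod_list (map e w)) * \<alpha> i w))"
    by (rule choice[THEN exE])
  show ?case
  proof (intro exI[of _ "\<lambda>w. \<alpha> (hd w) (tl w)"] conjI ballI allI)
    fix w assume "w \<in> words J (Suc L)"
    then obtain i v where "w = i # v" "i \<in> J" "v \<in> words J L" by (auto simp: words_def length_Suc_conv)
    then show "cmod (\<alpha> (hd w) (tl w)) \<le> C * cnorm A \<one> * M ^ Suc L" using \<alpha> by (simp add: mult_ac)
  next
    fix e
    let ?S = "signed_sum J a e" and ?W = "alternating_power (signed_sum J a e) L"
    have S: "?S \<in> carrier A" by (rule signed_sum_closed) (rule a(1))
    have W: "?W \<in> carrier A" using S by simp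
    have "alternating_power ?S (Suc L) = signed_sum J b e \<otimes> ?W"
      using star_signed_sum[OF J, of a e] a(1) by (simp add: b_def)
    also have "\<dots> = (\<Oplus>i\<in>J. complex_of_real (e i) \<odot> b i \<otimes> ?W)"
      unfolding signed_sum_def[of J b] by (rule finsum_ldistr[OF J W]) (use b in auto)
    also have "\<dots> = (\<Oplus>i\<in>J. complex_of_real (e i) \<odot> (b i \<otimes> ?W))"
      by (rule finsum_cong'[OF refl]) (use b W in \<open>auto simp: mult_scale_left\<close>)
    finally have "f (alternating_power ?S (Suc L)) = (\<Sum>i\<in>J. complex_of_real (e i) * f (b i \<otimes> ?W))"
      using linear_functional_finsum[OF Suc.prems(1) J, of "\<lambda>i. b i \<otimes> ?W"] b W by simp
    also have "\<dots> = (\<Sum>i\<in>J. \<Sum>w\<in>words J L. of_real (prod_list (map e (i # w))) * \<alpha> i w)"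
      by (rule sum.cong[OF refl]) (use \<alpha> in \<open>simp add: sum_distrib_left mult.assoc\<close>)
    finally show "f (alternating_power ?S (Suc L)) =
        (\<Sum>w\<in>words J (Suc L). of_real (prod_list (map e w)) * \<alpha> (hd w) (tl w))"
      by (simp add: sum_words_Suc)
  qed
qed

text \<open>A form of the fact that \<open>l\<^sub>1\<close> of dimension \<open>m\<close> embeds well only into matrix algebras of size
  exponential in \<open>m\<close>: average the \<open>2 L\<close>-th power of the norm over all signs.\<close>

lemma rank_bound_of_large_signed_sums:
  assumes rank: "has_rank A r" and ne: "\<one> \<noteq> \<zero>" and J: "finite J"
    and a: "\<And>i. i \<in> J \<Longrightarrow> a i \<in> carrier A" "\<And>i. i \<in> J \<Longrightarrow> cnorm A (a i) \<le> M" and M: "M \<ge> 0"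
    and lower: "\<And>e. e \<in> signs J \<Longrightarrow> b \<le> cnorm A (signed_sum J a e)" and b: "b \<ge> 0"
    and L: "L = 4 * 2 ^ j" "L \<le> card J"
  shows "b ^ (2 * L) \<le> real r ^ 4 * (M ^ (2 * L) * (24 * real L * real (card J)) ^ L)"
proof -
  obtain P :: "'a set" and \<omega> where P: "finite P" "card P \<le> r" and lin: "\<forall>p\<in>P. linear_functional (\<omega> p) 1"
    and bound: "\<forall>s\<in>carrier A. (cnorm A s)\<^sup>2 \<le> real (card P) * (\<Sum>p\<in>P. cmod (\<omega> p (star A s \<otimes> s)))"
    using norming_functionals_exist[OF rank ne] by (elim exE conjE)
  have one: "cnorm A \<one> = 1"
    using norm_projection[of \<one>] ne by (simp add: projection_def)
  let ?S = "signed_sum J a" and ?m = "card J"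
  let ?g = "\<lambda>p e. \<omega> p (alternating_power (?S e) L)"
  \<comment> \<open>One factor \<open>card P\<close> comes from the norming functionals, squaring
    makes it two, and Cauchy-Schwarz over \<open>P\<close> adds the third; the fourth arises later
    from summing the moments over \<open>P\<close>.\<close>
  have point: "b ^ (2 * L) \<le> real (card P) ^ 3 * (\<Sum>p\<in>P. (cmod (?g p e))\<^sup>2)" if e: "e \<in> signs J" for e
  proof -
    have S: "?S e \<in> carrier A" by (rule signed_sum_closed) (rule a(1))
    define h where "h = star A (?S e) \<otimes> ?S e"
    have h: "h \<in> carrier A" "star A h = h" using S by (simp_all add: h_def star_mult)
    \<comment> \<open>The norming bound is quadratic in \<open>s\<close>, and \<open>h\<close>
      itself contains two factors; thus \<open>star A s \<otimes> s\<close> has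
      \<open>4 * 2 ^ j = L\<close> alternating factors.\<close>
    define s where "s = h [^] (2 ^ j :: nat)"
    have s: "s \<in> carrier A" "star A s = s" using h star_nat_pow[OF h] by (simp_all add: s_def)
    have "cnorm A s = (cnorm A (?S e)) ^ (2 * 2 ^ j)"
      unfolding s_def norm_nat_pow_two_power[OF h] unfolding h_def norm_star_mult[OF S] by (simp add: power_mult)
    then have n: "(cnorm A s)\<^sup>2 = (cnorm A (?S e)) ^ L" by (simp add: L power_mult[symmetric] mult.commute)
    have "star A s \<otimes> s = h [^] (2 ^ j + 2 ^ j :: nat)"
      unfolding s(2) unfolding s_def by (rule nat_pow_mult[OF h(1)])
    also have "\<dots> = alternating_power (?S e) L"
    proof -
      have "2 * (2 ^ j + 2 ^ j) = L" by (simp add: L)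
      then show ?thesis using alternating_power_even[OF S, of "2 ^ j + 2 ^ j"] by (simp only: h_def)
    qed
    finally have ss: "star A s \<otimes> s = alternating_power (?S e) L" .
    have "(cnorm A (?S e)) ^ L \<le> real (card P) * (\<Sum>p\<in>P. cmod (?g p e))"
      using bound[rule_format, OF s(1)] unfolding n ss .
    moreover have "b ^ L \<le> (cnorm A (?S e)) ^ L" using lower[OF e] b by (rule power_mono)
    ultimately have "b ^ L \<le> real (card P) * (\<Sum>p\<in>P. cmod (?g p e))" by linarith
    then have "(b ^ L)\<^sup>2 \<le> (real (card P) * (\<Sum>p\<in>P. cmod (?g p e)))\<^sup>2" using b by (intro power_mono) auto
    also have "\<dots> = (real (card P))\<^sup>2 * (\<Sum>p\<in>P. 1 * cmod (?g p e))\<^sup>2" by (simp add: power_mult_distrib)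
    also have "\<dots> \<le> (real (card P))\<^sup>2 * ((\<Sum>p\<in>P. 1\<^sup>2) * (\<Sum>p\<in>P. (cmod (?g p e))\<^sup>2))"
      by (intro mult_left_mono Cauchy_Schwarz_ineq_sum) simp
    also have "\<dots> = real (card P) ^ 3 * (\<Sum>p\<in>P. (cmod (?g p e))\<^sup>2)"
      by (simp add: power2_eq_square power3_eq_cube mult.assoc)
    also have "(b ^ L)\<^sup>2 = b ^ (2 * L)" by (simp add: power_mult[symmetric] mult.commute)
    finally show ?thesis .
  qed
  have L1: "1 \<le> L" using L by simp
  have moment: "(\<Sum>e\<in>signs J. (cmod (?g p e))\<^sup>2) \<le> (M ^ L)\<^sup>2 * (2 ^ ?m * (24 * real L * real ?m) ^ L)" if p: "p \<in> P" for p
  proof -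
    have "\<exists>\<alpha>. (\<forall>w\<in>words J L. cmod (\<alpha> w) \<le> 1 * cnorm A \<one> * M ^ L) \<and>
      (\<forall>e. \<omega> p (alternating_power (?S e) L) = (\<Sum>w\<in>words J L. of_real (prod_list (map e w)) * \<alpha> w))"
      by (rule alternating_power_expansion[OF J _ _ M lin[rule_format, OF p]]) (use a in auto)
    then obtain \<alpha> where \<alpha>: "\<forall>w\<in>words J L. cmod (\<alpha> w) \<le> 1 * cnorm A \<one> * M ^ L"
      and eq: "\<forall>e. \<omega> p (alternating_power (?S e) L) = (\<Sum>w\<in>words J L. of_real (prod_list (map e w)) * \<alpha> w)"
      by (elim exE conjE)
    have "(\<Sum>e\<in>signs J. (cmod (?g p e))\<^sup>2) \<le> (M ^ L)\<^sup>2 * (\<Sum>e\<in>signs J. (\<Sum>i\<in>J. e i) ^ (2 * L))"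
      unfolding eq[rule_format] by (rule second_moment_le[OF J]) (use \<alpha> one in simp)
    also have "\<dots> \<le> (M ^ L)\<^sup>2 * (2 ^ ?m * (24 * real L * real ?m) ^ L)"
      by (intro mult_left_mono rademacher_moment_le J L1 L) simp
    finally show ?thesis .
  qed
  have "2 ^ ?m * b ^ (2 * L) = (\<Sum>e\<in>signs J. b ^ (2 * L))" by (simp add: card_signs[OF J])
  also have "\<dots> \<le> (\<Sum>e\<in>signs J. real (card P) ^ 3 * (\<Sum>p\<in>P. (cmod (?g p e))\<^sup>2))"
    by (rule sum_mono) (rule point)
  also have "\<dots> = real (card P) ^ 3 * (\<Sum>p\<in>P. \<Sum>e\<in>signs J. (cmod (?g p e))\<^sup>2)"
    by (simp only: sum_distrib_left[symmetric] sum.swap[of _ "signs J" P])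
  also have "\<dots> \<le> real (card P) ^ 3 * (\<Sum>p\<in>P. (M ^ L)\<^sup>2 * (2 ^ ?m * (24 * real L * real ?m) ^ L))"
    by (intro mult_left_mono sum_mono moment) auto
  also have "\<dots> = 2 ^ ?m * (real (card P) ^ 4 * (M ^ (2 * L) * (24 * real L * real ?m) ^ L))"
    by (simp add: power_mult[symmetric] mult.commute[of 2 L] power4_eq_xxxx power3_eq_cube mult_ac)
  finally have "b ^ (2 * L) \<le> real (card P) ^ 4 * (M ^ (2 * L) * (24 * real L * real ?m) ^ L)" by simp
  also have "\<dots> \<le> real r ^ 4 * (M ^ (2 * L) * (24 * real L * real ?m) ^ L)"
    using P M by (intro mult_right_mono power_mono) auto
  finally show ?thesis .
qed

end


section \<open>Entropy of orbits\<close>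

definition orbit_set :: "('x \<Rightarrow> 'x) \<Rightarrow> ('x \<Rightarrow> complex) \<Rightarrow> nat \<Rightarrow> ('x \<Rightarrow> complex) set" where
  "orbit_set T f n = (\<Union>k<n. (induced_automorphism T ^^ k) ` {f})"

lemma funpow_induced_automorphism: "(induced_automorphism T ^^ k) f = f \<circ> (T ^^ k)"
proof (induction k)
  case (Suc k)
  have "(induced_automorphism T ^^ Suc k) f = f \<circ> ((T ^^ k) \<circ> T)"
    by (simp add: Suc induced_automorphism_def fun_eq_iff)
  then show ?case by (simp only: funpow_Suc_right[of k T])
qed simp

lemma orbit_set_eq: "orbit_set T f n = (\<lambda>k. f \<circ> (T ^^ k)) ` {..<n}"
  by (auto simp: orbit_set_def funpow_induced_automorphism)

lemma continuous_on_funpow: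
  assumes "continuous_on UNIV (T :: 'x::topological_space \<Rightarrow> 'x)"
  shows "continuous_on UNIV (T ^^ k)"
proof (induction k)
  case (Suc k)
  show ?case unfolding funpow.simps
    by (rule continuous_on_compose[OF Suc continuous_on_subset[OF assms]]) simp
qed (simp add: continuous_on_id id_def)

lemma continuous_on_orbit:
  assumes "continuous_on UNIV (T :: 'x::topological_space \<Rightarrow> 'x)" "continuous_on UNIV f"
  shows "continuous_on UNIV (f \<circ> (T ^^ k))"
  by (rule continuous_on_compose[OF continuous_on_funpow[OF assms(1)] continuous_on_subset[OF assms(2)]]) simp

text \<open>On a member of the iterated cover each \<open>f \<circ> (T ^^ k)\<close> with
  \<open>k < n\<close> sees only values of \<open>f\<close> on a single member of
  \<open>\<W>\<close>.\<close>

lemma rcp_ranks_orbit_le_cover_number: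
  fixes \<pi> :: "('x::metric_space \<Rightarrow> complex) \<Rightarrow> 'h::chilbert_space \<Rightarrow> 'h"
  assumes X: "compact (UNIV :: 'x set)" and T: "continuous_on UNIV T"
    and rep: "faithful_representation continuous_functions \<pi>" and f: "continuous_on UNIV f"
    and W: "finite \<W>" "\<Union>\<W> = UNIV" "\<And>W. W \<in> \<W> \<Longrightarrow> open W"
    and osc: "\<And>W x y. W \<in> \<W> \<Longrightarrow> x \<in> W \<Longrightarrow> y \<in> W \<Longrightarrow> cmod (f x - f y) \<le> \<epsilon>" and \<epsilon>: "\<epsilon> < \<delta>"
  shows "\<exists>r\<in>rcp_ranks continuous_functions \<pi> (orbit_set T f n) \<delta>. r \<le> cover_number (cover_iterate T \<W> n)"
proof -
  obtain \<V> where V: "\<V> \<subseteq> cover_iterate T \<W> n" "finite \<V>" "\<Union>\<V> = UNIV"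
      "card \<V> = cover_number (cover_iterate T \<W> n)"
    by (rule cover_number_attained[OF finite_cover_iterate[OF W(1)] Union_cover_iterate[OF W(2)]])
  have form: "\<exists>u. V = (\<Inter>k<n. (T ^^ k) -` u k) \<and> (\<forall>k<n. u k \<in> \<W>)" if "V \<in> \<V>" for V
    using V(1) that unfolding cover_iterate_eq by blast
  have "\<exists>r\<in>rcp_ranks continuous_functions \<pi> (orbit_set T f n) \<delta>. r \<le> card \<V>"
  proof (rule rcp_ranks_le_card_cover[OF X rep V(2) _ V(3) _ _ \<epsilon>])
    show "open V" if "V \<in> \<V>" for V
    proof -
      from form[OF that] obtain u where u: "V = (\<Inter>k<n. (T ^^ k) -` u k)" "\<forall>k<n. u k \<in> \<W>" by blast
      have "open ((T ^^ k) -` u k)" if "k < n" for k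
        using u(2) W(3) that by (intro open_vimage continuous_on_funpow[OF T]) auto
      then show ?thesis unfolding u(1) by (intro open_INT) auto
    qed
    show "continuous_on UNIV g" if "g \<in> orbit_set T f n" for g
      using that continuous_on_orbit[OF T f] by (auto simp: orbit_set_eq)
    fix g V x y assume g: "g \<in> orbit_set T f n" and V': "V \<in> \<V>" "x \<in> V" "y \<in> V"
    obtain k where k: "k < n" "g = f \<circ> (T ^^ k)" using g by (auto simp: orbit_set_eq)
    obtain u where u: "V = (\<Inter>k<n. (T ^^ k) -` u k)" "\<forall>k<n. u k \<in> \<W>" using form[OF V'(1)] by blast
    have "(T ^^ k) x \<in> u k" "(T ^^ k) y \<in> u k" using V' u(1) k(1) by auto
    then show "cmod (g x - g y) \<le> \<epsilon>" using osc[of "u k"] u(2) k by simp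
  qed
  then show ?thesis using V(4) by simp
qed

lemma finite_net_of_range:
  fixes f :: "'x::topological_space \<Rightarrow> complex"
  assumes X: "compact (UNIV :: 'x set)" and f: "continuous_on UNIV f" and e: "e > 0"
  obtains C where "finite C" "\<And>x. \<exists>c\<in>C. dist (f x) c < e"
proof -
  have "compact (range f)" by (rule compact_continuous_image[OF f X])
  then have "\<exists>C. C \<subseteq> range f \<and> finite C \<and> range f \<subseteq> (\<Union>c\<in>C. ball c e)"
    by (rule compactE_image[of _ "range f" "\<lambda>c. ball c e"]) (use e in auto)
  then obtain C where C: "finite C" "range f \<subseteq> (\<Union>c\<in>C. ball c e)" by blast
  have "\<exists>c\<in>C. dist (f x) c < e" for x
  proof -
    have "f x \<in> (\<Union>c\<in>C. ball c e)" using C(2) by blast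
    then show ?thesis by (auto simp: dist_commute)
  qed
  with C(1) show ?thesis by (rule that)
qed

lemma ht_nonneg: "ht A \<pi> \<alpha> \<Omega> \<ge> 0"
proof -
  \<comment> \<open>For \<open>m = 0\<close> the logarithm is 0 by convention.\<close>
  have "0 \<le> ln (real m) / real n" for m n by (cases "m = 0") auto
  then have "0 \<le> limsup (\<lambda>n. ereal (ln (real (rcp A \<pi> (\<Union>k<n. (\<alpha> ^^ k) ` \<Omega>) 1)) / real n))"
    by (intro le_Limsup) (auto simp: eventually_sequentially)
  also have "\<dots> \<le> ht A \<pi> \<alpha> \<Omega>" unfolding ht_def by (rule SUP_upper) simp
  finally show ?thesis .
qed

lemma ht_zero_if_constant_on_entropy_pairs:
  fixes T :: "'x::metric_space \<Rightarrow> 'x"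
    and \<pi> :: "('x \<Rightarrow> complex) \<Rightarrow> 'h::chilbert_space \<Rightarrow> 'h"
  assumes X: "compact (UNIV :: 'x set)" and T: "continuous_on UNIV T"
    and rep: "faithful_representation continuous_functions \<pi>" and f: "continuous_on UNIV f"
    and const: "\<And>x y. entropy_pair T x y \<Longrightarrow> f x = f y"
  shows "ht continuous_functions \<pi> (induced_automorphism T) {f} = 0"
proof (rule antisym[OF _ ht_nonneg])
  show "ht continuous_functions \<pi> (induced_automorphism T) {f} \<le> 0"
    unfolding ht_def orbit_set_def[symmetric]
  proof (rule SUP_least)
    fix \<delta> :: real assume "\<delta> \<in> {0<..}"
    then have \<delta>: "\<delta> > 0" by simp
    \<comment> \<open>The net radius matches the radius of the sets \<open>F c\<close>, so these
      cover the space. Two values of \<open>f\<close> on \<open>- G c\<close> differ by at most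
      \<open>\<delta> / 2\<close>, which leaves the strict inequality that the approximation
      needs.\<close>
    obtain C where C: "finite C" "\<And>x. \<exists>c\<in>C. dist (f x) c < \<delta> / 8"
      using finite_net_of_range[OF X f, of "\<delta> / 8"] \<delta> by auto
    define F where "F c = {x. dist (f x) c \<le> \<delta> / 8}" for c
    define G where "G c = {x. dist (f x) c \<ge> \<delta> / 4}" for c
    have clF: "closed (F c)" and clG: "closed (G c)" for c
      unfolding F_def G_def by (intro closed_Collect_le continuous_intros f)+
    have disj: "F c \<inter> G c = {}" for c using \<delta> by (auto simp: F_def G_def)
    have h0: "h_top T {- F c, - G c} = 0" for c
    proof (rule ccontr)
      assume "h_top T {- F c, - G c} \<noteq> 0"
      moreover have "h_top T {- F c, - G c} \<ge> 0" by (rule h_top_nonneg) (use disj in auto)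
      ultimately have "h_top T {- F c, - G c} > 0" by simp
      then obtain x y where xy: "x \<in> F c" "y \<in> G c" "entropy_pair T x y"
        by (rule entropy_pair_exists[OF X clF clG disj])
      then have "f x = f y" using const by blast
      then show False using xy disj by (auto simp: F_def G_def)
    qed
    define \<W> where "\<W> = (\<lambda>c. - G c) ` C"
    have C0: "C \<noteq> {}" using C(2) by blast
    have W: "finite \<W>" "\<Union>\<W> = UNIV" "\<And>W. W \<in> \<W> \<Longrightarrow> open W"
    proof -
      show "finite \<W>" using C by (simp add: \<W>_def)
      show "open W" if "W \<in> \<W>" for W using that clG by (auto simp: \<W>_def)
      have "x \<in> \<Union>\<W>" for x
      proof -
        obtain c where c: "c \<in> C" "dist (f x) c < \<delta> / 8" using C(2) by blast
        then have "x \<in> - G c" using \<delta> by (simp add: G_def)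
        then show ?thesis using c(1) by (auto simp: \<W>_def)
      qed
      then show "\<Union>\<W> = UNIV" by blast
    qed
    \<comment> \<open>A choice from the covers either uses some \<open>- G c\<close>, a member of
      \<open>\<W>\<close>, or consists of the \<open>- F c\<close> only and has empty
      intersection.\<close>
    have "h_top T \<W> \<le> (\<Sum>c\<in>C. h_top T {- F c, - G c})"
    proof (rule h_top_le_sum[OF C(1) _ _ _ W(1,2)])
      fix u assume u: "\<And>c. c \<in> C \<Longrightarrow> u c \<in> {- F c, - G c}"
      show "\<exists>W\<in>\<W>. (\<Inter>c\<in>C. u c) \<subseteq> W"
      proof (cases "\<exists>c\<in>C. u c = - G c")
        case True
        then show ?thesis by (auto simp: \<W>_def)
      next
        case False
        have "x \<notin> (\<Inter>c\<in>C. u c)" for x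
        proof -
          obtain c where c: "c \<in> C" "dist (f x) c < \<delta> / 8" using C(2) by blast
          then have "u c = - F c" using u False by blast
          then have "x \<notin> u c" using c by (simp add: F_def)
          then show ?thesis using c(1) by blast
        qed
        then have "(\<Inter>c\<in>C. u c) = {}" by blast
        moreover obtain W where "W \<in> \<W>" using C0 by (auto simp: \<W>_def)
        ultimately show ?thesis by blast
      qed
    qed (use disj in auto)
    then have "h_top T \<W> = 0" using h_top_nonneg[OF W(1,2), of T] by (simp add: h0)
    then have lim: "(\<lambda>n. ln (real (cover_number (cover_iterate T \<W> n))) / real n) \<longlonglongrightarrow> 0"
      using h_top_limit[OF W(1,2), of T] by simp
    have le: "ln (real (rcp continuous_functions \<pi> (orbit_set T f n) \<delta>)) / real n
        \<le> ln (real (cover_number (cover_iterate T \<W> n))) / real n" for n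
    proof -
      have "\<exists>r\<in>rcp_ranks continuous_functions \<pi> (orbit_set T f n) \<delta>. r \<le> cover_number (cover_iterate T \<W> n)"
      proof (rule rcp_ranks_orbit_le_cover_number[OF X T rep f W, of "\<delta> / 2"])
        fix W x y assume "W \<in> \<W>" "x \<in> W" "y \<in> W"
        then obtain c where "x \<in> - G c" "y \<in> - G c" unfolding \<W>_def by blast
        then have "dist (f x) c < \<delta> / 4" "dist (f y) c < \<delta> / 4" by (simp_all add: G_def)
        then have "dist (f x) (f y) \<le> \<delta> / 2" using dist_triangle2[of "f x" "f y" c] by simp
        then show "cmod (f x - f y) \<le> \<delta> / 2" by (simp add: dist_norm)
      qed (use \<delta> in auto)
      then obtain r where "r \<in> rcp_ranks continuous_functions \<pi> (orbit_set T f n) \<delta>"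
        "r \<le> cover_number (cover_iterate T \<W> n)" by blast
      then have "rcp continuous_functions \<pi> (orbit_set T f n) \<delta> \<le> cover_number (cover_iterate T \<W> n)"
        unfolding rcp_eq_Inf by (meson cInf_lower bdd_below_bot order_trans)
      moreover have "cover_number (cover_iterate T \<W> n) \<ge> 1"
        by (intro cover_number_pos finite_cover_iterate Union_cover_iterate W)
      ultimately show ?thesis
        by (cases "rcp continuous_functions \<pi> (orbit_set T f n) \<delta> = 0") (auto intro!: divide_right_mono ln_mono)
    qed
    have "limsup (\<lambda>n. ereal (ln (real (rcp continuous_functions \<pi> (orbit_set T f n) \<delta>)) / real n))
        \<le> limsup (\<lambda>n. ereal (ln (real (cover_number (cover_iterate T \<W> n))) / real n))"
      by (intro Limsup_mono always_eventually allI) (simp add: le)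
    also have "\<dots> = ereal 0"
      by (rule lim_imp_Limsup) (use lim in simp_all)
    finally show "limsup (\<lambda>n. ereal (ln (real (rcp continuous_functions \<pi> (orbit_set T f n) \<delta>)) / real n)) \<le> 0"
      by (simp add: zero_ereal_def)
  qed
qed

section \<open>The lower bound along an entropy pair\<close>

text \<open>The admissible exponents \<open>4 * 2 ^ j\<close> approximate any prescribed length
  within a factor of 2.\<close>

lemma power_of_two_near:
  fixes y :: real
  assumes "y \<ge> 4"
  obtains j where "4 * 2 ^ j \<le> y" "y < 8 * 2 ^ j"
proof -
  have "\<exists>j. y < 4 * 2 ^ j"
  proof -
    obtain j where "y < 2 ^ j" using real_arch_pow[of 2 y] by auto
    then have "y < 4 * 2 ^ j" using assms by linarith
    then show ?thesis by blast
  qed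
  then have l: "y < 4 * 2 ^ (LEAST j. y < 4 * 2 ^ j)" by (rule LeastI_ex)
  obtain i where i: "(LEAST j. y < 4 * 2 ^ j) = Suc i"
    using l assms by (cases "LEAST j. y < 4 * 2 ^ j") auto
  then have "\<not> y < 4 * 2 ^ i" using not_less_Least[of i "\<lambda>j. y < 4 * 2 ^ j"] by simp
  then show ?thesis using l i by (intro that[of i]) auto
qed

text \<open>A finite-dimensional algebra through which the functions \<open>g i\<close> factor approximately inherits
  their lower bound on signed sums.\<close>

lemma rcp_ranks_lower_bound:
  fixes \<pi> :: "('x::metric_space \<Rightarrow> complex) \<Rightarrow> 'h::chilbert_space \<Rightarrow> 'h"
  assumes X: "compact (UNIV :: 'x set)" and rep: "faithful_representation continuous_functions \<pi>"
    and r: "r \<in> rcp_ranks continuous_functions \<pi> \<Omega> \<delta>"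
    and J: "finite J" and g: "\<And>i. i \<in> J \<Longrightarrow> continuous_on UNIV (g i)" "\<And>i. i \<in> J \<Longrightarrow> g i \<in> \<Omega>"
      "\<And>i x. i \<in> J \<Longrightarrow> cmod (g i x) \<le> M" and M: "M \<ge> 0"
    and big: "\<And>e. e \<in> signs J \<Longrightarrow> \<exists>x. cmod (\<Sum>i\<in>J. of_real (e i) * g i x) \<ge> (\<delta> + l) * card J"
    and l: "l \<ge> 0" and L: "L = 4 * 2 ^ j" "L \<le> card J"
  shows "(l * card J) ^ (2 * L) \<le> real r ^ 4 * (M ^ (2 * L) * (24 * real L * real (card J)) ^ L)"
proof -
  interpret function_representation \<pi> by (rule function_representation.intro[OF rep])
  let ?C = "continuous_functions :: ('x \<Rightarrow> complex) cstar"
  obtain B :: "(nat \<Rightarrow> complex) cstar" and \<phi> \<psi> where B: "cstar_algebra B" and ne: "\<one>\<^bsub>B\<^esub> \<noteq> \<zero>\<^bsub>B\<^esub>"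
    and \<phi>: "contractive_cp ?C B \<phi>" and \<psi>: "contractive_cp B operator_algebra \<psi>"
    and ap: "\<forall>x\<in>\<Omega>. onorm (\<lambda>h. \<psi> (\<phi> x) h - \<pi> x h) < \<delta>" and rank: "has_rank B r"
    using r unfolding rcp_ranks_def by blast
  interpret B: unital_cstar B
    by (intro unital_cstar.intro unital_cstar_axioms.intro cstar_algebra.axioms(1)[OF B] B)
  have carC: "carrier ?C = {f. continuous_on UNIV f}" by (simp add: continuous_functions_def)
  have \<phi>c: "\<phi> f \<in> carrier B" if "continuous_on UNIV f" for f
    using \<phi> that by (auto simp: contractive_cp_def carC)
  have \<psi>c: "\<psi> b \<in> bounded_operators" if "b \<in> carrier B" for b
    using \<psi> that by (auto simp: contractive_cp_def operator_algebra_def)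
  have sum_eq: "\<phi> (\<lambda>x. \<Sum>i\<in>I. of_real (e i) * g i x) = B.signed_sum I (\<lambda>i. \<phi> (g i)) e \<and>
      \<psi> (B.signed_sum I (\<lambda>i. \<phi> (g i)) e) = (\<lambda>h. \<Sum>i\<in>I. scaleC (of_real (e i)) (\<psi> (\<phi> (g i)) h))"
    if "finite I" "I \<subseteq> J" for I e
    using that
  proof (induction I)
    case empty
    have z: "continuous_on UNIV (\<lambda>x::'x. 0 :: complex)" by simp
    have "\<phi> (0 \<odot>\<^bsub>?C\<^esub> (\<lambda>x. 0)) = 0 \<odot>\<^bsub>B\<^esub> \<phi> (\<lambda>x. 0)"
      using \<phi> z unfolding contractive_cp_def carC by blast
    then have 1: "\<phi> (\<lambda>x. 0) = \<zero>\<^bsub>B\<^esub>" using \<phi>c[OF z] by (simp add: continuous_functions_def)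
    have "\<psi> (0 \<odot>\<^bsub>B\<^esub> \<zero>\<^bsub>B\<^esub>) = 0 \<odot>\<^bsub>operator_algebra\<^esub> \<psi> \<zero>\<^bsub>B\<^esub>"
      using \<psi> B.zero_closed unfolding contractive_cp_def by blast
    moreover have "scaleC 0 (x :: 'h) = 0" for x using scaleC_of_real[of 0 x] by simp
    ultimately have "\<psi> \<zero>\<^bsub>B\<^esub> = (\<lambda>h. 0)" by (simp add: operator_algebra_def)
    then show ?case using 1 by (simp add: B.signed_sum_def)
  next
    case (insert i I)
    let ?s = "\<lambda>I. B.signed_sum I (\<lambda>i. \<phi> (g i)) e"
    have gi: "continuous_on UNIV (g i)" using g insert by simp
    have cI: "continuous_on UNIV (\<lambda>x. \<Sum>i\<in>I. of_real (e i) * g i x)"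
      by (intro continuous_intros g) (use insert in auto)
    have cs: "continuous_on UNIV (\<lambda>x. of_real (e i) * g i x)" by (intro continuous_intros gi)
    have sI: "?s I \<in> carrier B" by (rule B.signed_sum_closed) (use g insert \<phi>c in auto)
    have si: "of_real (e i) \<odot>\<^bsub>B\<^esub> \<phi> (g i) \<in> carrier B" using \<phi>c[OF gi] by simp
    have s: "?s (insert i I) = of_real (e i) \<odot>\<^bsub>B\<^esub> \<phi> (g i) \<oplus>\<^bsub>B\<^esub> ?s I"
      unfolding B.signed_sum_def using insert g \<phi>c by (intro B.finsum_insert) auto
    have "\<phi> ((of_real (e i) \<odot>\<^bsub>?C\<^esub> g i) \<oplus>\<^bsub>?C\<^esub> (\<lambda>x. \<Sum>i\<in>I. of_real (e i) * g i x))
        = \<phi> (of_real (e i) \<odot>\<^bsub>?C\<^esub> g i) \<oplus>\<^bsub>B\<^esub> \<phi> (\<lambda>x. \<Sum>i\<in>I. of_real (e i) * g i x)"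
      using \<phi> cs cI unfolding contractive_cp_def carC by (simp add: continuous_functions_def)
    moreover have "\<phi> (of_real (e i) \<odot>\<^bsub>?C\<^esub> g i) = of_real (e i) \<odot>\<^bsub>B\<^esub> \<phi> (g i)"
      using \<phi> gi unfolding contractive_cp_def carC by blast
    ultimately have 1: "\<phi> (\<lambda>x. \<Sum>i\<in>insert i I. of_real (e i) * g i x) = ?s (insert i I)"
      using insert s by (simp add: continuous_functions_def)
    have "\<psi> (?s (insert i I)) = \<psi> (of_real (e i) \<odot>\<^bsub>B\<^esub> \<phi> (g i)) \<oplus>\<^bsub>operator_algebra\<^esub> \<psi> (?s I)"
      unfolding s using \<psi> sI si unfolding contractive_cp_def by blast
    moreover have "\<psi> (of_real (e i) \<odot>\<^bsub>B\<^esub> \<phi> (g i)) = of_real (e i) \<odot>\<^bsub>operator_algebra\<^esub> \<psi> (\<phi> (g i))"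
      using \<psi> \<phi>c[OF gi] unfolding contractive_cp_def by blast
    ultimately have "\<psi> (?s (insert i I)) = (\<lambda>h. \<Sum>i\<in>insert i I. scaleC (of_real (e i)) (\<psi> (\<phi> (g i)) h))"
      using insert by (simp add: operator_algebra_def)
    with 1 show ?case by blast
  qed
  have lower: "l * card J \<le> cnorm B (B.signed_sum J (\<lambda>i. \<phi> (g i)) e)" if e: "e \<in> signs J" for e
  proof -
    let ?s = "B.signed_sum J (\<lambda>i. \<phi> (g i)) e"
    define G where "G = (\<lambda>x. \<Sum>i\<in>J. of_real (e i) * g i x)"
    have cG: "continuous_on UNIV G" unfolding G_def by (intro continuous_intros g) auto
    have sB: "?s \<in> carrier B" by (rule B.signed_sum_closed) (use g \<phi>c in auto)
    define D where "D i = (\<lambda>h. \<psi> (\<phi> (g i)) h - \<pi> (g i) h)" for i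
    have blD: "bounded_linear (D i)" if "i \<in> J" for i
      unfolding D_def using \<psi>c[OF \<phi>c[OF g(1)[OF that]]] bounded_linear[OF g(1)[OF that]]
      by (intro bounded_linear_sub) (auto simp: bounded_operators_def)
    have bls: "bounded_linear (\<psi> ?s)" using \<psi>c[OF sB] by (simp add: bounded_operators_def)
    \<comment> \<open>Every summand is reproduced up to \<open>\<delta>\<close> and the signs have
      modulus 1, so the signed sum is off by at most \<open>\<delta> * card J\<close>. As
      \<open>\<psi>\<close> is contractive, the rest of its norm is already present in
      \<open>B\<close>.\<close>
    have "onorm (\<pi> G) \<le> onorm (\<psi> ?s) + \<delta> * card J"
    proof (rule onorm_bound)
      \<comment> \<open>The sign of \<open>\<delta>\<close> is read off from the approximation once
        \<open>J\<close> has an element; for empty \<open>J\<close> the error term vanishes.\<close>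
      have "0 \<le> \<delta>" if "J \<noteq> {}"
      proof -
        from that obtain i where i: "i \<in> J" by blast
        then have "onorm (D i) < \<delta>" unfolding D_def using ap g by blast
        then show ?thesis using onorm_pos_le[OF blD[OF i]] by linarith
      qed
      then have "0 \<le> \<delta> * card J" by (cases "J = {}") auto
      then show "0 \<le> onorm (\<psi> ?s) + \<delta> * card J" using onorm_pos_le[OF bls] by simp
      fix h
      have "\<pi> G h = (\<Sum>i\<in>J. \<pi> (\<lambda>x. of_real (e i) * g i x) h)"
        unfolding G_def by (rule sum[OF J]) (intro continuous_intros g)
      also have "\<dots> = (\<Sum>i\<in>J. e i *\<^sub>R \<pi> (g i) h)"
        by (intro sum.cong refl) (simp add: smult g scaleC_of_real)
      also have "\<dots> = \<psi> ?s h - (\<Sum>i\<in>J. e i *\<^sub>R D i h)"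
        using sum_eq[OF J order_refl, of e]
        by (simp add: D_def scaleC_of_real scaleR_diff_right sum_subtractf)
      finally have "norm (\<pi> G h) \<le> norm (\<psi> ?s h) + norm (\<Sum>i\<in>J. e i *\<^sub>R D i h)"
        by (simp add: norm_triangle_ineq4)
      also have "norm (\<Sum>i\<in>J. e i *\<^sub>R D i h) \<le> (\<Sum>i\<in>J. \<delta> * norm h)"
      proof (rule sum_norm_le)
        fix i assume i: "i \<in> J"
        have "\<bar>e i\<bar> = 1" using e i by (auto simp: signs_def dest: PiE_mem)
        then have "norm (e i *\<^sub>R D i h) \<le> onorm (D i) * norm h" using onorm[OF blD[OF i]] by simp
        also have "\<dots> \<le> \<delta> * norm h"
        proof (rule mult_right_mono)
          show "onorm (D i) \<le> \<delta>"
            unfolding D_def by (rule less_imp_le, rule bspec[OF ap], rule g(2)[OF i])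
        qed simp
        finally show "norm (e i *\<^sub>R D i h) \<le> \<delta> * norm h" .
      qed
      also have "norm (\<psi> ?s h) \<le> onorm (\<psi> ?s) * norm h" by (rule onorm[OF bls])
      finally show "norm (\<pi> G h) \<le> (onorm (\<psi> ?s) + \<delta> * card J) * norm h"
        by (simp add: algebra_simps)
    qed
    moreover have "onorm (\<psi> ?s) \<le> cnorm B ?s"
      using \<psi> sB unfolding contractive_cp_def by (simp add: operator_algebra_def)
    moreover obtain x where "cmod (G x) \<ge> (\<delta> + l) * card J" using big[OF e] unfolding G_def by blast
    moreover have "cmod (G x) \<le> onorm (\<pi> G)" by (rule onorm_ge[OF cG])
    ultimately show ?thesis by (simp add: algebra_simps)
  qed
  show ?thesis
  proof (rule B.rank_bound_of_large_signed_sums[OF rank ne J _ _ M lower _ L])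
    fix i assume i: "i \<in> J"
    show "\<phi> (g i) \<in> carrier B" by (rule \<phi>c[OF g(1)[OF i]])
    have "cnorm B (\<phi> (g i)) \<le> cnorm ?C (g i)"
      using \<phi> g(1)[OF i] unfolding contractive_cp_def carC by blast
    also have "\<dots> \<le> M" by (rule cnorm_continuous_functions_le[OF g(3)[OF i]])
    finally show "cnorm B (\<phi> (g i)) \<le> M" .
  qed (use l in auto)
qed

text \<open>Two points \<open>z\<close> and \<open>z'\<close> realising opposite patterns are
  compared: in the difference of the two signed sums every term contributes at least a third of the
  distance in the direction of \<open>a - b\<close>. One of the two sums therefore reaches half of
  that.\<close>

lemma large_signed_sum:
  fixes f :: "'x \<Rightarrow> complex"
  assumes J: "finite J" and e: "e \<in> signs J" and ne: "a \<noteq> b"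
    and sh: "\<And>\<sigma>. \<exists>z. \<forall>i\<in>J. if \<sigma> i then dist (g i z) a \<le> dist a b / 3 else dist (g i z) b \<le> dist a b / 3"
  shows "\<exists>z. cmod (\<Sum>i\<in>J. of_real (e i) * g i z) \<ge> dist a b / 6 * card J"
proof -
  define d where "d = dist a b"
  have d: "d > 0" "cmod (a - b) = d" using ne by (auto simp: d_def dist_norm)
  \<comment> \<open>The rotation that turns \<open>a - b\<close> into the positive real number
    \<open>d\<close>, so that real parts add up without cancellation.\<close>
  define u where "u = cnj (a - b) / of_real d"
  have u1: "cmod u = 1" unfolding u_def using d by (simp add: norm_divide del: complex_cnj_diff)
  have uab: "u * (a - b) = of_real d"
  proof -
    have "u * (a - b) = (a - b) * cnj (a - b) / of_real d" by (simp add: u_def)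
    also have "(a - b) * cnj (a - b) = (of_real d)\<^sup>2" using complex_norm_square[of "a - b"] d by simp
    finally show ?thesis using d by (simp add: power2_eq_square)
  qed
  have key: "Re (u * (p - q)) \<ge> d / 3" if "dist p a \<le> d / 3" "dist q b \<le> d / 3" for p q
  proof -
    have "u * (p - q) = of_real d + u * (p - a) - u * (q - b)"
      unfolding uab[symmetric] by (simp add: algebra_simps)
    then have "Re (u * (p - q)) = d + Re (u * (p - a)) - Re (u * (q - b))" by simp
    moreover have "\<bar>Re (u * (p - a))\<bar> \<le> d / 3"
      using abs_Re_le_cmod[of "u * (p - a)"] that(1) u1 by (simp add: norm_mult dist_norm)
    moreover have "\<bar>Re (u * (q - b))\<bar> \<le> d / 3"
      using abs_Re_le_cmod[of "u * (q - b)"] that(2) u1 by (simp add: norm_mult dist_norm)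
    ultimately show ?thesis by linarith
  qed
  obtain z where z: "\<forall>i\<in>J. if e i = 1 then dist (g i z) a \<le> d / 3 else dist (g i z) b \<le> d / 3"
    using sh[of "\<lambda>i. e i = 1"] unfolding d_def by blast
  obtain z' where z': "\<forall>i\<in>J. if e i \<noteq> 1 then dist (g i z') a \<le> d / 3 else dist (g i z') b \<le> d / 3"
    using sh[of "\<lambda>i. e i \<noteq> 1"] unfolding d_def by blast
  let ?S = "\<lambda>z. \<Sum>i\<in>J. complex_of_real (e i) * g i z"
  have "(\<Sum>i\<in>J. d / 3) \<le> (\<Sum>i\<in>J. e i * Re (u * (g i z - g i z')))"
  proof (rule sum_mono)
    fix i assume i: "i \<in> J"
    then have "e i = 1 \<or> e i = - 1" using e by (auto simp: signs_def dest: PiE_mem)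
    then show "d / 3 \<le> e i * Re (u * (g i z - g i z'))"
    proof
      assume ei: "e i = 1"
      then have "dist (g i z) a \<le> d / 3" "dist (g i z') b \<le> d / 3" using z z' i by force+
      then show ?thesis using key ei by simp
    next
      assume ei: "e i = - 1"
      have "dist (g i z) b \<le> d / 3" using bspec[OF z i] ei by simp
      moreover have "dist (g i z') a \<le> d / 3" using bspec[OF z' i] ei by simp
      ultimately have "Re (u * (g i z' - g i z)) \<ge> d / 3" by (intro key)
      moreover have "e i * Re (u * (g i z - g i z')) = Re (u * (g i z' - g i z))"
        unfolding ei by (simp add: algebra_simps)
      ultimately show ?thesis by simp
    qed
  qed
  also have "\<dots> = Re (\<Sum>i\<in>J. complex_of_real (e i) * (u * (g i z - g i z')))" by simp
  also have "(\<Sum>i\<in>J. complex_of_real (e i) * (u * (g i z - g i z'))) = u * (?S z - ?S z')"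
    by (simp add: sum_distrib_left sum_subtractf algebra_simps)
  also have "Re \<dots> \<le> cmod (u * (?S z - ?S z'))" by (rule complex_Re_le_cmod)
  also have "\<dots> \<le> cmod (?S z) + cmod (?S z')" by (simp add: norm_mult u1 norm_triangle_ineq4)
  finally have "real (card J) * (d / 3) \<le> cmod (?S z) + cmod (?S z')" by simp
  then have "cmod (?S z) \<ge> d / 6 * card J \<or> cmod (?S z') \<ge> d / 6 * card J" by (simp add: field_simps) linarith
  then show ?thesis unfolding d_def by blast
qed

text \<open>The exponent \<open>L\<close> is a fixed proportion of \<open>m\<close>, chosen so that
  the moment estimate loses to \<open>(l * m) ^ (2 * L)\<close> by a factor \<open>2 ^ L\<close>;
  hence \<open>2 ^ L \<le> r ^ 4\<close>.\<close>

lemma exponential_lower_bound: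
  fixes r m :: nat and \<kappa> l M :: real
  assumes l: "l > 0" and M: "M > 0" and \<kappa>: "\<kappa> = l\<^sup>2 / (24 * M\<^sup>2)" "\<kappa> \<le> 1" and m: "8 \<le> \<kappa> * real m"
    and bound: "\<And>L j. L = 4 * 2 ^ j \<Longrightarrow> L \<le> m \<Longrightarrow>
      (l * real m) ^ (2 * L) \<le> real r ^ 4 * (M ^ (2 * L) * (24 * real L * real m) ^ L)"
  shows "ln (real r) \<ge> \<kappa> * ln 2 / 16 * real m"
proof -
  have m0: "real m > 0" using m by (cases "m = 0") auto
  \<comment> \<open>The hypothesis \<open>8 \<le> \<kappa> * m\<close> makes room for an exponent of
    the form \<open>4 * 2 ^ j\<close>. It is at least \<open>\<kappa> * m / 4\<close>, which with
    the fourth power of \<open>r\<close> gives the 16 of the conclusion.\<close>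
  obtain j where j: "4 * 2 ^ j \<le> \<kappa> * real m / 2" "\<kappa> * real m / 2 < 8 * 2 ^ j"
    by (rule power_of_two_near[of "\<kappa> * real m / 2"]) (use m in auto)
  define L :: nat where "L = 4 * 2 ^ j"
  have L: "real L \<le> \<kappa> * real m / 2" "\<kappa> * real m / 4 \<le> real L" "real L > 0" using j by (auto simp: L_def)
  have "\<kappa> * real m \<le> 1 * real m" using \<kappa> by (intro mult_right_mono) auto
  then have "real L \<le> real m" using L by linarith
  then have Lm: "L \<le> m" by simp
  \<comment> \<open>The base of the moment bound. \<open>\<kappa>\<close> is defined so that
    \<open>L \<le> \<kappa> * m / 2\<close> means
    \<open>2 * D \<le> (l * m)\<^sup>2\<close>.\<close>
  define D where "D = M\<^sup>2 * (24 * real L * real m)"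
  have D: "D > 0" using M L m0 by (simp add: D_def)
  have "2 * D \<le> (l * real m)\<^sup>2"
  proof -
    have "2 * D = 48 * M\<^sup>2 * real m * real L" by (simp add: D_def)
    also have "\<dots> \<le> 48 * M\<^sup>2 * real m * (\<kappa> * real m / 2)" using L M m0 by (intro mult_left_mono) auto
    also have "\<dots> = (l * real m)\<^sup>2" unfolding \<kappa>(1) using M by (simp add: field_simps power2_eq_square)
    finally show ?thesis .
  qed
  then have "(2 * D) ^ L \<le> ((l * real m)\<^sup>2) ^ L" using D by (intro power_mono) auto
  also have "\<dots> = (l * real m) ^ (2 * L)" by (rule power_mult[symmetric])
  also have "\<dots> \<le> real r ^ 4 * (M ^ (2 * L) * (24 * real L * real m) ^ L)" by (rule bound[OF L_def Lm])
  also have "\<dots> = real r ^ 4 * D ^ L" by (simp add: D_def power_mult_distrib power_mult)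
  finally have "2 ^ L * D ^ L \<le> real r ^ 4 * D ^ L" by (simp add: power_mult_distrib)
  then have two: "2 ^ L \<le> real r ^ 4" using D by simp
  moreover have "(0::real) < 2 ^ L" by simp
  ultimately have "real r ^ 4 > 0" by linarith
  then have r: "real r > 0" by (cases "r = 0") auto
  have "real L * ln 2 = ln (2 ^ L)" by (simp add: ln_realpow)
  also have "\<dots> \<le> ln (real r ^ 4)" using two by (intro ln_mono) auto
  also have "\<dots> = 4 * ln (real r)" using r by (simp add: ln_realpow)
  finally have "real L * ln 2 \<le> 4 * ln (real r)" .
  moreover have "\<kappa> * real m / 4 * ln 2 \<le> real L * ln 2" using L by (intro mult_right_mono) auto
  ultimately have "\<kappa> * real m / 4 * ln 2 \<le> 4 * ln (real r)" by linarith
  then show ?thesis by (simp add: field_simps)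
qed

lemma ht_pos_if_separates_entropy_pair:
  fixes T :: "'x::metric_space \<Rightarrow> 'x"
    and \<pi> :: "('x \<Rightarrow> complex) \<Rightarrow> 'h::chilbert_space \<Rightarrow> 'h"
  assumes X: "compact (UNIV :: 'x set)" and T: "continuous_on UNIV T"
    and rep: "faithful_representation continuous_functions \<pi>" and f: "continuous_on UNIV f"
    and pair: "entropy_pair T x y" and ne: "f x \<noteq> f y"
  shows "ht continuous_functions \<pi> (induced_automorphism T) {f} > 0"
proof -
  define d where "d = dist (f x) (f y)"
  have d: "d > 0" using ne by (simp add: d_def)
  define U where "U = {z. dist (f z) (f x) > d / 3}"
  define V where "V = {z. dist (f z) (f y) > d / 3}"
  have op: "open U" "open V" unfolding U_def V_def by (intro open_Collect_less continuous_intros f)+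
  have UV: "U \<union> V = UNIV"
  proof (rule ccontr)
    assume "U \<union> V \<noteq> UNIV"
    then obtain z where "z \<notin> U" "z \<notin> V" by blast
    then have "dist (f z) (f x) \<le> d / 3" "dist (f z) (f y) \<le> d / 3" by (auto simp: U_def V_def)
    then show False using dist_triangle3[of "f x" "f y" "f z"] d unfolding d_def by linarith
  qed
  have int: "z \<in> interior (- {w. dist (f w) (f z) > d / 3})" for z
  proof (rule interiorI)
    show "open {w. dist (f w) (f z) < d / 3}" by (intro open_Collect_less continuous_intros f)
  qed (use d in auto)
  have "y \<in> U" "y \<notin> V" using d by (auto simp: U_def V_def dist_commute d_def)
  then have "U \<noteq> V" by blast
  then have "card {U, V} = 2" by simp
  then have h: "h_top T {U, V} > 0"
  proof -
    have "x \<in> interior (- U)" "y \<in> interior (- V)" using int[of x] int[of y] by (simp_all add: U_def V_def)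
    then show ?thesis using pair op UV \<open>card {U, V} = 2\<close> unfolding entropy_pair_def by blast
  qed
  obtain c :: real where c: "c > 0" and ev: "\<forall>\<^sub>F n in sequentially. \<exists>J\<subseteq>{..<n}. real (card J) \<ge> c * real n \<and>
       (\<forall>\<sigma>. \<exists>z. \<forall>i\<in>J. (T ^^ i) z \<notin> (if \<sigma> i then U else V))"
    by (rule positive_entropy_independence[OF UV h])
  \<comment> \<open>The summand \<open>d\<close> ensures \<open>M > 0\<close> and
    \<open>l \<le> M\<close>, from which \<open>\<kappa> \<le> 1\<close> follows.\<close>
  define M where "M = cnorm continuous_functions f + d"
  \<comment> \<open>The signed sums reach \<open>d / 6\<close> per function. One half of this is
    given up to the approximation error, which is also \<open>d / 12\<close>, and the other half is
    \<open>l\<close>.\<close>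
  define l where "l = d / 12"
  define \<kappa> where "\<kappa> = l\<^sup>2 / (24 * M\<^sup>2)"
  have fM: "cmod (f z) \<le> M" for z
    using cmod_le_cnorm_continuous_functions[OF X f, of z] d by (simp add: M_def)
  have M: "M > 0" "l \<le> M" using d norm_ge_zero[of "f x"] cmod_le_cnorm_continuous_functions[OF X f, of x]
    unfolding M_def l_def by linarith+
  have l: "l > 0" using d by (simp add: l_def)
  have \<kappa>: "\<kappa> > 0" "\<kappa> \<le> 1"
  proof -
    show "\<kappa> > 0" using l M by (simp add: \<kappa>_def)
    have "l\<^sup>2 \<le> M\<^sup>2" using M l by (intro power_mono) auto
    then have "l\<^sup>2 \<le> 24 * M\<^sup>2" using zero_le_power2[of M] by linarith
    then show "\<kappa> \<le> 1" using M by (simp add: \<kappa>_def divide_le_eq)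
  qed
  define c' where "c' = \<kappa> * ln 2 / 16 * c"
  have c': "c' > 0" using \<kappa> c by (simp add: c'_def)
  let ?rcp = "\<lambda>n. rcp continuous_functions \<pi> (orbit_set T f n) (d / 12)"
  \<comment> \<open>Beyond \<open>n0\<close> the independence set, of density at least
    \<open>c\<close>, has at least \<open>8 / \<kappa>\<close> elements.\<close>
  obtain n0 :: nat where n0: "8 / (\<kappa> * c) < real n0" using reals_Archimedean2 by blast
  have "\<forall>\<^sub>F n in sequentially. ereal c' \<le> ereal (ln (real (?rcp n)) / real n)"
    using ev eventually_ge_at_top[of "max 1 n0"]
  proof eventually_elim
    case (elim n)
    then have n: "n \<ge> 1" "n \<ge> n0" by auto
    obtain J where J: "J \<subseteq> {..<n}" "c * real n \<le> real (card J)"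
      and sh: "\<forall>\<sigma>. \<exists>z. \<forall>i\<in>J. (T ^^ i) z \<notin> (if \<sigma> i then U else V)" using elim(1) by blast
    have finJ: "finite J" using J(1) finite_subset by blast
    \<comment> \<open>Nonemptiness makes the infimum \<open>rcp\<close> an attained rank. A net of
      radius \<open>d / 48\<close> gives oscillation at most \<open>d / 24\<close>, strictly below
      the tolerance \<open>d / 12\<close>.\<close>
    have "rcp_ranks continuous_functions \<pi> (orbit_set T f n) (d / 12) \<noteq> {}"
    proof -
      obtain C where C: "finite C" "\<And>x. \<exists>c\<in>C. dist (f x) c < d / 48"
        using finite_net_of_range[OF X f, of "d / 48"] d by auto
      let ?W = "(\<lambda>c. {z. dist (f z) c < d / 48}) ` C"
      have "\<exists>r\<in>rcp_ranks continuous_functions \<pi> (orbit_set T f n) (d / 12). r \<le> cover_number (cover_iterate T ?W n)"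
      proof (rule rcp_ranks_orbit_le_cover_number[OF X T rep f, of ?W "d / 24"])
        show "finite ?W" using C by simp
        show "\<Union>?W = UNIV" using C(2) by blast
        show "open W" if "W \<in> ?W" for W
          using that by (auto intro!: open_Collect_less continuous_intros f)
        fix W a b assume "W \<in> ?W" "a \<in> W" "b \<in> W"
        then obtain c where "dist (f a) c < d / 48" "dist (f b) c < d / 48" by blast
        then have "dist (f a) (f b) \<le> d / 24" using dist_triangle2[of "f a" "f b" c] by simp
        then show "cmod (f a - f b) \<le> d / 24" by (simp add: dist_norm)
      qed (use d in simp)
      then show ?thesis by blast
    qed
    then have r: "?rcp n \<in> rcp_ranks continuous_functions \<pi> (orbit_set T f n) (d / 12)"
      unfolding rcp_eq_Inf by (rule Inf_nat_def1)
    have big: "\<exists>z. cmod (\<Sum>i\<in>J. of_real (e i) * (f \<circ> (T ^^ i)) z) \<ge> (d / 12 + l) * card J" if e: "e \<in> signs J" for e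
    proof -
      have "\<exists>z. cmod (\<Sum>i\<in>J. of_real (e i) * (f \<circ> (T ^^ i)) z) \<ge> dist (f x) (f y) / 6 * card J"
      proof (rule large_signed_sum[OF finJ e ne])
        fix \<sigma> :: "nat \<Rightarrow> bool"
        from sh obtain z where z: "\<forall>i\<in>J. (T ^^ i) z \<notin> (if \<sigma> i then U else V)" by blast
        have "if \<sigma> i then dist ((f \<circ> (T ^^ i)) z) (f x) \<le> dist (f x) (f y) / 3
            else dist ((f \<circ> (T ^^ i)) z) (f y) \<le> dist (f x) (f y) / 3" if "i \<in> J" for i
          using bspec[OF z that] by (auto simp: U_def V_def d_def split: if_splits)
        then show "\<exists>z. \<forall>i\<in>J. if \<sigma> i then dist ((f \<circ> (T ^^ i)) z) (f x) \<le> dist (f x) (f y) / 3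
            else dist ((f \<circ> (T ^^ i)) z) (f y) \<le> dist (f x) (f y) / 3" by blast
      qed
      then show ?thesis by (simp add: l_def d_def)
    qed
    have mult: "8 \<le> \<kappa> * real (card J)"
    proof -
      have "8 < real n0 * (\<kappa> * c)" using n0 \<kappa> c by (simp add: divide_less_eq)
      also have "\<dots> \<le> real n * (\<kappa> * c)" using n \<kappa> c by (intro mult_right_mono) auto
      also have "\<dots> = \<kappa> * (c * real n)" by simp
      also have "\<dots> \<le> \<kappa> * real (card J)" using J \<kappa> by (intro mult_left_mono) auto
      finally show ?thesis by simp
    qed
    have "\<kappa> * ln 2 / 16 * real (card J) \<le> ln (real (?rcp n))"
    proof (rule exponential_lower_bound[OF l M(1) \<kappa>_def \<kappa>(2) mult])
      fix L j :: nat assume L: "L = 4 * 2 ^ j" "L \<le> card J"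
      show "(l * real (card J)) ^ (2 * L) \<le> real (?rcp n) ^ 4 * (M ^ (2 * L) * (24 * real L * real (card J)) ^ L)"
      proof (rule rcp_ranks_lower_bound[OF X rep r finJ _ _ _ _ big _ L])
        show "continuous_on UNIV (f \<circ> (T ^^ i))" for i by (rule continuous_on_orbit[OF T f])
        show "f \<circ> (T ^^ i) \<in> orbit_set T f n" if "i \<in> J" for i using that J by (auto simp: orbit_set_eq)
        show "cmod ((f \<circ> (T ^^ i)) z) \<le> M" for i z using fM by simp
      qed (use M l in auto)
    qed
    moreover have "c' * real n \<le> \<kappa> * ln 2 / 16 * real (card J)"
      using mult_left_mono[OF J(2), of "\<kappa> * ln 2 / 16"] \<kappa> by (simp add: c'_def mult.assoc)
    ultimately have "c' * real n \<le> ln (real (?rcp n))" by linarith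
    then show ?case using n by (simp add: le_divide_eq)
  qed
  then have "ereal c' \<le> limsup (\<lambda>n. ereal (ln (real (?rcp n)) / real n))" by (intro le_Limsup) simp_all
  also have "\<dots> \<le> ht continuous_functions \<pi> (induced_automorphism T) {f}"
    unfolding ht_def orbit_set_def[symmetric] using d by (intro SUP_upper) simp
  finally have "ereal c' \<le> ht continuous_functions \<pi> (induced_automorphism T) {f}" .
  moreover have "0 < ereal c'" using c' by simp
  ultimately show ?thesis by (rule less_le_trans[rotated])
qed

theorem theorem4p3:
  fixes T T' :: "'x::metric_space \<Rightarrow> 'x"
    and \<pi> :: "('x \<Rightarrow> complex) \<Rightarrow> 'h::chilbert_space \<Rightarrow> 'h"
  assumes "compact (UNIV :: 'x set)"
    and "homeomorphism UNIV UNIV T T'"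
    and "faithful_representation continuous_functions \<pi>"
  shows "pinsker_algebra T =
    {f \<in> carrier continuous_functions.
       ht continuous_functions \<pi> (induced_automorphism T) {f} = 0}"
proof -
  have T: "continuous_on UNIV T" using assms(2) by (simp add: homeomorphism_def)
  have "f \<in> pinsker_algebra T \<longleftrightarrow> ht continuous_functions \<pi> (induced_automorphism T) {f} = 0"
    if f: "continuous_on UNIV f" for f
  proof
    assume "f \<in> pinsker_algebra T"
    then show "ht continuous_functions \<pi> (induced_automorphism T) {f} = 0"
      by (intro ht_zero_if_constant_on_entropy_pairs[OF assms(1) T assms(3) f])
        (simp add: pinsker_algebra_def)
  next
    assume "ht continuous_functions \<pi> (induced_automorphism T) {f} = 0"
    then have "f x = f y" if "entropy_pair T x y" for x y
      using ht_pos_if_separates_entropy_pair[OF assms(1) T assms(3) f that] by fastforce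
    then show "f \<in> pinsker_algebra T" using f by (simp add: pinsker_algebra_def)
  qed
  then show ?thesis by (auto simp: pinsker_algebra_def continuous_functions_def)
qed

end
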